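(* Let $S$ and $S'$ be composition series of finite groups of order $n$ such that $\alpha$ is an upper bound for the order of any factor (of $S$ or of $S'$). Then we can test if $S \cong S'$ in $n^{O(\alpha)}$ time.
   Context: Groups are given by multiplication tables, and a composition series by its chain of subgroups. A composition series of a group $G$ is a maximal subnormal series $G_0 = 1 \triangleleft \cdots \triangleleft G_m = G$; its factors are the groups $G_{i+1}/G_i$. Two composition series $G_0 = 1 \triangleleft \cdots \triangleleft G_m = G$ and $H_0 = 1 \triangleleft \cdots \triangleleft H_{m'} = H$ are isomorphic if there is a group isomorphism $\phi : G \to H$ with $\phi[G_i] = H_i$ for each $i$ (in particular $m=m'$). The constant in $O(\cdot)$ is absolute. *)

theory Defs
  imports "HOL-Algebra.Algebra" "HOL-Library.Sublist"
begin

section \<open>Computation model\<close>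

text \<open>
  Time is measured for programs of a first-order, call-by-value functional language over binary
  trees (the language F of N. D. Jones, Computability and Complexity from a Programming
  Perspective). There are no numbers and no comparison of trees among the primitives: besides
  control flow, a program can build a node, take a subtree and test for the empty tree. Each
  evaluation of an expression node is charged one step, so (trees being passed as pointers) step
  counts agree with Turing machine and RAM running times up to a polynomial. As the bound of
  interest, $n^{O(\alpha)}$, is closed under polynomial overheads, it does not depend on the choice
  among these models.
\<close>

datatype tree = Leaf | Node tree tree

fun left :: "tree \<Rightarrow> tree" where
  "left Leaf = Leaf"
| "left (Node a b) = a"

fun right :: "tree \<Rightarrow> tree" where
  "right Leaf = Leaf"
| "right (Node a b) = b"

text \<open>
  Variables are de Bruijn indices: \<open>VarE i\<close> is the \<open>i\<close>-th entry of the current environment, and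
  \<open>LetE\<close> adds an entry at the front. \<open>CallE f es\<close> calls the \<open>f\<close>-th function of the program, whose
  body is evaluated in the environment made up of the argument values alone.
\<close>

datatype expr =
    VarE nat
  | LeafE
  | NodeE expr expr
  | LeftE expr
  | RightE expr
  | IfE expr expr expr
  | LetE expr expr
  | CallE nat "expr list"

type_synonym prog = "expr list"

text \<open>\<open>eval p env e v t\<close>: in the program \<open>p\<close>, the expression \<open>e\<close> evaluates to \<open>v\<close> in exactly \<open>t\<close> steps.\<close>

inductive eval :: "prog \<Rightarrow> tree list \<Rightarrow> expr \<Rightarrow> tree \<Rightarrow> nat \<Rightarrow> bool"
  and evals :: "prog \<Rightarrow> tree list \<Rightarrow> expr list \<Rightarrow> tree list \<Rightarrow> nat \<Rightarrow> bool"
  for p :: prog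
where
  VarE: "i < length env \<Longrightarrow> eval p env (VarE i) (env ! i) 1"
| LeafE: "eval p env LeafE Leaf 1"
| NodeE: "\<lbrakk>eval p env e1 v1 t1; eval p env e2 v2 t2\<rbrakk>
    \<Longrightarrow> eval p env (NodeE e1 e2) (Node v1 v2) (1 + t1 + t2)"
| LeftE: "eval p env e v t \<Longrightarrow> eval p env (LeftE e) (left v) (1 + t)"
| RightE: "eval p env e v t \<Longrightarrow> eval p env (RightE e) (right v) (1 + t)"
| IfTrueE: "\<lbrakk>eval p env e u t; u \<noteq> Leaf; eval p env e1 v t1\<rbrakk>
    \<Longrightarrow> eval p env (IfE e e1 e2) v (1 + t + t1)"
| IfFalseE: "\<lbrakk>eval p env e Leaf t; eval p env e2 v t2\<rbrakk>
    \<Longrightarrow> eval p env (IfE e e1 e2) v (1 + t + t2)"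
| LetE: "\<lbrakk>eval p env e1 v1 t1; eval p (v1 # env) e2 v t2\<rbrakk>
    \<Longrightarrow> eval p env (LetE e1 e2) v (1 + t1 + t2)"
| CallE: "\<lbrakk>f < length p; evals p env es vs t1; eval p vs (p ! f) v t2\<rbrakk>
    \<Longrightarrow> eval p env (CallE f es) v (1 + t1 + t2)"
| NilE: "evals p env [] [] 0"
| ConsE: "\<lbrakk>eval p env e v t1; evals p env es vs t2\<rbrakk>
    \<Longrightarrow> evals p env (e # es) (v # vs) (t1 + t2)"

lemma eval_deterministic:
  "eval p env e v t \<Longrightarrow> eval p env e v' t' \<Longrightarrow> v' = v \<and> t' = t"
  "evals p env es vs s \<Longrightarrow> evals p env es vs' s' \<Longrightarrow> vs' = vs \<and> s' = s"
proof (induction arbitrary: v' t' and vs' s' rule: eval_evals.inducts)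
  case (VarE i env) from VarE.prems show ?case by cases auto
next
  case (LeafE env) from LeafE.prems show ?case by cases auto
next
  case (NodeE env e1 v1 t1 e2 v2 t2) from NodeE.prems NodeE.IH show ?case by cases blast
next
  case (LeftE env e v t) from LeftE.prems LeftE.IH show ?case by cases blast
next
  case (RightE env e v t) from RightE.prems RightE.IH show ?case by cases blast
next
  case (IfTrueE env e u t e1 v t1 e2)
  from IfTrueE.prems IfTrueE.IH IfTrueE.hyps show ?case by cases blast+
next
  case (IfFalseE env e t e2 v t2 e1)
  from IfFalseE.prems IfFalseE.IH show ?case by cases blast+
next
  case (LetE env e1 v1 t1 e2 v t2) from LetE.prems LetE.IH show ?case by cases blast
next
  case (CallE f env es vs t1 v t2) from CallE.prems CallE.IH show ?case by cases blast
next
  case (NilE env) from NilE.prems show ?case by cases auto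
next
  case (ConsE env e v t1 es vs t2) from ConsE.prems ConsE.IH show ?case by cases blast
qed

text \<open>The function with index \<open>0\<close> is the main function; it takes the whole input as its only argument.\<close>

definition computes :: "prog \<Rightarrow> tree \<Rightarrow> tree \<Rightarrow> nat \<Rightarrow> bool" where
  "computes p x v t \<longleftrightarrow> p \<noteq> [] \<and> eval p [x] (p ! 0) v t"

text \<open>
  Decision with output convention: \<open>Leaf\<close> means "no", every other output means "yes".
\<close>

definition decides_within :: "prog \<Rightarrow> tree \<Rightarrow> bool \<Rightarrow> nat \<Rightarrow> bool" where
  "decides_within p x b T \<longleftrightarrow> (\<exists>v t. computes p x v t \<and> (v \<noteq> Leaf \<longleftrightarrow> b) \<and> t \<le> T)"


section \<open>Composition series\<close>

text \<open>
  A series is the list of its members, \<open>S ! i\<close> being the subgroup with index \<open>i\<close>. All inclusions are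
  proper; otherwise no series would be maximal.
\<close>

definition subnormal_series :: "('a, 'b) monoid_scheme \<Rightarrow> 'a set list \<Rightarrow> bool" where
  "subnormal_series G S \<longleftrightarrow>
     S \<noteq> [] \<and> hd S = {\<one>\<^bsub>G\<^esub>} \<and> last S = carrier G \<and>
     (\<forall>i. Suc i < length S \<longrightarrow>
        S ! i \<lhd> G\<lparr>carrier := S ! Suc i\<rparr> \<and> S ! i \<noteq> S ! Suc i)"

definition composition_series :: "('a, 'b) monoid_scheme \<Rightarrow> 'a set list \<Rightarrow> bool" where
  "composition_series G S \<longleftrightarrow>
     subnormal_series G S \<and> (\<forall>T. subnormal_series G T \<and> subseq S T \<longrightarrow> T = S)"

definition series_factors :: "('a, 'b) monoid_scheme \<Rightarrow> 'a set list \<Rightarrow> 'a set monoid set" where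
  "series_factors G S = {G\<lparr>carrier := S ! Suc i\<rparr> Mod (S ! i) | i. Suc i < length S}"

definition series_isomorphic ::
  "('a, 'c) monoid_scheme \<Rightarrow> 'a set list \<Rightarrow> ('b, 'd) monoid_scheme \<Rightarrow> 'b set list \<Rightarrow> bool" where
  "series_isomorphic G S H S' \<longleftrightarrow>
     length S = length S' \<and> (\<exists>\<phi> \<in> iso G H. \<forall>i < length S. \<phi> ` (S ! i) = S' ! i)"


section \<open>Encoding of the input\<close>

text \<open>
  A group of order \<open>n\<close> is presented by its multiplication table after its elements have been named
  \<open>0, \<dots>, n - 1\<close>, that is, it has carrier \<open>{..<n}\<close> (no particular element is the identity).
  Numbers are written in unary, which costs only a polynomial in \<open>n\<close>.
\<close>

fun enc_nat :: "nat \<Rightarrow> tree" where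
  "enc_nat 0 = Leaf"
| "enc_nat (Suc k) = Node Leaf (enc_nat k)"

definition enc_list :: "('a \<Rightarrow> tree) \<Rightarrow> 'a list \<Rightarrow> tree" where
  "enc_list f xs = foldr (\<lambda>x t. Node (f x) t) xs Leaf"

definition mult_table :: "nat monoid \<Rightarrow> nat list list" where
  "mult_table G = map (\<lambda>x. map (\<lambda>y. x \<otimes>\<^bsub>G\<^esub> y) [0..<order G]) [0..<order G]"

definition enc_group :: "nat monoid \<Rightarrow> tree" where
  "enc_group G = enc_list (enc_list enc_nat) (mult_table G)"

definition enc_series :: "nat set list \<Rightarrow> tree" where
  "enc_series S = enc_list (\<lambda>A. enc_list enc_nat (sorted_list_of_set A)) S"

definition enc_input :: "nat monoid \<Rightarrow> nat set list \<Rightarrow> nat monoid \<Rightarrow> nat set list \<Rightarrow> tree" where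
  "enc_input G S H S' =
     enc_list (\<lambda>x. x) [enc_group G, enc_series S, enc_group H, enc_series S']"

end

theory Submission
  imports Defs
begin

text \<open>
  Number the elements so that the members of both series become initial segments of \<open>{..<n}\<close>; this is
  possible with the same cardinalities in both groups unless the answer is "no". Along the series the
  algorithm maintains generators of the group of automorphisms of the partial series of \<open>G\<close>, and a renaming
  of \<open>H\<close> whose table agrees with that of \<open>G\<close> on the current member \<open>G\<^sub>i\<close>.

  Let \<open>T\<close> be a set of representatives of the cosets of \<open>G\<^sub>i\<close> in \<open>G\<^sub>i\<^sub>+\<^sub>1\<close>; it has at most \<open>\<alpha>\<close> elements,
  so all tuples \<open>y\<close> of possible images of \<open>T\<close> can be tried. An isomorphism of the partial series extends to
  \<open>G\<^sub>i\<^sub>+\<^sub>1\<close> with prescribed values \<open>y\<close> if and only if it transports the maps \<open>x \<mapsto> c\<inverse> a x b\<close>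
  (\<open>a\<close>, \<open>b\<close>, \<open>c\<close> in \<open>T\<close>, with \<open>c\<close> representing \<open>a b\<close>) from \<open>G\<^sub>i\<close> to itself to the corresponding maps for \<open>y\<close>.
  For each of these maps, its restrictions to \<open>G\<^sub>0\<close>, \<open>G\<^sub>1\<close>, \<open>\<dots>\<close>, \<open>G\<^sub>i\<close> are transported one after the other by an
  orbit computation with Schreier generators of the stabilizers. The orbits are short: the maps are affine,
  so once the restriction to \<open>G\<^sub>j\<close> is fixed, the restriction to \<open>G\<^sub>j\<^sub>+\<^sub>1\<close> is determined by its values on at most \<open>\<alpha>\<close>
  coset representatives, and hence has at most \<open>n\<^sup>\<alpha>\<close> images. Schreier generators are thinned out to at most \<open>n\<^sup>2\<close>
  after each step. In total, polynomially many steps in \<open>n\<close> and \<open>n\<^sup>\<alpha>\<close> suffice.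
\<close>

section \<open>A calculus of polynomial-time functions for the tree language\<close>

section \<open>Linking programs\<close>

text \<open>The program is not told \<alpha>. It computes M = n^m in unary, where m is the largest
  index of consecutive members, and all other work is polynomial in the input together with M. M
  bounds the orbits, the number of search rounds and the number of tuples y.

  The group of automorphisms cannot be enumerated, so the next one has to be reached through
  generators. Two isomorphisms with the same values on \<open>T\<close> differ by an automorphism
  that fixes \<open>T\<close> pointwise, and every such automorphism has the form t z -> t u(z),
  with u in the stabilizer of the transported maps. Hence one extension for each y, together with
  the lifts of generators of that stabilizer, generates the automorphism group of the next member.

  Renaming the second group along any extension found loses nothing, since the renamed table and the
  old one are isomorphic together with their chains. Once the tables agree on the current member,
  the isomorphisms sought restrict there to automorphisms, that is, to elements of a group given by
  generators. This is why a search in permutation groups suffices.\<close>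

primrec shift_calls :: "nat \<Rightarrow> expr \<Rightarrow> expr" where
  "shift_calls k (VarE i) = VarE i"
| "shift_calls k LeafE = LeafE"
| "shift_calls k (NodeE a b) = NodeE (shift_calls k a) (shift_calls k b)"
| "shift_calls k (LeftE a) = LeftE (shift_calls k a)"
| "shift_calls k (RightE a) = RightE (shift_calls k a)"
| "shift_calls k (IfE a b c) = IfE (shift_calls k a) (shift_calls k b) (shift_calls k c)"
| "shift_calls k (LetE a b) = LetE (shift_calls k a) (shift_calls k b)"
| "shift_calls k (CallE f es) = CallE (k + f) (map (shift_calls k) es)"

lemma eval_callI:
  assumes "evals p env es vs t1" "eval p vs (p ! f) v t2" "f < length p" "t = 1 + t1 + t2"
  shows "eval p env (CallE f es) v t"
  using eval_evals.CallE[OF assms(3,1,2)] assms(4) by simp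

text \<open>A function body sees only its arguments, so relocating it changes call indices and
  nothing else; step counts are preserved exactly.\<close>

lemma eval_shift_calls:
  assumes "P = pre @ map (shift_calls (length pre)) q @ post"
  shows "eval q env e v t \<Longrightarrow> eval P env (shift_calls (length pre) e) v t"
    "evals q env es vs t' \<Longrightarrow> evals P env (map (shift_calls (length pre)) es) vs t'"
proof (induction rule: eval_evals.inducts)
  case (CallE f env es vs t1 v t2)
  have "P ! (length pre + f) = shift_calls (length pre) (q ! f)"
    using CallE by (simp add: assms nth_append)
  moreover have "length pre + f < length P" using CallE by (simp add: assms)
  ultimately show ?case using CallE by (auto intro!: eval_callI)
qed (simp_all only: shift_calls.simps list.map, (blast intro: eval_evals.intros)+)

text \<open>The glue \<open>m\<close> stays at the front and is not shifted, so its calls must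
  already use absolute positions: \<open>p\<close> starts at \<open>length m\<close> and
  \<open>q\<close> at \<open>length m + length p\<close>.\<close>

definition link2 :: "prog \<Rightarrow> prog \<Rightarrow> prog \<Rightarrow> prog" where
  "link2 m p q = m @ map (shift_calls (length m)) p @ map (shift_calls (length m + length p)) q"

lemma eval_link2_fst:
  assumes "computes p x v t" "eval (link2 m p q) env e x s"
  shows "eval (link2 m p q) env (CallE (length m) [e]) v (1 + s + t)"
proof -
  have *: "eval p [x] (p ! 0) v t" "p \<noteq> []" using assms by (auto simp: computes_def)
  have "eval (link2 m p q) [x] (shift_calls (length m) (p ! 0)) v t"
    by (rule eval_shift_calls(1)[OF _ *(1)]) (simp add: link2_def)
  moreover have "link2 m p q ! length m = shift_calls (length m) (p ! 0)"
    using *(2) by (simp add: link2_def nth_append)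
  moreover have "length m < length (link2 m p q)" using *(2) by (simp add: link2_def)
  moreover have "evals (link2 m p q) env [e] [x] (s + 0)"
    using eval_evals.ConsE[OF assms(2) eval_evals.NilE] .
  ultimately show ?thesis by (auto intro!: eval_callI)
qed

lemma eval_link2_snd:
  assumes "computes q x v t" "eval (link2 m p q) env e x s"
  shows "eval (link2 m p q) env (CallE (length m + length p) [e]) v (1 + s + t)"
proof -
  have "link2 m p q = link2 (m @ map (shift_calls (length m)) p) q []"
    by (simp add: link2_def)
  then show ?thesis
    using eval_link2_fst[of q x v t "m @ map (shift_calls (length m)) p" "[]" env e s] assms by simp
qed


section \<open>Encodable types\<close>

text \<open>Programs compare trees; injectivity is what turns this into a test for equality of the
  encoded values in \<open>polytime_eq0\<close>.\<close>

class tree_enc =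
  fixes enc :: "'a \<Rightarrow> tree"
  assumes enc_inject: "enc x = enc y \<Longrightarrow> x = y"

instantiation tree :: tree_enc
begin
definition enc_tree_def: "enc (t :: tree) = t"
instance by standard (simp add: enc_tree_def)
end

instantiation nat :: tree_enc
begin
definition enc_nat_def: "enc (k :: nat) = enc_nat k"
instance
proof
  fix x y :: nat
  have "enc_nat x = enc_nat y \<Longrightarrow> x = y" for y
  proof (induction x arbitrary: y)
    case 0 then show ?case by (cases y) auto
  next
    case (Suc x) then show ?case by (cases y) auto
  qed
  then show "enc x = enc y \<Longrightarrow> x = y" by (simp add: enc_nat_def)
qed
end

instantiation prod :: (tree_enc, tree_enc) tree_enc
begin
definition enc_prod_def: "enc p = Node (enc (fst p)) (enc (snd p))"
instance by standard (auto simp: enc_prod_def prod_eq_iff dest: enc_inject)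
end

instantiation list :: (tree_enc) tree_enc
begin
definition enc_list_def': "enc (xs :: 'a list) = enc_list enc xs"
instance
proof
  fix xs ys :: "'a list"
  have "enc_list enc xs = enc_list enc ys \<Longrightarrow> xs = ys" for ys
  proof (induction xs arbitrary: ys)
    case Nil then show ?case by (cases ys) (auto simp: enc_list_def)
  next
    case (Cons x xs) then show ?case by (cases ys) (auto simp: enc_list_def dest: enc_inject)
  qed
  then show "enc xs = enc ys \<Longrightarrow> xs = ys" by (simp add: enc_list_def')
qed
end

instantiation unit :: tree_enc
begin
definition enc_unit_def: "enc (u :: unit) = Leaf"
instance by standard simp
end

instantiation bool :: tree_enc
begin
definition enc_bool_def: "enc b = (if b then Node Leaf Leaf else Leaf)"
instance by standard (auto simp: enc_bool_def split: if_splits)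
end

lemma enc_simps [simp]:
  "enc (a, b) = Node (enc a) (enc b)"
  "enc ([] :: 'a :: tree_enc list) = Leaf"
  "enc (x # xs) = Node (enc x) (enc xs)"
  "enc () = Leaf"
  "enc True = Node Leaf Leaf"
  "enc False = Leaf"
  "enc (0 :: nat) = Leaf"
  "enc (Suc k) = Node Leaf (enc k)"
  by (simp_all add: enc_prod_def enc_list_def' enc_list_def enc_bool_def enc_nat_def enc_unit_def)

text \<open>The offset ensures \<open>2 \<le> sz x\<close>. Constants and coefficients can then be
  absorbed by the exponent, so a single power \<open>sz x ^ c\<close> is general enough as a
  polynomial bound.\<close>

definition sz :: "'a :: tree_enc \<Rightarrow> nat" where
  "sz x = size (enc x) + 2"

lemma sz_ge_2 [simp]: "2 \<le> sz x" by (simp add: sz_def)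

lemma sz_pos [simp]: "0 < sz x" by (simp add: sz_def)

lemma sz_ge_1 [simp]: "Suc 0 \<le> sz x" by (simp add: sz_def)

lemma sz_Pair: "sz (a, b) + 1 = sz a + sz b" by (simp add: sz_def)

lemma sz_Nil [simp]: "sz [] = 2" by (simp add: sz_def)

lemma sz_Cons: "sz (a # l) + 1 = sz a + sz l" by (simp add: sz_def)

lemma sz_fst_le: "sz (fst p) \<le> sz p" and sz_snd_le: "sz (snd p) \<le> sz p"
  by (cases p; simp add: sz_def)+

lemma sz_nat: "sz (k :: nat) = k + 2"
  by (induction k) (simp_all add: sz_def)

lemma sz_bool_le: "sz (b :: bool) \<le> 3"
  by (cases b) (simp_all add: sz_def)

lemma sz_elem_le: "e \<in> set l \<Longrightarrow> sz e \<le> sz l"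
proof (induction l)
  case (Cons a l)
  have "sz a \<le> sz (a # l)" "sz l \<le> sz (a # l)"
    using sz_Cons[of a l] sz_ge_2[of a] sz_ge_2[of l] by linarith+
  with Cons show ?case by (auto intro: order_trans)
qed simp

lemma length_less_sz: "length l < sz l"
proof (induction l)
  case (Cons a l)
  then show ?case using sz_Cons[of a l] sz_ge_2[of a] unfolding length_Cons by linarith
qed simp

lemma sz_list_le: "(\<And>e. e \<in> set l \<Longrightarrow> sz e \<le> B) \<Longrightarrow> sz l \<le> 2 + length l * B"
proof (induction l)
  case (Cons a l)
  then have "sz a \<le> B" "sz l \<le> 2 + length l * B" by auto
  then show ?case using sz_Cons[of a l] by simp
qed simp

lemma sz_take_le: "sz (take k l) \<le> sz l"
proof (induction l arbitrary: k)
  case (Cons a l)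
  show ?case
  proof (cases k)
    case (Suc j)
    then show ?thesis using sz_Cons[of a l] sz_Cons[of a "take j l"] Cons[of j] by simp
  qed (simp add: sz_def)
qed simp


section \<open>Polynomial bounds and polynomial time\<close>

definition poly_bounded :: "('a :: tree_enc \<Rightarrow> nat) \<Rightarrow> bool" where
  "poly_bounded h \<longleftrightarrow> (\<exists>c. \<forall>x. h x \<le> sz x ^ c)"

lemma poly_boundedI: "(\<And>x. h x \<le> sz x ^ c) \<Longrightarrow> poly_bounded h"
  by (auto simp: poly_bounded_def)

lemma poly_bounded_mono: "poly_bounded h \<Longrightarrow> (\<And>x. g x \<le> h x) \<Longrightarrow> poly_bounded g"
  by (meson poly_bounded_def order_trans)

lemma poly_bounded_const: "poly_bounded (\<lambda>_. k)"
proof (rule poly_boundedI)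
  fix x :: 'a
  have "k \<le> 2 ^ k" using less_exp[of k] by simp
  also have "\<dots> \<le> sz x ^ k" by (rule power_mono) auto
  finally show "k \<le> sz x ^ k" .
qed

lemma poly_bounded_add:
  fixes g h :: "'a :: tree_enc \<Rightarrow> nat"
  assumes "poly_bounded g" "poly_bounded h" shows "poly_bounded (\<lambda>x. g x + h x)"
proof -
  obtain c d where *: "\<And>x. g x \<le> sz x ^ c" "\<And>x. h x \<le> sz x ^ d"
    using assms by (auto simp: poly_bounded_def)
  show ?thesis
  proof (rule poly_boundedI)
    fix x :: 'a
    have "g x + h x \<le> sz x ^ (c + d) + sz x ^ (c + d)"
      by (intro add_mono order_trans[OF *(1)] order_trans[OF *(2)] power_increasing) auto
    also have "\<dots> = 2 * sz x ^ (c + d)" by simp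
    also have "\<dots> \<le> sz x * sz x ^ (c + d)" by (intro mult_mono) auto
    finally show "g x + h x \<le> sz x ^ (Suc (c + d))" by simp
  qed
qed

lemma poly_bounded_mult:
  assumes "poly_bounded g" "poly_bounded h" shows "poly_bounded (\<lambda>x. g x * h x)"
proof -
  obtain c d where *: "\<And>x. g x \<le> sz x ^ c" "\<And>x. h x \<le> sz x ^ d"
    using assms by (auto simp: poly_bounded_def)
  show ?thesis
    by (rule poly_boundedI[of _ "c + d"]) (auto simp: power_add intro: mult_mono *)
qed

lemma poly_bounded_power: "poly_bounded g \<Longrightarrow> poly_bounded (\<lambda>x. g x ^ k)"
  by (induction k) (auto intro: poly_bounded_const poly_bounded_mult)

definition time_bounded :: "('a :: tree_enc \<Rightarrow> 'b :: tree_enc) \<Rightarrow> ('a \<Rightarrow> nat) \<Rightarrow> bool" where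
  "time_bounded f T \<longleftrightarrow> (\<exists>p. \<forall>x. \<exists>t\<le>T x. computes p (enc x) (enc (f x)) t)"

lemma time_bounded_mono: "time_bounded f T \<Longrightarrow> (\<And>x. T x \<le> U x) \<Longrightarrow> time_bounded f U"
  unfolding time_bounded_def by (meson order_trans)

text \<open>
  Values are shared in memory, so that a fast program may output an exponentially large tree;
  closure under composition needs a bound on the output size in addition to the time bound.
\<close>

definition polytime :: "('a :: tree_enc \<Rightarrow> 'b :: tree_enc) \<Rightarrow> bool" where
  "polytime f \<longleftrightarrow> poly_bounded (\<lambda>x. sz (f x)) \<and> (\<exists>T. poly_bounded T \<and> time_bounded f T)"

named_theorems polytime_intros

lemma poly_bounded_comp:
  assumes "poly_bounded h" "polytime f" shows "poly_bounded (\<lambda>x. h (f x))"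
proof -
  obtain c d where *: "\<And>x. h x \<le> sz x ^ c" "\<And>x. sz (f x) \<le> sz x ^ d"
    using assms by (auto simp: poly_bounded_def polytime_def)
  show ?thesis
  proof (rule poly_boundedI)
    fix x
    have "h (f x) \<le> sz (f x) ^ c" by (rule *)
    also have "\<dots> \<le> (sz x ^ d) ^ c" by (rule power_mono[OF *(2)]) simp
    finally show "h (f x) \<le> sz x ^ (d * c)" by (simp add: power_mult)
  qed
qed

lemma poly_bounded_id: "poly_bounded sz"
  by (rule poly_boundedI[of _ 1]) simp

lemma poly_bounded_sz: "polytime f \<Longrightarrow> poly_bounded (\<lambda>x. sz (f x))"
  by (simp add: polytime_def)

lemma poly_bounded_nat: "polytime f \<Longrightarrow> poly_bounded f"
  by (rule poly_bounded_mono[OF poly_bounded_sz]) (auto simp: sz_nat)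

lemmas poly_bounded_intros =
  poly_bounded_const poly_bounded_add poly_bounded_mult poly_bounded_power

lemma time_bounded_comp:
  assumes "time_bounded f T" "time_bounded g U"
  shows "time_bounded (\<lambda>x. f (g x)) (\<lambda>x. U x + T (g x) + 3)"
proof -
  obtain p q where p: "\<And>x. \<exists>t\<le>T x. computes p (enc x) (enc (f x)) t"
    and q: "\<And>x. \<exists>t\<le>U x. computes q (enc x) (enc (g x)) t"
    using assms by (auto simp: time_bounded_def)
  define m where "m = [CallE 1 [CallE (1 + length p) [VarE 0]]]"
  have "\<exists>t\<le>U x + T (g x) + 3. computes (link2 m p q) (enc x) (enc (f (g x))) t" for x
  proof -
    obtain t u where t: "t \<le> T (g x)" "computes p (enc (g x)) (enc (f (g x))) t"
      and u: "u \<le> U x" "computes q (enc x) (enc (g x)) u"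
      using p[of "g x"] q[of x] by auto
    let ?P = "link2 m p q"
    have "eval ?P [enc x] (VarE 0) (enc x) 1"
      using eval_evals.VarE[of 0 "[enc x]" ?P] by simp
    from eval_link2_fst[OF t(2) eval_link2_snd[OF u(2) this]]
    have "eval ?P [enc x] (?P ! 0) (enc (f (g x))) (1 + (1 + 1 + u) + t)"
      by (simp add: m_def link2_def)
    then show ?thesis using t u
      by (intro exI[of _ "1 + (1 + 1 + u) + t"]) (auto simp: computes_def m_def link2_def)
  qed
  then show ?thesis unfolding time_bounded_def by blast
qed

lemma polytime_comp:
  assumes "polytime f" "polytime g" shows "polytime (\<lambda>x. f (g x))"
proof -
  obtain T U where *: "poly_bounded T" "time_bounded f T" "poly_bounded U" "time_bounded g U"
    using assms by (auto simp: polytime_def)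
  have "poly_bounded (\<lambda>x. U x + T (g x) + 3)"
    by (intro poly_bounded_intros * poly_bounded_comp[OF *(1) assms(2)])
  with time_bounded_comp[OF *(2,4)] show ?thesis
    unfolding polytime_def using assms poly_bounded_comp[OF poly_bounded_sz[OF assms(1)] assms(2)]
    by blast
qed

lemma polytime_programI:
  assumes "\<And>x. \<exists>t\<le>k. computes p (enc x) (enc (f x)) t" "\<And>x. sz (f x) \<le> sz x + k"
  shows "polytime f"
  unfolding polytime_def
proof (intro conjI exI)
  show "poly_bounded (\<lambda>x. sz (f x))"
    by (rule poly_bounded_mono[OF poly_bounded_add[OF poly_bounded_id poly_bounded_const]])
      (rule assms(2))
  show "poly_bounded (\<lambda>_::'a. k)" by (rule poly_bounded_const)
  show "time_bounded f (\<lambda>_. k)" using assms(1) unfolding time_bounded_def by blast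
qed

lemma computesI:
  assumes "eval p [x] (p ! 0) v t" "p \<noteq> []" "t \<le> T"
  shows "\<exists>t\<le>T. computes p x v t"
  using assms by (auto simp: computes_def)

lemma eval_var0: "eval p (x # env) (VarE 0) x 1"
  using eval_evals.VarE[of 0 "x # env" p] by simp

text \<open>Several conversions are free because the encodings coincide: a cons cell is the pair of
  head and tail, a successor is a pair with the unit, and a number is a list of units.\<close>

lemma polytime_recode:
  assumes "\<And>x. enc (f x) = enc x" shows "polytime f"
  by (rule polytime_programI[of 1 "[VarE 0]"])
    (auto simp: assms computes_def sz_def intro!: exI[of _ "1::nat"] eval_var0)

lemma polytime_id: "polytime (\<lambda>x. x)"
  by (rule polytime_recode) simp

fun const_expr :: "tree \<Rightarrow> expr" where
  "const_expr Leaf = LeafE"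
| "const_expr (Node a b) = NodeE (const_expr a) (const_expr b)"

lemma eval_const_expr: "\<exists>t. \<forall>env. eval p env (const_expr v) v t"
proof (induction v)
  case Leaf show ?case by (auto intro: eval_evals.LeafE)
next
  case (Node a b) then show ?case by (metis const_expr.simps(2) eval_evals.NodeE)
qed

lemma polytime_const: "polytime (\<lambda>_. k)"
proof -
  obtain t where "\<And>env. eval [const_expr (enc k)] env (const_expr (enc k)) (enc k) t"
    using eval_const_expr by blast
  then show ?thesis
    by (intro polytime_programI[of "t + sz k" "[const_expr (enc k)]"])
      (auto simp: computes_def intro!: exI[of _ t])
qed

lemma polytime_fst0: "polytime fst"
proof (rule polytime_programI[of 2 "[LeftE (VarE 0)]"])
  fix x :: "'a \<times> 'b"
  have "eval [LeftE (VarE 0)] [enc x] (LeftE (VarE 0)) (left (enc x)) (1 + 1)"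
    by (intro eval_evals.LeftE eval_var0)
  then show "\<exists>t\<le>2. computes [LeftE (VarE 0)] (enc x) (enc (fst x)) t"
    by (cases x) (auto simp: computes_def numeral_2_eq_2)
  show "sz (fst x) \<le> sz x + 2" using sz_fst_le[of x] by simp
qed

lemma polytime_snd0: "polytime snd"
proof (rule polytime_programI[of 2 "[RightE (VarE 0)]"])
  fix x :: "'a \<times> 'b"
  have "eval [RightE (VarE 0)] [enc x] (RightE (VarE 0)) (right (enc x)) (1 + 1)"
    by (intro eval_evals.RightE eval_var0)
  then show "\<exists>t\<le>2. computes [RightE (VarE 0)] (enc x) (enc (snd x)) t"
    by (cases x) (auto simp: computes_def numeral_2_eq_2)
  show "sz (snd x) \<le> sz x + 2" using sz_snd_le[of x] by simp
qed

lemma time_bounded_Pair: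
  assumes "time_bounded f T" "time_bounded g U"
  shows "time_bounded (\<lambda>x. (f x, g x)) (\<lambda>x. T x + U x + 5)"
proof -
  obtain p q where p: "\<And>x. \<exists>t\<le>T x. computes p (enc x) (enc (f x)) t"
    and q: "\<And>x. \<exists>t\<le>U x. computes q (enc x) (enc (g x)) t"
    using assms by (auto simp: time_bounded_def)
  define m where "m = [NodeE (CallE 1 [VarE 0]) (CallE (1 + length p) [VarE 0])]"
  have "\<exists>t\<le>T x + U x + 5. computes (link2 m p q) (enc x) (enc (f x, g x)) t" for x
  proof -
    obtain t u where t: "t \<le> T x" "computes p (enc x) (enc (f x)) t"
      and u: "u \<le> U x" "computes q (enc x) (enc (g x)) u"
      using p[of x] q[of x] by auto
    let ?P = "link2 m p q"
    have "eval ?P [enc x] (NodeE (CallE (length m) [VarE 0]) (CallE (length m + length p) [VarE 0]))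
      (Node (enc (f x)) (enc (g x))) (1 + (1 + 1 + t) + (1 + 1 + u))"
      by (intro eval_evals.NodeE eval_link2_fst[OF t(2)] eval_link2_snd[OF u(2)] eval_var0)
    then have "eval ?P [enc x] (?P ! 0) (enc (f x, g x)) (1 + (1 + 1 + t) + (1 + 1 + u))"
      by (simp add: m_def link2_def)
    then show ?thesis using t u
      by (intro exI[of _ "1 + (1 + 1 + t) + (1 + 1 + u)"]) (auto simp: computes_def m_def link2_def)
  qed
  then show ?thesis unfolding time_bounded_def by blast
qed

lemma polytime_Pair:
  assumes "polytime f" "polytime g" shows "polytime (\<lambda>x. (f x, g x))"
proof -
  obtain T U where *: "poly_bounded T" "time_bounded f T" "poly_bounded U" "time_bounded g U"
    using assms by (auto simp: polytime_def)
  have "poly_bounded (\<lambda>x. T x + U x + 5)" by (intro poly_bounded_intros *)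
  moreover have "poly_bounded (\<lambda>x. sz (f x, g x))"
    by (rule poly_bounded_mono[OF poly_bounded_add[OF poly_bounded_sz[OF assms(1)]
            poly_bounded_sz[OF assms(2)]]]) (simp add: sz_def)
  ultimately show ?thesis
    unfolding polytime_def using time_bounded_Pair[OF *(2,4)] by blast
qed

lemma polytime_fst: "polytime f \<Longrightarrow> polytime (\<lambda>x. fst (f x))"
  by (rule polytime_comp[OF polytime_fst0])

lemma polytime_snd: "polytime f \<Longrightarrow> polytime (\<lambda>x. snd (f x))"
  by (rule polytime_comp[OF polytime_snd0])

lemma polytime_Cons: "polytime f \<Longrightarrow> polytime g \<Longrightarrow> polytime (\<lambda>x. f x # g x)"
  by (rule polytime_comp[OF polytime_recode[of "\<lambda>p. fst p # snd p"] polytime_Pair, simplified])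
    (auto simp: enc_prod_def)

lemma polytime_Suc: "polytime f \<Longrightarrow> polytime (\<lambda>x. Suc (f x))"
  by (rule polytime_comp[OF polytime_recode[of "\<lambda>p. Suc (snd p)"] polytime_Pair[OF polytime_const[of "()"]],
        simplified])
    (auto simp: enc_prod_def)

text \<open>Provides loops over numbers: iterating k times is folding over
  \<open>replicate k ()\<close>.\<close>

lemma polytime_units:
  assumes "polytime f" shows "polytime (\<lambda>x. replicate (f x) ())"
proof -
  have "enc (replicate k ()) = enc k" for k by (induction k) auto
  from polytime_comp[OF polytime_recode[of "\<lambda>k. replicate k ()", OF this] assms] show ?thesis .
qed

lemma polytime_app2:
  assumes "polytime (\<lambda>p. F (fst p) (snd p))" "polytime a" "polytime b"
  shows "polytime (\<lambda>x. F (a x) (b x))"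
  using polytime_comp[OF assms(1) polytime_Pair[OF assms(2,3)]] by simp

lemma polytime_app3:
  assumes "polytime (\<lambda>p. F (fst p) (fst (snd p)) (snd (snd p)))"
    "polytime a" "polytime b" "polytime c"
  shows "polytime (\<lambda>x. F (a x) (b x) (c x))"
  using polytime_comp[OF assms(1) polytime_Pair[OF assms(2) polytime_Pair[OF assms(3,4)]]] by simp

text \<open>Binders are handled by pairing: below a binder the outer argument is
  \<open>fst p\<close> and the bound value is \<open>snd p\<close>. With this convention the rules
  in \<open>polytime_intros\<close> descend mechanically through a function body.\<close>

lemma polytime_Let [polytime_intros]:
  assumes "polytime g" "polytime (\<lambda>p. f (fst p) (snd p))"
  shows "polytime (\<lambda>x. let y = g x in f x y)"
  unfolding Let_def using polytime_app2[OF assms(2) polytime_id assms(1)] .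

lemma polytime_case_prod [polytime_intros]:
  assumes "polytime g" "polytime (\<lambda>p. f (fst p) (fst (snd p)) (snd (snd p)))"
  shows "polytime (\<lambda>x. case g x of (a, b) \<Rightarrow> f x a b)"
proof -
  have "(\<lambda>x. case g x of (a, b) \<Rightarrow> f x a b) = (\<lambda>x. f x (fst (g x)) (snd (g x)))"
    by (auto split: prod.splits)
  then show ?thesis
    using polytime_app3[OF assms(2) polytime_id polytime_fst[OF assms(1)] polytime_snd[OF assms(1)]]
    by simp
qed


section \<open>Case distinction, equality and iteration\<close>

lemma polytime_if0:
  "polytime (\<lambda>p :: bool \<times> 'a \<times> 'a :: tree_enc. if fst p then fst (snd p) else snd (snd p))"
proof -
  let ?e = "IfE (LeftE (VarE 0)) (LeftE (RightE (VarE 0))) (RightE (RightE (VarE 0)))"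
  show ?thesis
  proof (rule polytime_programI[of 6 "[?e]"])
    fix x :: "bool \<times> 'a \<times> 'a"
    obtain b u v where x: "x = (b, u, v)" by (cases x)
    note ev = eval_evals.LeftE eval_evals.RightE eval_var0
    have 1: "eval [?e] [enc x] (LeftE (VarE 0)) (enc b) (1 + 1)"
      using ev(1)[OF ev(3), of "[?e]" "enc x" "[]"] by (simp add: x)
    have 2: "eval [?e] [enc x] (LeftE (RightE (VarE 0))) (enc u) (1 + (1 + 1))"
      using ev(1)[OF ev(2)[OF ev(3)], of "[?e]" "enc x" "[]"] by (simp add: x)
    have 3: "eval [?e] [enc x] (RightE (RightE (VarE 0))) (enc v) (1 + (1 + 1))"
      using ev(2)[OF ev(2)[OF ev(3)], of "[?e]" "enc x" "[]"] by (simp add: x)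
    have "eval [?e] [enc x] ?e (enc (if b then u else v)) (1 + (1 + 1) + (1 + (1 + 1)))"
    proof (cases b)
      case True
      show ?thesis by (rule eval_evals.IfTrueE[OF 1]) (use True 2 in simp_all)
    next
      case False
      show ?thesis by (rule eval_evals.IfFalseE) (use False 1 3 in simp_all)
    qed
    then have "eval [?e] [enc x] ([?e] ! 0) (enc (if fst x then fst (snd x) else snd (snd x)))
        (1 + (1 + 1) + (1 + (1 + 1)))"
      by (simp only: x fst_conv snd_conv nth_Cons_0)
    then show "\<exists>t\<le>6. computes [?e] (enc x) (enc (if fst x then fst (snd x) else snd (snd x))) t"
      by (rule computesI) simp_all
    show "sz (if fst x then fst (snd x) else snd (snd x)) \<le> sz x + 6"
      by (simp add: x sz_def)
  qed
qed

lemma polytime_if: "polytime b \<Longrightarrow> polytime f \<Longrightarrow> polytime g \<Longrightarrow>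
    polytime (\<lambda>x. if b x then f x else g x)"
  by (rule polytime_app3[of "\<lambda>a b c. if a then b else c", OF polytime_if0])

lemma polytime_not:
  assumes "polytime f" shows "polytime (\<lambda>x. \<not> f x)"
proof -
  have "(\<lambda>x. \<not> f x) = (\<lambda>x. if f x then False else True)" by auto
  then show ?thesis
    using polytime_if[OF assms polytime_const[of False] polytime_const[of True]] by simp
qed

lemma polytime_conj:
  assumes "polytime f" "polytime g" shows "polytime (\<lambda>x. f x \<and> g x)"
proof -
  have "(\<lambda>x. f x \<and> g x) = (\<lambda>x. if f x then g x else False)" by auto
  then show ?thesis
    using polytime_if[OF assms polytime_const[of False]] by simp
qed

lemma polytime_case_list0:
  assumes a: "polytime a" and f: "polytime (\<lambda>p. f (fst p) (fst (snd p)) (snd (snd p)))"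
  shows "polytime (\<lambda>p. case fst p of [] \<Rightarrow> a (snd p) | h # t \<Rightarrow> f (snd p) h t)"
proof -
  let ?F = "\<lambda>p. case fst p of [] \<Rightarrow> a (snd p) | h # t \<Rightarrow> f (snd p) h t"
  obtain T U where T: "poly_bounded T" "time_bounded a T"
    and U: "poly_bounded U" "time_bounded (\<lambda>p. f (fst p) (fst (snd p)) (snd (snd p))) U"
    using assms by (auto simp: polytime_def)
  obtain p q where p: "\<And>x. \<exists>t\<le>T x. computes p (enc x) (enc (a x)) t"
    and q: "\<And>x h l. \<exists>t\<le>U (x, h, l). computes q (enc (x, h, l)) (enc (f x h l)) t"
  proof -
    obtain p where p: "\<And>x. \<exists>t\<le>T x. computes p (enc x) (enc (a x)) t"
      using T(2) by (auto simp: time_bounded_def)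
    obtain q where q: "\<And>z. \<exists>t\<le>U z. computes q (enc z) (enc (f (fst z) (fst (snd z)) (snd (snd z)))) t"
      using U(2) unfolding time_bounded_def by blast
    have "\<exists>t\<le>U (x, h, l). computes q (enc (x, h, l)) (enc (f x h l)) t" for x h l
      using q[of "(x, h, l)"] unfolding fst_conv snd_conv .
    with p show thesis by (rule that)
  qed
  obtain c where c: "\<And>x. T x \<le> sz x ^ c" using T(1) by (auto simp: poly_bounded_def)
  obtain d where d: "\<And>x. U x \<le> sz x ^ d" using U(1) by (auto simp: poly_bounded_def)
  \<comment> \<open>The encoding of a nonempty list is already that of the pair of its head and
    tail, so pairing the environment with the whole list gives the argument of the second
    program.\<close>
  define m where "m = [IfE (LeftE (VarE 0))
    (CallE (1 + length p) [NodeE (RightE (VarE 0)) (LeftE (VarE 0))]) (CallE 1 [RightE (VarE 0)])]"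
  let ?P = "link2 m p q"
  have time: "\<exists>t \<le> sz x ^ c + (sz x) ^ d + 20. computes ?P (enc x) (enc (?F x)) t" for x
  proof (cases "fst x")
    case Nil
    then obtain y where x: "x = ([], y)" by (cases x) auto
    obtain t where t: "t \<le> T y" "computes p (enc y) (enc (a y)) t" using p by blast
    have *: "eval ?P [enc x] (LeftE (VarE 0)) Leaf (1 + 1)" "eval ?P [enc x] (RightE (VarE 0)) (enc y) (1 + 1)"
      using eval_evals.LeftE[OF eval_var0, of ?P "enc x" "[]"]
        eval_evals.RightE[OF eval_var0, of ?P "enc x" "[]"]
      by (simp_all add: x)
    have "eval ?P [enc x] (?P ! 0) (enc (a y)) (1 + (1 + 1) + (1 + (1 + 1) + t))"
      using eval_evals.IfFalseE[OF *(1) eval_link2_fst[OF t(2) *(2)]] by (simp add: link2_def m_def)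
    moreover have "1 + (1 + 1) + (1 + (1 + 1) + t) \<le> sz x ^ c + sz x ^ d + 20"
    proof -
      have "t \<le> sz y ^ c" using t c order_trans by blast
      also have "\<dots> \<le> sz x ^ c" by (rule power_mono) (simp_all add: x sz_def)
      finally show ?thesis by simp
    qed
    ultimately show ?thesis
      unfolding computes_def
      by (intro exI[of _ "1 + (1 + 1) + (1 + (1 + 1) + t)"]) (auto simp: x link2_def m_def)
  next
    case (Cons h l)
    then obtain y where x: "x = (h # l, y)" by (cases x) auto
    obtain t where t: "t \<le> U (y, h, l)" "computes q (enc (y, h, l)) (enc (f y h l)) t" using q by blast
    have *: "eval ?P [enc x] (LeftE (VarE 0)) (Node (enc h) (enc l)) (1 + 1)"
      "eval ?P [enc x] (RightE (VarE 0)) (enc y) (1 + 1)"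
      using eval_evals.LeftE[OF eval_var0, of ?P "enc x" "[]"] 
        eval_evals.RightE[OF eval_var0, of ?P "enc x" "[]"]
      by (simp_all add: x)
    have **: "eval ?P [enc x] (NodeE (RightE (VarE 0)) (LeftE (VarE 0))) (enc (y, h, l)) (1 + (1 + 1) + (1 + 1))"
      using eval_evals.NodeE[OF *(2,1)] by simp
    have "eval ?P [enc x] (?P ! 0) (enc (f y h l)) (1 + (1 + 1) + (1 + (1 + (1 + 1) + (1 + 1)) + t))"
      using eval_evals.IfTrueE[OF *(1) _ eval_link2_snd[OF t(2) **]] by (simp add: link2_def m_def)
    moreover have "1 + (1 + 1) + (1 + (1 + (1 + 1) + (1 + 1)) + t) \<le> sz x ^ c + sz x ^ d + 20"
    proof -
      have "t \<le> sz (y, h, l) ^ d" using t d order_trans by blast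
      also have "\<dots> \<le> sz x ^ d" by (rule power_mono) (simp_all add: x sz_def)
      finally show ?thesis by simp
    qed
    ultimately show ?thesis
      unfolding computes_def
      by (intro exI[of _ "1 + (1 + 1) + (1 + (1 + (1 + 1) + (1 + 1)) + t)"]) (auto simp: x link2_def m_def)
  qed
  have "poly_bounded (\<lambda>x. sz x ^ c + sz x ^ d + 20)"
    by (intro poly_bounded_intros poly_bounded_id)
  moreover have "poly_bounded (\<lambda>x. sz (?F x))"
  proof -
    obtain i where i: "\<And>x. sz (a x) \<le> sz x ^ i"
      using poly_bounded_sz[OF a] by (auto simp: poly_bounded_def)
    obtain j where j0: "\<And>x. sz (f (fst x) (fst (snd x)) (snd (snd x))) \<le> sz x ^ j"
      using poly_bounded_sz[OF f] unfolding poly_bounded_def by blast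
    have j: "sz (f x h t) \<le> sz (x, h, t) ^ j" for x h t using j0[of "(x, h, t)"] by simp
    have "poly_bounded (\<lambda>x. sz x ^ i + sz x ^ j)" by (intro poly_bounded_intros poly_bounded_id)
    then show ?thesis
    proof (rule poly_bounded_mono)
      fix x
      show "sz (?F x) \<le> sz x ^ i + sz x ^ j"
      proof (cases "fst x")
        case Nil
        have "sz (a (snd x)) \<le> sz x ^ i"
          by (rule order_trans[OF i power_mono[OF sz_snd_le]]) simp
        then show ?thesis by (simp add: Nil)
      next
        case (Cons h t)
        then have "sz (snd x, h, t) \<le> sz x" by (cases x) (auto simp: sz_def)
        then have "sz (f (snd x) h t) \<le> sz x ^ j"
          by (intro order_trans[OF j power_mono]) simp_all
        then show ?thesis by (simp add: Cons)
      qed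
    qed
  qed
  ultimately show ?thesis
    unfolding polytime_def time_bounded_def using time by blast
qed

lemma polytime_case_list:
  assumes "polytime l" "polytime a" "polytime (\<lambda>p. f (fst p) (fst (snd p)) (snd (snd p)))"
  shows "polytime (\<lambda>x. case l x of [] \<Rightarrow> a x | h # t \<Rightarrow> f x h t)"
  using polytime_comp[OF polytime_case_list0[where f = f, OF assms(2,3)]
      polytime_Pair[OF assms(1) polytime_id]]
  unfolding fst_conv snd_conv .

definition eq_prog :: prog where
  "eq_prog = [CallE 1 [LeftE (VarE 0), RightE (VarE 0)],
     IfE (VarE 0)
       (IfE (VarE 1)
          (IfE (CallE 1 [LeftE (VarE 0), LeftE (VarE 1)])
               (CallE 1 [RightE (VarE 0), RightE (VarE 1)]) LeafE)
          LeafE)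
       (IfE (VarE 1) LeafE (NodeE LeafE LeafE))]"

lemma eq_prog_nth:
  "eq_prog ! 0 = CallE 1 [LeftE (VarE 0), RightE (VarE 0)]"
  "eq_prog ! 1 = IfE (VarE 0)
       (IfE (VarE 1)
          (IfE (CallE 1 [LeftE (VarE 0), LeftE (VarE 1)])
               (CallE 1 [RightE (VarE 0), RightE (VarE 1)]) LeafE)
          LeafE)
       (IfE (VarE 1) LeafE (NodeE LeafE LeafE))"
  "length eq_prog = 2"
  by (simp_all add: eq_prog_def)

lemma eval_var1: "eval p (x # y # env) (VarE 1) y 1"
  using eval_evals.VarE[of 1 "x # y # env" p] by simp

lemma eval_var2: "eval p (x # y # z # env) (VarE 2) z 1"
  using eval_evals.VarE[of 2 "x # y # z # env" p] by simp

text \<open>A node takes at most 19 steps besides its two recursive calls, and one of the two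
  offsets 10 of these calls has to be paid for as well; 30 per node covers both.\<close>

lemma eval_eq_loop: "\<exists>t \<le> 30 * size a + 10. eval eq_prog [a, b] (eq_prog ! 1) (enc (a = b)) t"
proof (induction a arbitrary: b)
  case Leaf
  have "\<exists>t\<le>5. eval eq_prog [Leaf, b] (IfE (VarE 1) LeafE (NodeE LeafE LeafE)) (enc (Leaf = b)) t"
  proof (cases b)
    case Leaf
    have "eval eq_prog [Leaf, b] (VarE 1) Leaf 1" using eval_var1 Leaf by blast
    then have "eval eq_prog [Leaf, b] (IfE (VarE 1) LeafE (NodeE LeafE LeafE)) (Node Leaf Leaf)
        (1 + 1 + (1 + 1 + 1))"
      by (intro eval_evals.IfFalseE eval_evals.NodeE eval_evals.LeafE)
    then show ?thesis by (intro exI[of _ "1 + 1 + (1 + 1 + 1)"]) (simp add: Leaf)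
  next
    case (Node b1 b2)
    have "eval eq_prog [Leaf, b] (IfE (VarE 1) LeafE (NodeE LeafE LeafE)) Leaf (1 + 1 + 1)"
      by (rule eval_evals.IfTrueE[OF eval_var1 _ eval_evals.LeafE]) (simp add: Node)
    then show ?thesis by (intro exI[of _ "1 + 1 + 1"]) (simp add: Node)
  qed
  then obtain t where t: "t \<le> 5"
    "eval eq_prog [Leaf, b] (IfE (VarE 1) LeafE (NodeE LeafE LeafE)) (enc (Leaf = b)) t" by blast
  have "eval eq_prog [Leaf, b] (eq_prog ! 1) (enc (Leaf = b)) (1 + 1 + t)"
    unfolding eq_prog_nth by (rule eval_evals.IfFalseE[OF eval_var0 t(2)])
  with t(1) show ?case by (intro exI[of _ "1 + 1 + t"]) simp
next
  case (Node a1 a2)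
  let ?env = "[Node a1 a2, b]"
  show ?case
  proof (cases b)
    case Leaf
    have "eval eq_prog ?env (VarE 1) Leaf 1" using eval_var1 Leaf by blast
    from eval_evals.IfTrueE[OF eval_var0 tree.distinct(2) eval_evals.IfFalseE[OF this eval_evals.LeafE]]
    have "eval eq_prog ?env (eq_prog ! 1) Leaf (1 + 1 + (1 + 1 + 1))"
      unfolding eq_prog_nth .
    then show ?thesis using Leaf by (intro exI[of _ "1 + 1 + (1 + 1 + 1)"]) simp
  next
    case b: (Node b1 b2)
    obtain t1 where t1: "t1 \<le> 30 * size a1 + 10" "eval eq_prog [a1, b1] (eq_prog ! 1) (enc (a1 = b1)) t1"
      using Node by blast
    obtain t2 where t2: "t2 \<le> 30 * size a2 + 10" "eval eq_prog [a2, b2] (eq_prog ! 1) (enc (a2 = b2)) t2"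
      using Node by blast
    have l: "evals eq_prog ?env [LeftE (VarE 0), LeftE (VarE 1)] [a1, b1] ((1 + 1) + ((1 + 1) + 0))"
      using eval_evals.ConsE[OF eval_evals.LeftE[OF eval_var0]
          eval_evals.ConsE[OF eval_evals.LeftE[OF eval_var1] eval_evals.NilE], of eq_prog "Node a1 a2" b "[]"]
      by (simp add: b)
    have r: "evals eq_prog ?env [RightE (VarE 0), RightE (VarE 1)] [a2, b2] ((1 + 1) + ((1 + 1) + 0))"
      using eval_evals.ConsE[OF eval_evals.RightE[OF eval_var0]
          eval_evals.ConsE[OF eval_evals.RightE[OF eval_var1] eval_evals.NilE], of eq_prog "Node a1 a2" b "[]"]
      by (simp add: b)
    have L: "eval eq_prog ?env (CallE 1 [LeftE (VarE 0), LeftE (VarE 1)]) (enc (a1 = b1)) (1 + ((1 + 1) + ((1 + 1) + 0)) + t1)"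
      by (rule eval_evals.CallE[OF _ l t1(2)]) (simp add: eq_prog_nth)
    have R: "eval eq_prog ?env (CallE 1 [RightE (VarE 0), RightE (VarE 1)]) (enc (a2 = b2)) (1 + ((1 + 1) + ((1 + 1) + 0)) + t2)"
      by (rule eval_evals.CallE[OF _ r t2(2)]) (simp add: eq_prog_def)
    have "\<exists>t \<le> t1 + t2 + 15. eval eq_prog ?env (IfE (CallE 1 [LeftE (VarE 0), LeftE (VarE 1)])
               (CallE 1 [RightE (VarE 0), RightE (VarE 1)]) LeafE) (enc (a1 = b1 \<and> a2 = b2)) t"
    proof (cases "a1 = b1")
      case True
      have "eval eq_prog ?env (IfE (CallE 1 [LeftE (VarE 0), LeftE (VarE 1)])
          (CallE 1 [RightE (VarE 0), RightE (VarE 1)]) LeafE) (enc (a2 = b2))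
          (1 + (1 + ((1 + 1) + ((1 + 1) + 0)) + t1) + (1 + ((1 + 1) + ((1 + 1) + 0)) + t2))"
        by (rule eval_evals.IfTrueE[OF L _ R]) (simp add: True)
      then show ?thesis
        by (intro exI[of _ "1 + (1 + ((1 + 1) + ((1 + 1) + 0)) + t1) + (1 + ((1 + 1) + ((1 + 1) + 0)) + t2)"])
          (simp add: True)
    next
      case False
      with L have "eval eq_prog ?env (CallE 1 [LeftE (VarE 0), LeftE (VarE 1)]) Leaf (1 + ((1 + 1) + ((1 + 1) + 0)) + t1)"
        by simp
      from eval_evals.IfFalseE[OF this eval_evals.LeafE]
      have "eval eq_prog ?env (IfE (CallE 1 [LeftE (VarE 0), LeftE (VarE 1)])
          (CallE 1 [RightE (VarE 0), RightE (VarE 1)]) LeafE) Leaf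
          (1 + (1 + ((1 + 1) + ((1 + 1) + 0)) + t1) + 1)" .
      then show ?thesis
        by (intro exI[of _ "1 + (1 + ((1 + 1) + ((1 + 1) + 0)) + t1) + 1"]) (simp add: False)
    qed
    then obtain t where t: "t \<le> t1 + t2 + 15" "eval eq_prog ?env (IfE (CallE 1 [LeftE (VarE 0), LeftE (VarE 1)])
               (CallE 1 [RightE (VarE 0), RightE (VarE 1)]) LeafE) (enc (a1 = b1 \<and> a2 = b2)) t" by blast
    have "b \<noteq> Leaf" by (simp add: b)
    from eval_evals.IfTrueE[OF eval_var0 tree.distinct(2) eval_evals.IfTrueE[OF eval_var1 this t(2)]]
    have "eval eq_prog ?env (eq_prog ! 1) (enc (a1 = b1 \<and> a2 = b2)) (1 + 1 + (1 + 1 + t))"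
      unfolding eq_prog_nth .
    then show ?thesis using t t1 t2
      by (intro exI[of _ "1 + 1 + (1 + 1 + t)"]) (simp add: b)
  qed
qed

lemma polytime_eq0: "polytime (\<lambda>p :: 'a :: tree_enc \<times> 'a. fst p = snd p)"
proof -
  have "time_bounded (\<lambda>p :: 'a \<times> 'a. fst p = snd p) (\<lambda>p. 30 * sz p + 20)"
    unfolding time_bounded_def
  proof (rule exI[of _ eq_prog], rule allI)
    fix x :: "'a \<times> 'a"
    obtain a b where x: "x = (a, b)" by (cases x)
    obtain t where t: "t \<le> 30 * size (enc a) + 10"
      "eval eq_prog [enc a, enc b] (eq_prog ! 1) (enc (enc a = enc b)) t"
      using eval_eq_loop by blast
    have "evals eq_prog [enc x] [LeftE (VarE 0), RightE (VarE 0)] [enc a, enc b] ((1 + 1) + ((1 + 1) + 0))"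
      using eval_evals.ConsE[OF eval_evals.LeftE[OF eval_var0]
          eval_evals.ConsE[OF eval_evals.RightE[OF eval_var0] eval_evals.NilE], of eq_prog "enc x" "[]"]
      by (simp add: x)
    then have "eval eq_prog [enc x] (eq_prog ! 0) (enc (enc a = enc b)) (1 + ((1 + 1) + ((1 + 1) + 0)) + t)"
      unfolding eq_prog_nth(1) by (rule eval_evals.CallE[OF _ _ t(2), rotated]) (simp add: eq_prog_nth(3))
    moreover have "(enc a = enc b) = (a = b)" using enc_inject by blast
    ultimately have "eval eq_prog [enc x] (eq_prog ! 0) (enc (fst x = snd x)) (1 + ((1 + 1) + ((1 + 1) + 0)) + t)"
      by (simp only: x fst_conv snd_conv)
    then show "\<exists>t\<le>30 * sz x + 20. computes eq_prog (enc x) (enc (fst x = snd x)) t"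
    proof (rule computesI)
      show "eq_prog \<noteq> []" by (simp add: eq_prog_def)
      show "1 + ((1 + 1) + ((1 + 1) + 0)) + t \<le> 30 * sz x + 20"
        using t(1) by (simp add: x sz_def)
    qed
  qed
  moreover have "poly_bounded (\<lambda>p :: 'a \<times> 'a. 30 * sz p + 20)"
    by (intro poly_bounded_intros poly_bounded_id)
  moreover have "poly_bounded (\<lambda>p :: 'a \<times> 'a. sz (fst p = snd p))"
    by (rule poly_bounded_mono[OF poly_bounded_const]) (rule sz_bool_le)
  ultimately show ?thesis unfolding polytime_def by blast
qed

lemma polytime_eq: "polytime f \<Longrightarrow> polytime g \<Longrightarrow> polytime (\<lambda>x. f x = g x)"
  by (rule polytime_app2[OF polytime_eq0])


text \<open>A polynomial-time step may double the state each time, so the time of a fold cannot be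
  bounded by the input alone and is expressed through its largest intermediate state. The same
  measure later carries the factor that is exponential in \<alpha>, in
  \<open>time_bounded_fuel\<close>.\<close>

definition max_state :: "('s :: tree_enc \<Rightarrow> 'e \<Rightarrow> 's) \<Rightarrow> 's \<Rightarrow> 'e list \<Rightarrow> nat" where
  "max_state f s l = Max ((\<lambda>i. sz (foldl f s (take i l))) ` {..length l})"

lemma max_state_ge: "i \<le> length l \<Longrightarrow> sz (foldl f s (take i l)) \<le> max_state f s l"
  unfolding max_state_def by (rule Max_ge) auto

lemma max_state_le:
  "(\<And>i. i \<le> length l \<Longrightarrow> sz (foldl f s (take i l)) \<le> B) \<Longrightarrow> max_state f s l \<le> B"
  unfolding max_state_def by (subst Max_le_iff) auto

lemma max_state_Nil [simp]: "max_state f s [] = sz s"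
  by (simp add: max_state_def)

lemma max_state_Cons_ge: "max_state f (f s e) l \<le> max_state f s (e # l)"
proof (rule max_state_le)
  fix i assume "i \<le> length l"
  then show "sz (foldl f (f s e) (take i l)) \<le> max_state f s (e # l)"
    using max_state_ge[of "Suc i" "e # l" f s] by simp
qed

lemma time_bounded_foldl:
  assumes f: "polytime (\<lambda>p. f (fst p) (fst (snd p)) (snd (snd p)))"
  shows "\<exists>c. time_bounded (\<lambda>p. foldl (f (fst p)) (fst (snd p)) (snd (snd p)))
    (\<lambda>p. (sz p + max_state (f (fst p)) (fst (snd p)) (snd (snd p))) ^ c)"
proof -
  obtain T where T: "poly_bounded T" "time_bounded (\<lambda>p. f (fst p) (fst (snd p)) (snd (snd p))) T"
    using f by (auto simp: polytime_def)
  obtain p where p0: "\<And>z. \<exists>t\<le>T z. computes p (enc z) (enc (f (fst z) (fst (snd z)) (snd (snd z)))) t"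
    using T(2) unfolding time_bounded_def by blast
  obtain c where c: "\<And>z. T z \<le> sz z ^ c" using T(1) unfolding poly_bounded_def by blast
  \<comment> \<open>Function 0 unpacks the input, function 1 is the loop over \<open>x\<close>,
    \<open>s\<close> and the rest of the list, and the linked program for one step starts at index
    2.\<close>
  define m where "m = [CallE 1 [LeftE (VarE 0), LeftE (RightE (VarE 0)), RightE (RightE (VarE 0))],
    IfE (VarE 2) (CallE 1 [VarE 0, CallE 2 [NodeE (VarE 0) (NodeE (VarE 1) (LeftE (VarE 2)))], RightE (VarE 2)])
      (VarE 1)]"
  let ?P = "link2 m p []"
  have P: "?P ! 0 = CallE 1 [LeftE (VarE 0), LeftE (RightE (VarE 0)), RightE (RightE (VarE 0))]"
    "?P ! 1 = IfE (VarE 2) (CallE 1 [VarE 0, CallE (length m) [NodeE (VarE 0) (NodeE (VarE 1) (LeftE (VarE 2)))],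
      RightE (VarE 2)]) (VarE 1)"
    "1 < length ?P" "length m = 2"
    by (simp_all add: link2_def m_def)
  have loop: "\<exists>t \<le> length l * (20 + B ^ c) + 3.
      eval ?P [enc x, enc s, enc l] (?P ! 1) (enc (foldl (f x) s l)) t"
    if "sz x + sz l + max_state (f x) s l \<le> B" for x s l B
    using that
  proof (induction l arbitrary: s)
    case Nil
    have "eval ?P [enc x, enc s, enc []] (VarE 2) Leaf 1" using eval_var2[of ?P _ _ Leaf] by simp
    from eval_evals.IfFalseE[OF this eval_var1]
    have "eval ?P [enc x, enc s, enc []] (?P ! 1) (enc (foldl (f x) s [])) (1 + 1 + 1)"
      unfolding P foldl_Nil .
    then show ?case by (intro exI[of _ "1 + 1 + 1"]) simp
  next
    case (Cons e l)
    let ?env = "[enc x, enc s, enc (e # l)]"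
    have bnd: "sz x + sz l + max_state (f x) (f x s e) l \<le> B"
      using Cons.prems max_state_Cons_ge[of "f x" s e l] sz_Cons[of e l] sz_ge_2[of e] by linarith
    obtain u where u: "u \<le> length l * (20 + B ^ c) + 3"
      "eval ?P [enc x, enc (f x s e), enc l] (?P ! 1) (enc (foldl (f x) (f x s e) l)) u"
      using Cons.IH[OF bnd] by blast
    obtain t where t: "t \<le> T (x, s, e)" "computes p (enc (x, s, e)) (enc (f x s e)) t"
      using p0[of "(x, s, e)"] unfolding fst_conv snd_conv by blast
    have "t \<le> B ^ c"
    proof -
      have "sz s \<le> max_state (f x) s (e # l)" using max_state_ge[of 0 "e # l" "f x" s] by simp
      then have "sz (x, s, e) \<le> B"
        using Cons.prems sz_Cons[of e l] sz_Pair[of x "(s, e)"] sz_Pair[of s e] sz_ge_2[of l]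
        by linarith
      then have "sz (x, s, e) ^ c \<le> B ^ c" by (rule power_mono) simp
      with t(1) c[of "(x, s, e)"] show ?thesis by linarith
    qed
    have var2: "eval ?P ?env (VarE 2) (Node (enc e) (enc l)) 1"
      using eval_var2[of ?P _ _ "enc (e # l)"] by simp
    have arg: "eval ?P ?env (NodeE (VarE 0) (NodeE (VarE 1) (LeftE (VarE 2)))) (enc (x, s, e))
      (1 + 1 + (1 + 1 + (1 + 1)))"
      using eval_evals.NodeE[OF eval_var0 eval_evals.NodeE[OF eval_var1 eval_evals.LeftE[OF var2]]]
      by simp
    have args: "evals ?P ?env
      [VarE 0, CallE (length m) [NodeE (VarE 0) (NodeE (VarE 1) (LeftE (VarE 2)))], RightE (VarE 2)]
      [enc x, enc (f x s e), enc l]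
      (1 + ((1 + (1 + 1 + (1 + 1 + (1 + 1))) + t) + ((1 + 1) + 0)))"
      using eval_evals.ConsE[OF eval_var0 eval_evals.ConsE[OF eval_link2_fst[OF t(2) arg]
          eval_evals.ConsE[OF eval_evals.RightE[OF var2] eval_evals.NilE]]]
      unfolding right.simps .
    have "eval ?P ?env (?P ! 1) (enc (foldl (f x) s (e # l)))
      (1 + 1 + (1 + (1 + ((1 + (1 + 1 + (1 + 1 + (1 + 1))) + t) + ((1 + 1) + 0))) + u))"
      using eval_evals.IfTrueE[OF var2 tree.distinct(2) eval_evals.CallE[OF P(3) args u(2)]]
      unfolding P(2) foldl_Cons .
    then show ?case using u(1) \<open>t \<le> B ^ c\<close>
      by (intro exI[of _ "1 + 1 + (1 + (1 + ((1 + (1 + 1 + (1 + 1 + (1 + 1))) + t) + ((1 + 1) + 0))) + u)"])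
        simp
  qed
  have "\<exists>t \<le> (sz z + max_state (f (fst z)) (fst (snd z)) (snd (snd z))) ^ (c + 7).
      computes ?P (enc z) (enc (foldl (f (fst z)) (fst (snd z)) (snd (snd z)))) t" for z
  proof -
    obtain x s l where z: "z = (x, s, l)" by (metis surj_pair)
    define B where "B = sz z + max_state (f x) s l"
    have B: "sz x + sz l + max_state (f x) s l \<le> B" "length l \<le> B" "4 \<le> B"
      using sz_Pair[of x "(s, l)"] sz_Pair[of s l] length_less_sz[of l]
        sz_ge_2[of s] sz_ge_2[of x] sz_ge_2[of l] max_state_ge[of 0 l "f x" s]
      unfolding B_def z take_0 foldl_Nil by linarith+
    obtain u where u: "u \<le> length l * (20 + B ^ c) + 3"
      "eval ?P [enc x, enc s, enc l] (?P ! 1) (enc (foldl (f x) s l)) u"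
      using loop[OF B(1)] by blast
    note ev = eval_evals.LeftE eval_evals.RightE eval_var0[of ?P "enc z" "[]"]
    have args: "evals ?P [enc z] [LeftE (VarE 0), LeftE (RightE (VarE 0)), RightE (RightE (VarE 0))]
      [enc x, enc s, enc l] ((1 + 1) + ((1 + (1 + 1)) + ((1 + (1 + 1)) + 0)))"
      using eval_evals.ConsE[OF ev(1)[OF ev(3)] eval_evals.ConsE[OF ev(1)[OF ev(2)[OF ev(3)]]
          eval_evals.ConsE[OF ev(2)[OF ev(2)[OF ev(3)]] eval_evals.NilE]]]
      by (simp add: z)
    have ev0: "eval ?P [enc z] (?P ! 0) (enc (foldl (f (fst z)) (fst (snd z)) (snd (snd z))))
      (1 + ((1 + 1) + ((1 + (1 + 1)) + ((1 + (1 + 1)) + 0))) + u)"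
      using eval_evals.CallE[OF P(3) args u(2)] unfolding P(1) by (simp only: z fst_conv snd_conv)
    \<comment> \<open>The exponent grows by 7: one factor \<open>B\<close> for the number of rounds
      and six for the numerical constants, using \<open>4 \<le> B\<close>.\<close>
    have "length l * (20 + B ^ c) + 12 \<le> B * (20 + B ^ c) + 12"
      using B(2) by simp
    also have "\<dots> \<le> B * (32 * B ^ c)"
    proof -
      have "1 \<le> B ^ c" using B(3) by simp
      then have "20 + B ^ c + 3 \<le> 32 * B ^ c" by linarith
      then have "B * (20 + B ^ c + 3) \<le> B * (32 * B ^ c)" by (rule mult_le_mono2)
      moreover have "B * (20 + B ^ c) + 12 \<le> B * (20 + B ^ c + 3)"
        using B(3) by (simp add: algebra_simps)
      ultimately show ?thesis by linarith
    qed
    also have "\<dots> \<le> B * (B ^ 6 * B ^ c)"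
    proof -
      have "(32::nat) \<le> 4 ^ 6" by simp
      also have "\<dots> \<le> B ^ 6" using B(3) by (rule power_mono) simp
      finally show ?thesis by (intro mult_le_mono2 mult_le_mono1)
    qed
    also have "\<dots> = B ^ (c + 7)" by (simp add: power_add eval_nat_numeral)
    finally have "1 + ((1 + 1) + ((1 + (1 + 1)) + ((1 + (1 + 1)) + 0))) + u \<le> B ^ (c + 7)"
      using u(1) by linarith
    moreover have "?P \<noteq> []" using P(3) by auto
    moreover have "B = sz z + max_state (f (fst z)) (fst (snd z)) (snd (snd z))"
      by (simp add: B_def z)
    ultimately show ?thesis using computesI[OF ev0] by blast
  qed
  then show ?thesis unfolding time_bounded_def by blast
qed

lemma polytime_foldl:
  assumes f: "polytime (\<lambda>p. f (fst p) (fst (snd p)) (snd (snd p)))"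
    and s: "polytime s" and l: "polytime l" and h: "poly_bounded h"
    and bound: "\<And>x i. i \<le> length (l x) \<Longrightarrow> sz (foldl (f x) (s x) (take i (l x))) \<le> h x"
  shows "polytime (\<lambda>x. foldl (f x) (s x) (l x))"
proof -
  let ?arg = "\<lambda>x. (x, s x, l x)"
  have arg: "polytime ?arg" by (intro polytime_Pair polytime_id s l)
  obtain T where T: "poly_bounded T" "time_bounded ?arg T" using arg by (auto simp: polytime_def)
  obtain c where "time_bounded (\<lambda>p. foldl (f (fst p)) (fst (snd p)) (snd (snd p)))
    (\<lambda>p. (sz p + max_state (f (fst p)) (fst (snd p)) (snd (snd p))) ^ c)"
    using time_bounded_foldl[OF f] by blast
  from time_bounded_comp[OF this T(2)]
  have "time_bounded (\<lambda>x. foldl (f x) (s x) (l x))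
      (\<lambda>x. T x + (sz (?arg x) + max_state (f x) (s x) (l x)) ^ c + 3)"
    by simp
  then have "time_bounded (\<lambda>x. foldl (f x) (s x) (l x)) (\<lambda>x. T x + (sz (?arg x) + h x) ^ c + 3)"
    by (rule time_bounded_mono) (auto intro!: power_mono add_mono max_state_le bound)
  moreover have "poly_bounded (\<lambda>x. T x + (sz (?arg x) + h x) ^ c + 3)"
    by (intro poly_bounded_intros T h poly_bounded_sz arg)
  moreover have "poly_bounded (\<lambda>x. sz (foldl (f x) (s x) (l x)))"
  proof (rule poly_bounded_mono[OF h])
    show "sz (foldl (f x) (s x) (l x)) \<le> h x" for x using bound[of "length (l x)" x] by simp
  qed
  ultimately show ?thesis unfolding polytime_def by blast
qed

text \<open>Controls intermediate states by an invariant, for folds whose value on a prefix has no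
  convenient closed form.\<close>

lemma polytime_foldl_inv:
  assumes "polytime (\<lambda>p. f (fst p) (fst (snd p)) (snd (snd p)))"
    and "polytime s" and "polytime l" and "poly_bounded h"
    and "\<And>x. I x (s x)" and step: "\<And>x e s. I x s \<Longrightarrow> e \<in> set (l x) \<Longrightarrow> I x (f x s e)"
    and "\<And>x s. I x s \<Longrightarrow> sz s \<le> h x"
  shows "polytime (\<lambda>x. foldl (f x) (s x) (l x))"
proof (rule polytime_foldl[OF assms(1-4)])
  fix x i
  have "I x s \<Longrightarrow> set k \<subseteq> set (l x) \<Longrightarrow> I x (foldl (f x) s k)" for s k
    by (induction k arbitrary: s) (auto intro: step)
  then have "I x (foldl (f x) (s x) (take i (l x)))"
    using assms(5) set_take_subset by metis
  then show "sz (foldl (f x) (s x) (take i (l x))) \<le> h x" by (rule assms(7))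
qed


section \<open>Polynomial-time list functions\<close>

lemma sz_append: "sz (a @ b) + 2 = sz a + sz b"
  by (induction a) (auto simp: sz_def)

lemma polytime_rev0: "polytime (rev :: 'a :: tree_enc list \<Rightarrow> _)"
proof -
  have *: "foldl (\<lambda>s e. e # s) s l = rev l @ s" for s l :: "'a list"
    by (induction l arbitrary: s) auto
  have sz_rev: "sz (rev l) = sz l" for l :: "'a list"
  proof -
    have app: "sz (a @ [b]) + 1 = sz a + sz b" for a and b :: 'a
      using sz_append[of a "[b]"] sz_Cons[of b "[]"] by simp
    show ?thesis
    proof (induction l)
      case (Cons a l)
      then show ?case using app[of "rev l" a] sz_Cons[of a l] by simp
    qed simp
  qed
  have "polytime (\<lambda>l :: 'a list. foldl (\<lambda>s e. e # s) [] l)"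
  proof (rule polytime_foldl[OF _ _ _ poly_bounded_id])
    show "sz (foldl (\<lambda>s e. e # s) [] (take i l)) \<le> sz l" for l :: "'a list" and i
      by (simp add: * sz_rev sz_take_le)
  qed (intro polytime_Cons polytime_snd polytime_fst polytime_id polytime_const)+
  then show ?thesis by (simp add: *)
qed

lemma polytime_rev: "polytime f \<Longrightarrow> polytime (\<lambda>x. rev (f x))"
  by (rule polytime_comp[OF polytime_rev0])

lemma polytime_map:
  assumes f: "polytime (\<lambda>p. f (fst p) (snd p))" and l: "polytime l"
  shows "polytime (\<lambda>x. map (f x) (l x))"
proof -
  have *: "foldl (\<lambda>s e. g e # s) s k = rev (map g k) @ s" for g s k
    by (induction k arbitrary: s) auto
  obtain c where c0: "\<And>z. sz (f (fst z) (snd z)) \<le> sz z ^ c"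
    using poly_bounded_sz[OF f] unfolding poly_bounded_def by blast
  have "polytime (\<lambda>x. foldl (\<lambda>s e. f x e # s) [] (l x))"
  proof (rule polytime_foldl[OF _ _ l])
    show "poly_bounded (\<lambda>x. 2 + sz (l x) * (sz x + sz (l x)) ^ c)"
      by (intro poly_bounded_intros poly_bounded_sz l poly_bounded_id)
    fix x i
    have "sz (foldl (\<lambda>s e. f x e # s) [] (take i (l x)))
      \<le> 2 + length (rev (map (f x) (take i (l x)))) * (sz x + sz (l x)) ^ c"
      unfolding * append_Nil2
    proof (rule sz_list_le)
      fix y assume "y \<in> set (rev (map (f x) (take i (l x))))"
      then obtain e where e: "e \<in> set (l x)" "y = f x e" by (auto dest: in_set_takeD)
      have "sz (x, e) \<le> sz x + sz (l x)"
        using sz_Pair[of x e] sz_elem_le[OF e(1)] by linarith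
      then have "sz (x, e) ^ c \<le> (sz x + sz (l x)) ^ c" by (rule power_mono) simp
      then show "sz y \<le> (sz x + sz (l x)) ^ c"
        using c0[of "(x, e)"] unfolding e fst_conv snd_conv by linarith
    qed
    also have "\<dots> \<le> 2 + sz (l x) * (sz x + sz (l x)) ^ c"
      using length_less_sz[of "l x"] by (intro add_left_mono mult_le_mono1) simp
    finally show "sz (foldl (\<lambda>s e. f x e # s) [] (take i (l x)))
      \<le> 2 + sz (l x) * (sz x + sz (l x)) ^ c" .
  next
    show "polytime (\<lambda>p. f (fst p) (snd (snd p)) # fst (snd p))"
      by (intro polytime_Cons polytime_fst polytime_snd polytime_id
          polytime_app2[OF f])
  qed (rule polytime_const)
  from polytime_rev[OF this] show ?thesis by (simp add: *)
qed

lemma polytime_append: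
  assumes "polytime f" "polytime g" shows "polytime (\<lambda>x. f x @ g x)"
proof -
  have *: "foldl (\<lambda>s e. e # s) s l = rev l @ s" for s l :: "'b list"
    by (induction l arbitrary: s) auto
  have "polytime (\<lambda>x. foldl (\<lambda>s e. e # s) (g x) (rev (f x)))"
  proof (rule polytime_foldl)
    show "poly_bounded (\<lambda>x. sz (rev (f x)) + sz (g x) + (2 + sz (rev (f x)) * sz (rev (f x))))"
      by (intro poly_bounded_intros poly_bounded_sz polytime_rev assms)
    show "sz (foldl (\<lambda>s e. e # s) (g x) (take i (rev (f x))))
      \<le> sz (rev (f x)) + sz (g x) + (2 + sz (rev (f x)) * sz (rev (f x)))" for x i
    proof -
      have "sz (rev (take i (rev (f x)))) \<le> 2 + length (rev (take i (rev (f x)))) * sz (rev (f x))"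
        by (rule sz_list_le) (auto intro!: sz_elem_le dest!: in_set_takeD)
      also have "\<dots> \<le> 2 + sz (rev (f x)) * sz (rev (f x))"
        using length_less_sz[of "rev (f x)"] by (intro add_left_mono mult_le_mono1) simp
      finally show ?thesis
        unfolding * using sz_append[of "rev (take i (rev (f x)))" "g x"] by linarith
    qed
  qed (intro polytime_Cons polytime_snd polytime_fst polytime_id polytime_rev assms)+
  then show ?thesis by (simp add: *)
qed

lemma polytime_concat0: "polytime (concat :: 'a :: tree_enc list list \<Rightarrow> _)"
proof -
  have *: "foldl (\<lambda>s e. s @ e) s l = s @ concat l" for s and l :: "'a list list"
    by (induction l arbitrary: s) auto
  have "polytime (\<lambda>l :: 'a list list. foldl (\<lambda>s e. s @ e) [] l)"
  proof (rule polytime_foldl[OF _ _ _ poly_bounded_id])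
    fix l :: "'a list list" and i
    have "sz (concat k) \<le> sz k" for k :: "'a list list"
    proof (induction k)
      case (Cons a k)
      then show ?case using sz_append[of a "concat k"] sz_Cons[of a k] by simp
    qed simp
    then show "sz (foldl (\<lambda>s e. s @ e) [] (take i l)) \<le> sz l"
      unfolding * using sz_take_le order_trans by fastforce
  qed (intro polytime_append polytime_snd polytime_fst polytime_id polytime_const)+
  then show ?thesis by (simp add: *)
qed

lemma polytime_concat: "polytime f \<Longrightarrow> polytime (\<lambda>x. concat (f x))"
  by (rule polytime_comp[OF polytime_concat0])

lemma polytime_filter:
  assumes f: "polytime (\<lambda>p. f (fst p) (snd p))" and l: "polytime l"
  shows "polytime (\<lambda>x. filter (f x) (l x))"
proof -
  have "concat (map (\<lambda>e. if g e then [e] else []) k) = filter g k" for g and k :: "'b list"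
    by (induction k) auto
  moreover have "polytime (\<lambda>x. concat (map (\<lambda>e. if f x e then [e] else []) (l x)))"
    by (intro polytime_concat polytime_map polytime_if polytime_Cons polytime_const polytime_snd
        polytime_id f l)
  ultimately show ?thesis by simp
qed

lemma polytime_length: "polytime f \<Longrightarrow> polytime (\<lambda>x. length (f x))"
proof (rule polytime_comp[of length])
  have enc_units: "enc (length l) = enc l" for l :: "unit list" by (induction l) auto
  have "polytime (\<lambda>l :: 'b list. length (map (\<lambda>_. ()) l))"
    by (rule polytime_comp[OF polytime_recode[OF enc_units] polytime_map])
      (rule polytime_const polytime_id)+
  then show "polytime (length :: 'b list \<Rightarrow> nat)" by simp
qed

lemma polytime_list_ex:
  assumes "polytime (\<lambda>p. f (fst p) (snd p))" "polytime l"
  shows "polytime (\<lambda>x. list_ex (f x) (l x))"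
proof -
  have "list_ex g k = (\<not> filter g k = [])" for g and k :: "'b list"
    by (induction k) auto
  then show ?thesis
    by (simp only:) (intro polytime_not polytime_eq polytime_filter polytime_const assms)
qed

lemma polytime_list_all:
  assumes "polytime (\<lambda>p. f (fst p) (snd p))" "polytime l"
  shows "polytime (\<lambda>x. list_all (f x) (l x))"
proof -
  have "list_all g k = (\<not> list_ex (\<lambda>e. \<not> g e) k)" for g and k :: "'b list"
    by (induction k) auto
  then show ?thesis
    by (simp only:) (intro polytime_not polytime_list_ex assms)
qed

lemma polytime_tl: "polytime f \<Longrightarrow> polytime (\<lambda>x. tl (f x))"
  unfolding tl_def
  by (intro polytime_case_list polytime_const polytime_snd polytime_id)

lemma polytime_drop:
  assumes "polytime k" "polytime l" shows "polytime (\<lambda>x. drop (k x) (l x))"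
proof -
  have *: "foldl (\<lambda>s _. tl s) l (replicate k ()) = drop k l" for k and l :: "'b list"
    by (induction k arbitrary: l) (auto simp: drop_Suc)
  have sz_drop: "sz (drop k l) \<le> sz l" for k and l :: "'b list"
    using sz_append[of "take k l" "drop k l"] sz_ge_2[of "take k l"]
    unfolding append_take_drop_id by linarith
  have "polytime (\<lambda>x. foldl (\<lambda>s _. tl s) (l x) (replicate (k x) ()))"
    by (rule polytime_foldl[OF _ assms(2) polytime_units[OF assms(1)] poly_bounded_sz[OF assms(2)]])
      (auto simp: * sz_drop min_def intro!: polytime_tl polytime_fst polytime_snd polytime_id)
  then show ?thesis by (simp add: *)
qed

lemma polytime_take:
  assumes "polytime k" "polytime l" shows "polytime (\<lambda>x. take (k x) (l x))"
proof -
  have "take k l = rev (drop (length (drop k l)) (rev l))" for k and l :: "'b list"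
    by (cases "k \<le> length l") (simp_all add: rev_drop)
  then show ?thesis
    using polytime_rev[OF polytime_drop[OF polytime_length[OF polytime_drop[OF assms]]
          polytime_rev[OF assms(2)]]] by simp
qed

text \<open>The default makes look-ups total, as needed for statements about all inputs; the form
  with \<open>drop\<close> is assembled from list functions already known to be polynomial.\<close>

definition nth_default :: "'a \<Rightarrow> 'a list \<Rightarrow> nat \<Rightarrow> 'a" where
  "nth_default d l i = (case drop i l of [] \<Rightarrow> d | h # _ \<Rightarrow> h)"

lemma nth_default_eq: "nth_default d l i = (if i < length l then l ! i else d)"
proof (cases "i < length l")
  case True
  then show ?thesis by (simp add: nth_default_def Cons_nth_drop_Suc[symmetric])
qed (simp add: nth_default_def)

lemma polytime_nth_default:
  "polytime d \<Longrightarrow> polytime l \<Longrightarrow> polytime i \<Longrightarrow> polytime (\<lambda>x. nth_default (d x) (l x) (i x))"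
  unfolding nth_default_def
  by (rule polytime_case_list; (intro polytime_drop polytime_fst polytime_snd polytime_id)?)

lemma polytime_less: "polytime f \<Longrightarrow> polytime g \<Longrightarrow> polytime (\<lambda>x. f x < (g x :: nat))"
proof -
  have *: "(a < b) = (\<not> drop a (replicate b ()) = [])" for a b by auto
  assume "polytime f" "polytime g"
  then show ?thesis
    unfolding * by (intro polytime_not polytime_eq polytime_drop polytime_const polytime_units)
qed

lemma polytime_upt: "polytime f \<Longrightarrow> polytime (\<lambda>x. [0..<f x])"
proof -
  have *: "foldl (\<lambda>s _. s @ [length s]) [] (replicate k ()) = [0..<k]" for k
    by (induction k) (simp_all add: replicate_app_Cons_same[symmetric] foldl_append
        flip: replicate_append_same)
  assume f: "polytime f"
  have "polytime (\<lambda>x. foldl (\<lambda>s _. s @ [length s]) [] (replicate (f x) ()))"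
  proof (rule polytime_foldl[OF _ polytime_const polytime_units[OF f]])
    show "poly_bounded (\<lambda>x. 2 + sz (f x) * sz (f x))"
      by (intro poly_bounded_intros poly_bounded_sz f)
    fix x i assume "i \<le> length (replicate (f x) ())"
    then have i: "i \<le> f x" by simp
    have "sz [0..<i] \<le> 2 + length [0..<i] * sz (f x)"
      by (rule sz_list_le) (use i in \<open>auto simp: sz_nat\<close>)
    moreover have "length [0..<i] * sz (f x) \<le> sz (f x) * sz (f x)"
      using i by (intro mult_le_mono1) (simp add: sz_nat)
    ultimately have "sz [0..<i] \<le> 2 + sz (f x) * sz (f x)" by linarith
    moreover have "foldl (\<lambda>s _. s @ [length s]) [] (take i (replicate (f x) ())) = [0..<i]"
      using i by (simp add: * min_def)
    ultimately show "sz (foldl (\<lambda>s _. s @ [length s]) [] (take i (replicate (f x) ())))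
      \<le> 2 + sz (f x) * sz (f x)" by simp
  qed (intro polytime_append polytime_Cons polytime_length polytime_const polytime_fst polytime_snd
      polytime_id)
  then show ?thesis by (simp add: *)
qed

lemma polytime_zip:
  assumes "polytime f" "polytime g" shows "polytime (\<lambda>x. zip (f x) (g x))"
proof -
  let ?step = "\<lambda>s e. case snd s of [] \<Rightarrow> s | y # r \<Rightarrow> ((e, y) # fst s, r)"
  have *: "foldl ?step (acc, b) a = (rev (zip a b) @ acc, drop (length a) b)"
    for acc and a :: "'b list" and b :: "'c list"
    by (induction a arbitrary: acc b) (auto split: list.split)
  have "polytime (\<lambda>x. foldl ?step ([], g x) (f x))"
  proof (rule polytime_foldl)
    show "poly_bounded (\<lambda>x. 2 + sz (f x) * (sz (f x) + sz (g x)) + sz (g x))"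
      by (intro poly_bounded_intros poly_bounded_sz assms)
    fix x i
    let ?a = "take i (f x)" and ?b = "g x"
    have "sz (rev (zip ?a ?b)) \<le> 2 + length (rev (zip ?a ?b)) * (sz (f x) + sz (g x))"
    proof (rule sz_list_le)
      fix y assume "y \<in> set (rev (zip ?a ?b))"
      then have y: "(fst y, snd y) \<in> set (zip ?a ?b)" by simp
      have "fst y \<in> set (f x)" using in_set_takeD[OF set_zip_leftD[OF y]] .
      moreover have "snd y \<in> set (g x)" using set_zip_rightD[OF y] .
      ultimately show "sz y \<le> sz (f x) + sz (g x)"
        using sz_Pair[of "fst y" "snd y"] sz_elem_le[of "fst y" "f x"] sz_elem_le[of "snd y" "g x"]
        by simp
    qed
    also have "\<dots> \<le> 2 + sz (f x) * (sz (f x) + sz (g x))"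
      using length_less_sz[of "f x"] by (intro add_left_mono mult_le_mono1) simp
    finally have 1: "sz (rev (zip ?a ?b)) \<le> 2 + sz (f x) * (sz (f x) + sz (g x))" .
    have 2: "sz (drop (length ?a) ?b) \<le> sz ?b"
      using sz_append[of "take (length ?a) ?b" "drop (length ?a) ?b"] sz_ge_2[of "take (length ?a) ?b"]
      unfolding append_take_drop_id by linarith
    show "sz (foldl ?step ([], g x) ?a) \<le> 2 + sz (f x) * (sz (f x) + sz (g x)) + sz (g x)"
      unfolding * append_Nil2
      using 1 2 sz_Pair[of "rev (zip ?a ?b)" "drop (length ?a) ?b"] by linarith
  qed (intro polytime_case_list polytime_Cons polytime_Pair polytime_const polytime_fst polytime_snd
      polytime_id assms)+
  then have "polytime (\<lambda>x. rev (fst (foldl ?step ([], g x) (f x))))"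
    by (intro polytime_rev polytime_fst)
  then show ?thesis by (simp add: *)
qed

lemmas [polytime_intros] = polytime_id polytime_const polytime_fst polytime_snd polytime_Pair
  polytime_Cons polytime_Suc polytime_units polytime_if polytime_not polytime_conj
  polytime_case_list polytime_eq polytime_rev polytime_map polytime_append polytime_concat
  polytime_filter polytime_length polytime_list_ex polytime_list_all polytime_tl polytime_drop
  polytime_take polytime_nth_default polytime_less polytime_upt polytime_zip


lemma polytime_app4:
  assumes "polytime (\<lambda>p. F (fst p) (fst (snd p)) (fst (snd (snd p))) (snd (snd (snd p))))"
    "polytime a" "polytime b" "polytime c" "polytime d"
  shows "polytime (\<lambda>x. F (a x) (b x) (c x) (d x))"
  by (rule polytime_app3[OF _ assms(2,3) polytime_Pair[OF assms(4,5)],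
        where F = "\<lambda>u v w. F u v (fst w) (snd w)", unfolded fst_conv snd_conv]) (rule assms(1))

lemma polytime_app5:
  assumes "polytime (\<lambda>p. F (fst p) (fst (snd p)) (fst (snd (snd p))) (fst (snd (snd (snd p))))
      (snd (snd (snd (snd p)))))"
    "polytime a" "polytime b" "polytime c" "polytime d" "polytime e"
  shows "polytime (\<lambda>x. F (a x) (b x) (c x) (d x) (e x))"
  by (rule polytime_app4[OF _ assms(2-4) polytime_Pair[OF assms(5,6)],
        where F = "\<lambda>u v w z. F u v w (fst z) (snd z)", unfolded fst_conv snd_conv]) (rule assms(1))

lemma polytime_app6:
  assumes "polytime (\<lambda>p. F (fst p) (fst (snd p)) (fst (snd (snd p))) (fst (snd (snd (snd p))))
      (fst (snd (snd (snd (snd p))))) (snd (snd (snd (snd (snd p))))))"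
    "polytime a" "polytime b" "polytime c" "polytime d" "polytime e" "polytime f"
  shows "polytime (\<lambda>x. F (a x) (b x) (c x) (d x) (e x) (f x))"
  by (rule polytime_app5[OF _ assms(2-5) polytime_Pair[OF assms(6,7)],
        where F = "\<lambda>u v w y z. F u v w y (fst z) (snd z)", unfolded fst_conv snd_conv]) (rule assms(1))

lemma polytime_app8:
  assumes "polytime (\<lambda>p. F (fst p) (fst (snd p)) (fst (snd (snd p))) (fst (snd (snd (snd p))))
      (fst (snd (snd (snd (snd p))))) (fst (snd (snd (snd (snd (snd p))))))
      (fst (snd (snd (snd (snd (snd (snd p))))))) (snd (snd (snd (snd (snd (snd (snd p))))))))"
    "polytime a" "polytime b" "polytime c" "polytime d" "polytime e" "polytime f" "polytime g" "polytime h"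
  shows "polytime (\<lambda>x. F (a x) (b x) (c x) (d x) (e x) (f x) (g x) (h x))"
  by (rule polytime_app6[OF _ assms(2-6) polytime_Pair[OF assms(7) polytime_Pair[OF assms(8,9)]],
        where F = "\<lambda>u v w y z q. F u v w y z (fst q) (fst (snd q)) (snd (snd q))", unfolded fst_conv snd_conv])
    (rule assms(1))

lemma polytime_disj [polytime_intros]:
  assumes "polytime f" "polytime g" shows "polytime (\<lambda>x. f x \<or> g x)"
proof -
  have "(\<lambda>x. f x \<or> g x) = (\<lambda>x. if f x then True else g x)" by auto
  then show ?thesis using polytime_if[OF assms(1) polytime_const[of True] assms(2)] by simp
qed


section \<open>The algorithms as list functions, with their running time on arbitrary input\<close>

section \<open>Permutations and multiplication tables as lists\<close>

abbreviation get :: "nat list \<Rightarrow> nat \<Rightarrow> nat" where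
  "get \<equiv> nth_default 0"

definition mul :: "nat list list \<Rightarrow> nat \<Rightarrow> nat \<Rightarrow> nat" where
  "mul t x y = get (nth_default [] t x) y"

text \<open>
  Being polynomial time is a statement about all inputs, including those that encode no groups.
  Therefore all results below are clipped to numbers less than \<open>n\<close>, and lists are cut off at length
  \<open>M\<close> or \<open>n\<^sup>2\<close>. This has no effect on legitimate inputs.
\<close>

definition clip :: "nat \<Rightarrow> nat \<Rightarrow> nat" where
  "clip n z = (if z < n then z else 0)"

definition first :: "'a \<Rightarrow> 'a list \<Rightarrow> 'a" where
  "first d l = (case l of [] \<Rightarrow> d | h # _ \<Rightarrow> h)"

definition norm_map :: "nat \<Rightarrow> nat list \<Rightarrow> nat list" where
  "norm_map n f = map (\<lambda>x. clip n (get f x)) [0..<n]"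

definition cmp :: "nat \<Rightarrow> nat list \<Rightarrow> nat list \<Rightarrow> nat list" where
  "cmp n f g = map (\<lambda>x. clip n (get f (get g x))) [0..<n]"

definition pinv :: "nat \<Rightarrow> nat list \<Rightarrow> nat list" where
  "pinv n f = map (\<lambda>y. first 0 (filter (\<lambda>x. get f x = y) [0..<n])) [0..<n]"

text \<open>The action of a permutation \<open>b\<close> on self-maps \<open>c\<close>, which need
  not be injective. That \<open>u\<close> transports \<open>c\<close> to \<open>d\<close> always
  means \<open>conj_by n u c = d\<close>.\<close>

definition conj_by :: "nat \<Rightarrow> nat list \<Rightarrow> nat list \<Rightarrow> nat list" where
  "conj_by n b c = cmp n b (cmp n c (pinv n b))"

lemma polytime_mul [polytime_intros]:
  "polytime t \<Longrightarrow> polytime x \<Longrightarrow> polytime y \<Longrightarrow> polytime (\<lambda>z. mul (t z) (x z) (y z))"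
  by (rule polytime_app3[of mul], unfold mul_def) (intro polytime_intros | assumption)+

lemma polytime_clip [polytime_intros]:
  "polytime n \<Longrightarrow> polytime x \<Longrightarrow> polytime (\<lambda>z. clip (n z) (x z))"
  by (rule polytime_app2[of clip], unfold clip_def) (intro polytime_intros | assumption)+

lemma polytime_first [polytime_intros]:
  "polytime d \<Longrightarrow> polytime l \<Longrightarrow> polytime (\<lambda>z. first (d z) (l z))"
  by (rule polytime_app2[of first], unfold first_def) (intro polytime_intros | assumption)+

lemma polytime_norm_map [polytime_intros]:
  "polytime n \<Longrightarrow> polytime f \<Longrightarrow> polytime (\<lambda>z. norm_map (n z) (f z))"
  by (rule polytime_app2[of norm_map], unfold norm_map_def) (intro polytime_intros | assumption)+

lemma polytime_cmp [polytime_intros]: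
  "polytime n \<Longrightarrow> polytime f \<Longrightarrow> polytime g \<Longrightarrow> polytime (\<lambda>z. cmp (n z) (f z) (g z))"
  by (rule polytime_app3[of cmp], unfold cmp_def) (intro polytime_intros | assumption)+

lemma polytime_pinv [polytime_intros]:
  "polytime n \<Longrightarrow> polytime f \<Longrightarrow> polytime (\<lambda>z. pinv (n z) (f z))"
  by (rule polytime_app2[of pinv], unfold pinv_def) (intro polytime_intros | assumption)+

lemma polytime_conj_by [polytime_intros]:
  "polytime n \<Longrightarrow> polytime f \<Longrightarrow> polytime g \<Longrightarrow> polytime (\<lambda>z. conj_by (n z) (f z) (g z))"
  by (rule polytime_app3[of conj_by], unfold conj_by_def) (intro polytime_intros | assumption)+

definition maps :: "nat \<Rightarrow> nat list set" where
  "maps n = {f. length f = n \<and> set f \<subseteq> {..<n}}"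

lemma first_in: "l \<noteq> [] \<Longrightarrow> first d l \<in> set l"
  by (cases l) (auto simp: first_def)

lemma norm_map_maps [simp]: "norm_map n f \<in> maps n"
  by (auto simp: norm_map_def maps_def clip_def)

lemma cmp_maps [simp]: "cmp n f g \<in> maps n"
  by (auto simp: cmp_def maps_def clip_def)

lemma pinv_maps [simp]: "pinv n f \<in> maps n"
proof -
  have "first 0 (filter (\<lambda>x. get f x = y) [0..<n]) < n" if "y < n" for y
  proof (cases "filter (\<lambda>x. get f x = y) [0..<n] = []")
    case True with that show ?thesis unfolding True by (simp add: first_def)
  next
    case False from first_in[OF this, of 0] show ?thesis by auto
  qed
  then show ?thesis by (auto simp: pinv_def maps_def)
qed

lemma conj_by_maps [simp]: "conj_by n b c \<in> maps n"
  by (simp add: conj_by_def)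

lemma upt_maps [simp]: "[0..<n] \<in> maps n"
  by (auto simp: maps_def)

lemma sz_maps_le: "f \<in> maps n \<Longrightarrow> sz f \<le> 2 + n * (n + 2)"
  using sz_list_le[of f "n + 2"] by (auto simp: maps_def sz_nat subset_iff order_less_imp_le)


section \<open>Algorithms for orbits, stabilizers and transporters\<close>

text \<open>An entry is a point of an orbit with a permutation that carries the start to it. The
  first witness found for a point is kept, so the witnesses form the transversal used for Schreier
  generators.\<close>

definition insert_entry :: "(nat list \<times> nat list) list \<Rightarrow> nat list \<times> nat list \<Rightarrow> (nat list \<times> nat list) list" where
  "insert_entry L e = (if list_ex (\<lambda>d. fst d = fst e) L then L else e # L)"

definition grow :: "nat \<Rightarrow> nat \<Rightarrow> nat list list \<Rightarrow> (nat list \<times> nat list) list \<Rightarrow> (nat list \<times> nat list) list" where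
  "grow n M A L = take M (foldl insert_entry L
     (concat (map (\<lambda>e. map (\<lambda>s. (conj_by n s (fst e), cmp n s (snd e))) A) L)))"

text \<open>\<open>M\<close> is both the cut-off and the number of rounds: every round before the
  list is closed adds a point, so \<open>M\<close> rounds exhaust an orbit of at most
  \<open>M\<close> points.\<close>

definition orbit_list :: "nat \<Rightarrow> nat \<Rightarrow> nat list list \<Rightarrow> nat list \<Rightarrow> (nat list \<times> nat list) list" where
  "orbit_list n M A c = foldl (\<lambda>L _. grow n M A L) [(c, [0..<n])] (replicate M ())"

definition lookup :: "(nat list \<times> nat list) list \<Rightarrow> nat list \<Rightarrow> nat list" where
  "lookup L c = first [] (map snd (filter (\<lambda>d. fst d = c) L))"

text \<open>The generators w^-1 s u of the stabilizer of the start, where u is the witness stored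
  for a point and w the one stored for its image under s.\<close>

definition schreier :: "nat \<Rightarrow> (nat list \<times> nat list) list \<Rightarrow> nat list list \<Rightarrow> nat list list" where
  "schreier n L A = concat (map (\<lambda>e. map (\<lambda>s.
     cmp n (pinv n (lookup L (conj_by n s (fst e)))) (cmp n s (snd e))) A) L)"

definition sift :: "nat \<Rightarrow> nat \<Rightarrow> nat list list \<Rightarrow> nat list list \<times> nat list list" where
  "sift n b A = foldl (\<lambda>s g. case filter (\<lambda>t. get t b = get g b) (fst s) of
       [] \<Rightarrow> (g # fst s, snd s)
     | t # _ \<Rightarrow> (fst s, cmp n (pinv n t) g # snd s)) ([], []) A"

text \<open>Sims' filter for the base 0, ..., n - 1. The length of the nested list is n^2, written
  in a form that the rules collected so far cover.\<close>

definition sims :: "nat \<Rightarrow> nat list list \<Rightarrow> nat list list" where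
  "sims n A = take (length (concat (map (\<lambda>_. [0..<n]) [0..<n])))
     (fst (foldl (\<lambda>s b. let r = sift n b (snd s) in (fst r @ fst s, snd r))
       ([], map (norm_map n) A) [0..<n]))"

text \<open>Partial results are lists of length at most one, where \<open>[]\<close> means failure.\<close>

definition transport_step :: "nat \<Rightarrow> nat \<Rightarrow> (nat list list \<times> nat list) list \<Rightarrow> nat list \<times> nat list
    \<Rightarrow> (nat list list \<times> nat list) list" where
  "transport_step n M st p = (case st of [] \<Rightarrow> [] | q # _ \<Rightarrow>
     (let L = orbit_list n M (fst q) (fst p) in
      case filter (\<lambda>d. fst d = conj_by n (pinv n (snd q)) (snd p)) L of
        [] \<Rightarrow> []
      | d # _ \<Rightarrow> [(sims n (schreier n L (fst q)), cmp n (snd q) (snd d))]))"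

text \<open>In a state \<open>(Y, v)\<close>, \<open>Y\<close> generates the stabilizer of the first
  components treated so far, and \<open>v\<close> carries them to their partners. For the next pair
  (c, d), an element h of this stabilizer taking c to the image of d under v^-1 is looked up, and
  \<open>v\<close> is replaced by v h.\<close>

definition transport :: "nat \<Rightarrow> nat \<Rightarrow> nat list list \<Rightarrow> (nat list \<times> nat list) list
    \<Rightarrow> (nat list list \<times> nat list) list" where
  "transport n M A ps = foldl (transport_step n M) [(A, [0..<n])] ps"

lemma insert_entry_bounds:
  "set (foldl insert_entry L k) \<subseteq> set L \<union> set k"
  "length (foldl insert_entry L k) \<le> length L + length k"
proof (induction k arbitrary: L)
  case (Cons a k)
  {
    case 1
    show ?case using Cons(1)[of "insert_entry L a"] by (auto simp: insert_entry_def)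
  next
    case 2
    show ?case using Cons(2)[of "insert_entry L a"] by (auto simp: insert_entry_def)
  }
qed auto

lemma polytime_foldl_insert_entry [polytime_intros]:
  assumes "polytime L" "polytime k" shows "polytime (\<lambda>x. foldl insert_entry (L x) (k x))"
proof (rule polytime_foldl[OF _ assms])
  show "poly_bounded (\<lambda>x. 2 + (sz (L x) + sz (k x)) * (sz (L x) + sz (k x)))"
    by (intro poly_bounded_intros poly_bounded_sz assms)
  show "polytime (\<lambda>p. insert_entry (fst (snd p)) (snd (snd p)))"
    unfolding insert_entry_def by (intro polytime_intros)
  fix x i
  let ?l = "foldl insert_entry (L x) (take i (k x))"
  have "sz ?l \<le> 2 + length ?l * (sz (L x) + sz (k x))"
  proof (rule sz_list_le)
    fix e assume "e \<in> set ?l"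
    then have "e \<in> set (L x) \<or> e \<in> set (k x)"
      using insert_entry_bounds(1)[of "L x" "take i (k x)"] by (auto dest: in_set_takeD)
    then show "sz e \<le> sz (L x) + sz (k x)" using sz_elem_le by (metis trans_le_add1 trans_le_add2)
  qed
  moreover have "length ?l \<le> sz (L x) + sz (k x)"
    using insert_entry_bounds(2)[of "L x" "take i (k x)"] length_less_sz[of "L x"] length_less_sz[of "k x"]
    unfolding length_take by linarith
  ultimately show "sz ?l \<le> 2 + (sz (L x) + sz (k x)) * (sz (L x) + sz (k x))"
    by (meson add_left_mono mult_le_mono1 order_trans)
qed

lemma polytime_grow [polytime_intros]:
  "polytime n \<Longrightarrow> polytime M \<Longrightarrow> polytime A \<Longrightarrow> polytime L \<Longrightarrow>
    polytime (\<lambda>z. grow (n z) (M z) (A z) (L z))"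
  by (rule polytime_app4[of grow], unfold grow_def) (intro polytime_intros | assumption)+

lemma set_grow_subset:
  "set (grow n M A L) \<subseteq> set L \<union> maps n \<times> maps n"
  using insert_entry_bounds(1)[of L] set_take_subset unfolding grow_def by fastforce

text \<open>The state stays small even for meaningless input: \<open>M\<close> limits the length,
  and all components except the start map \<open>c\<close> lie in \<open>maps n\<close> by clipping.
  The summand 1 accounts for the initial list.\<close>

lemma polytime_orbit_list [polytime_intros]:
  assumes "polytime n" "polytime M" "polytime A" "polytime c"
  shows "polytime (\<lambda>z. orbit_list (n z) (M z) (A z) (c z))"
proof -
  have "polytime (\<lambda>z. foldl (\<lambda>L _. grow (n z) (M z) (A z) L) [(c z, [0..<n z])] (replicate (M z) ()))"
  proof (rule polytime_foldl_inv[where I = "\<lambda>z L. length L \<le> 1 + M z \<and>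
      set L \<subseteq> ({c z} \<union> maps (n z)) \<times> maps (n z)"])
    let ?e = "\<lambda>z. sz (c z) + (2 + n z * (n z + 2)) + (2 + n z * (n z + 2))"
    show "poly_bounded (\<lambda>z. 2 + (1 + M z) * ?e z)"
      by (intro poly_bounded_intros poly_bounded_sz poly_bounded_nat assms)
    fix z and L :: "(nat list \<times> nat list) list"
    assume *: "length L \<le> 1 + M z \<and> set L \<subseteq> ({c z} \<union> maps (n z)) \<times> maps (n z)"
    have "sz L \<le> 2 + length L * ?e z"
    proof (rule sz_list_le)
      fix e assume "e \<in> set L"
      with * have "fst e = c z \<or> fst e \<in> maps (n z)" "snd e \<in> maps (n z)" by auto
      then show "sz e \<le> ?e z"
        using sz_Pair[of "fst e" "snd e"] sz_maps_le[of "fst e" "n z"] sz_maps_le[of "snd e" "n z"]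
        by auto
    qed
    also have "\<dots> \<le> 2 + (1 + M z) * ?e z" using * by (intro add_left_mono mult_le_mono1) simp
    finally show "sz L \<le> 2 + (1 + M z) * ?e z" .
  next
    fix z e and L :: "(nat list \<times> nat list) list"
    assume "length L \<le> 1 + M z \<and> set L \<subseteq> ({c z} \<union> maps (n z)) \<times> maps (n z)"
    then show "length (grow (n z) (M z) (A z) L) \<le> 1 + M z \<and>
      set (grow (n z) (M z) (A z) L) \<subseteq> ({c z} \<union> maps (n z)) \<times> maps (n z)"
      using set_grow_subset[of "n z" "M z" "A z" L] by (auto simp: grow_def)
  next
    show "polytime (\<lambda>p. grow (n (fst p)) (M (fst p)) (A (fst p)) (fst (snd p)))"
      by (intro polytime_intros assms[THEN polytime_comp])
  next
    show "polytime (\<lambda>z. [(c z, [0..<n z])])" by (intro polytime_intros assms)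
    show "polytime (\<lambda>z. replicate (M z) ())" by (intro polytime_intros assms)
  qed auto
  then show ?thesis by (simp add: orbit_list_def)
qed

lemma polytime_lookup [polytime_intros]:
  "polytime L \<Longrightarrow> polytime c \<Longrightarrow> polytime (\<lambda>z. lookup (L z) (c z))"
  by (rule polytime_app2[of lookup], unfold lookup_def) (intro polytime_intros | assumption)+

lemma polytime_schreier [polytime_intros]:
  "polytime n \<Longrightarrow> polytime L \<Longrightarrow> polytime A \<Longrightarrow> polytime (\<lambda>z. schreier (n z) (L z) (A z))"
  by (rule polytime_app3[of schreier], unfold schreier_def) (intro polytime_intros | assumption)+

lemma sift_bounds:
  "set (fst (sift n b A)) \<subseteq> set A" "set (snd (sift n b A)) \<subseteq> maps n"
  "length (fst (sift n b A)) + length (snd (sift n b A)) = length A"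
  by (induction A rule: rev_induct) (auto simp: sift_def split: list.splits)

lemma polytime_sift [polytime_intros]:
  assumes "polytime n" "polytime b" "polytime A"
  shows "polytime (\<lambda>z. sift (n z) (b z) (A z))"
proof -
  have "polytime (\<lambda>z. foldl (\<lambda>s g. case filter (\<lambda>t. get t (b z) = get g (b z)) (fst s) of
       [] \<Rightarrow> (g # fst s, snd s)
     | t # _ \<Rightarrow> (fst s, cmp (n z) (pinv (n z) t) g # snd s)) ([], []) (A z))"
  proof (rule polytime_foldl)
    show "polytime (\<lambda>p. case filter (\<lambda>t. get t (b (fst p)) = get (snd (snd p)) (b (fst p))) (fst (fst (snd p))) of
       [] \<Rightarrow> (snd (snd p) # fst (fst (snd p)), snd (fst (snd p)))
     | t # _ \<Rightarrow> (fst (fst (snd p)), cmp (n (fst p)) (pinv (n (fst p)) t) (snd (snd p)) # snd (fst (snd p))))"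
      by (intro polytime_intros assms[THEN polytime_comp])
    show "poly_bounded (\<lambda>z. 2 + sz (A z) * sz (A z) + (2 + sz (A z) * (2 + n z * (n z + 2))))"
      by (intro poly_bounded_intros poly_bounded_sz poly_bounded_nat assms)
    fix z i
    let ?s = "sift (n z) (b z) (take i (A z))"
    note bnds = sift_bounds[of "n z" "b z" "take i (A z)"]
    have len: "length (fst ?s) \<le> sz (A z)" "length (snd ?s) \<le> sz (A z)"
      using bnds(3) length_less_sz[of "A z"] unfolding length_take by linarith+
    have "sz (fst ?s) \<le> 2 + length (fst ?s) * sz (A z)"
      by (rule sz_list_le) (use bnds(1) in \<open>auto intro!: sz_elem_le dest: in_set_takeD\<close>)
    also have "\<dots> \<le> 2 + sz (A z) * sz (A z)"
      using len(1) by (intro add_left_mono mult_le_mono1)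
    finally have 1: "sz (fst ?s) \<le> 2 + sz (A z) * sz (A z)" .
    have "sz (snd ?s) \<le> 2 + length (snd ?s) * (2 + n z * (n z + 2))"
      by (rule sz_list_le, rule sz_maps_le) (use bnds(2) in auto)
    also have "\<dots> \<le> 2 + sz (A z) * (2 + n z * (n z + 2))"
      using len(2) by (intro add_left_mono mult_le_mono1)
    finally have "sz (snd ?s) \<le> 2 + sz (A z) * (2 + n z * (n z + 2))" .
    with 1 have "sz ?s \<le> 2 + sz (A z) * sz (A z) + (2 + sz (A z) * (2 + n z * (n z + 2)))"
      using sz_Pair[of "fst ?s" "snd ?s"] unfolding prod.collapse by linarith
    then show "sz (foldl (\<lambda>s g. case filter (\<lambda>t. get t (b z) = get g (b z)) (fst s) of
       [] \<Rightarrow> (g # fst s, snd s)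
     | t # _ \<Rightarrow> (fst s, cmp (n z) (pinv (n z) t) g # snd s)) ([], []) (take i (A z)))
      \<le> 2 + sz (A z) * sz (A z) + (2 + sz (A z) * (2 + n z * (n z + 2)))"
      by (simp add: sift_def)
  qed (intro polytime_intros assms)+
  then show ?thesis by (simp add: sift_def)
qed

text \<open>Each element becomes either a kept one or a residue in \<open>sift\<close>, so the total
  number of elements is invariant and the state cannot blow up.\<close>

lemma polytime_sims [polytime_intros]:
  assumes "polytime n" "polytime A" shows "polytime (\<lambda>z. sims (n z) (A z))"
proof -
  have "polytime (\<lambda>z. foldl (\<lambda>s b. let r = sift (n z) b (snd s) in (fst r @ fst s, snd r))
       ([], map (norm_map (n z)) (A z)) [0..<n z])"
  proof (rule polytime_foldl_inv[where I = "\<lambda>z s. set (fst s) \<subseteq> maps (n z) \<and> set (snd s) \<subseteq> maps (n z) \<and>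
      length (fst s) + length (snd s) = length (A z)"])
    show "polytime (\<lambda>p. let r = sift (n (fst p)) (snd (snd p)) (snd (fst (snd p)))
        in (fst r @ fst (fst (snd p)), snd r))"
      by (intro polytime_intros assms[THEN polytime_comp])
    let ?e = "\<lambda>z. 2 + sz (A z) * (2 + n z * (n z + 2))"
    show "poly_bounded (\<lambda>z. ?e z + ?e z)"
      by (intro poly_bounded_intros poly_bounded_sz poly_bounded_nat assms)
    show "polytime (\<lambda>z. ([], map (norm_map (n z)) (A z)))"
      by (intro polytime_intros assms assms[THEN polytime_comp])
    show "set (fst ([], map (norm_map (n z)) (A z))) \<subseteq> maps (n z) \<and>
      set (snd ([], map (norm_map (n z)) (A z))) \<subseteq> maps (n z) \<and>
      length (fst ([] :: nat list list, map (norm_map (n z)) (A z))) +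
      length (snd ([] :: nat list list, map (norm_map (n z)) (A z))) = length (A z)" for z
      by auto
    fix z and s :: "nat list list \<times> nat list list"
    assume s: "set (fst s) \<subseteq> maps (n z) \<and> set (snd s) \<subseteq> maps (n z) \<and>
      length (fst s) + length (snd s) = length (A z)"
    {
      fix b
      show "set (fst (let r = sift (n z) b (snd s) in (fst r @ fst s, snd r))) \<subseteq> maps (n z) \<and>
        set (snd (let r = sift (n z) b (snd s) in (fst r @ fst s, snd r))) \<subseteq> maps (n z) \<and>
        length (fst (let r = sift (n z) b (snd s) in (fst r @ fst s, snd r))) +
        length (snd (let r = sift (n z) b (snd s) in (fst r @ fst s, snd r))) = length (A z)"
        using s sift_bounds[of "n z" b "snd s"] by (auto simp: Let_def)
    }
    have "sz l \<le> ?e z" if "set l \<subseteq> maps (n z)" "length l \<le> length (A z)" for l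
    proof -
      have "sz l \<le> 2 + length l * (2 + n z * (n z + 2))"
        by (rule sz_list_le, rule sz_maps_le) (use that(1) in auto)
      also have "\<dots> \<le> ?e z"
        using that(2) length_less_sz[of "A z"] by (intro add_left_mono mult_le_mono1) linarith
      finally show ?thesis .
    qed
    then have "sz (fst s) \<le> ?e z" "sz (snd s) \<le> ?e z" using s by auto
    then show "sz s \<le> ?e z + ?e z" using sz_Pair[of "fst s" "snd s"] unfolding prod.collapse by linarith
  qed (intro polytime_intros assms)+
  then show ?thesis
    unfolding sims_def by (intro polytime_intros assms polytime_comp[OF assms(1)])
qed

lemma sims_bounds: "set (sims n A) \<subseteq> maps n" "length (sims n A) \<le> n * n"
proof -
  let ?f = "\<lambda>s b. let r = sift n b (snd s) in (fst r @ fst s, snd r)"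
  have "set (fst (foldl ?f s l)) \<subseteq> maps n"
    if "set (fst s) \<subseteq> maps n" "set (snd s) \<subseteq> maps n" for s l
    using that
  proof (induction l arbitrary: s)
    case (Cons b l)
    show ?case unfolding foldl_Cons
      by (rule Cons.IH) (use Cons.prems sift_bounds[of n b "snd s"] in \<open>auto simp: Let_def\<close>)
  qed simp
  moreover have "set (map (norm_map n) A) \<subseteq> maps n" by auto
  ultimately have "set (fst (foldl ?f ([], map (norm_map n) A) [0..<n])) \<subseteq> maps n" by simp
  then show "set (sims n A) \<subseteq> maps n"
    unfolding sims_def by (rule order_trans[OF set_take_subset])
  show "length (sims n A) \<le> n * n"
    by (simp add: sims_def length_concat map_replicate_const o_def sum_list_replicate)
qed

lemma polytime_transport_step [polytime_intros]:
  "polytime n \<Longrightarrow> polytime M \<Longrightarrow> polytime st \<Longrightarrow> polytime p \<Longrightarrow>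
    polytime (\<lambda>z. transport_step (n z) (M z) (st z) (p z))"
  by (rule polytime_app4[of transport_step], unfold transport_step_def) (intro polytime_intros | assumption)+

text \<open>Schreier generators alone would multiply in number by the orbit length at each step.
  Since \<open>sims\<close> cuts every new list to n^2 elements, only the initial list
  \<open>A\<close> can be longer, which is what the invariant records.\<close>

lemma polytime_transport [polytime_intros]:
  assumes "polytime n" "polytime M" "polytime A" "polytime ps"
  shows "polytime (\<lambda>z. transport (n z) (M z) (A z) (ps z))"
proof -
  let ?I = "\<lambda>z st. st = [] \<or> (\<exists>Y v. st = [(Y, v)] \<and> v \<in> maps (n z) \<and>
    (Y = A z \<or> length Y \<le> n z * n z \<and> set Y \<subseteq> maps (n z)))"
  have "polytime (\<lambda>z. foldl (transport_step (n z) (M z)) [(A z, [0..<n z])] (ps z))"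
  proof (rule polytime_foldl_inv[where I = ?I])
    show "polytime (\<lambda>p. transport_step (n (fst p)) (M (fst p)) (fst (snd p)) (snd (snd p)))"
      by (intro polytime_intros assms[THEN polytime_comp])
    let ?e = "\<lambda>z. 2 + n z * (n z + 2)"
    show "poly_bounded (\<lambda>z. 2 + (sz (A z) + (2 + (n z * n z) * ?e z) + ?e z))"
      by (intro poly_bounded_intros poly_bounded_sz poly_bounded_nat assms)
    show "?I z (transport_step (n z) (M z) st p)" if "?I z st" for z p st
      by (auto simp: transport_step_def Let_def sims_bounds split: list.splits)
    fix z st assume "?I z st"
    then consider "st = []" | Y v where "st = [(Y, v)]" "v \<in> maps (n z)"
      "Y = A z \<or> length Y \<le> n z * n z \<and> set Y \<subseteq> maps (n z)" by blast
    then show "sz st \<le> 2 + (sz (A z) + (2 + (n z * n z) * ?e z) + ?e z)"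
    proof cases
      case 2
      have "sz Y \<le> sz (A z) + (2 + (n z * n z) * ?e z)"
      proof (cases "Y = A z")
        case False
        with 2 have Y: "length Y \<le> n z * n z" "set Y \<subseteq> maps (n z)" by auto
        have "sz Y \<le> 2 + length Y * ?e z"
          by (rule sz_list_le, rule sz_maps_le) (use Y(2) in auto)
        also have "\<dots> \<le> 2 + (n z * n z) * ?e z" using Y(1) by (intro add_left_mono mult_le_mono1)
        finally show ?thesis by simp
      qed simp
      then show ?thesis
        using sz_maps_le[OF 2(2)] sz_Pair[of Y v] sz_Cons[of "(Y, v)" "[]"] unfolding 2(1) sz_Nil
        by linarith
    qed simp
  qed (auto intro!: polytime_intros assms)
  then show ?thesis by (simp add: transport_def)
qed


section \<open>The isomorphism test\<close>

definition remainder :: "nat list list \<Rightarrow> nat \<Rightarrow> nat list \<Rightarrow> nat \<Rightarrow> nat" where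
  "remainder t k T z = first 0 (filter (\<lambda>h. list_ex (\<lambda>c. mul t c h = z) T) [0..<k])"

text \<open>The map x -> c^-1 a x b on the points below \<open>j\<close>. The representative c is
  not computed: \<open>remainder\<close> searches for the factor h in c h = a x b over all c in
  \<open>T\<close>. Fixing the other points makes it a self-map of {..<n}, on which
  \<open>conj_by\<close> acts.\<close>

definition twisted :: "nat \<Rightarrow> nat list list \<Rightarrow> nat \<Rightarrow> nat list \<Rightarrow> nat \<Rightarrow> nat \<Rightarrow> nat \<Rightarrow> nat list" where
  "twisted n t k T a b j =
     map (\<lambda>x. if x < j then clip n (remainder t k T (mul t (mul t a x) b)) else x) [0..<n]"

text \<open>The order is essential: for fixed \<open>a\<close> and \<open>b\<close> the segments in
  \<open>ks\<close> follow each other, so a restriction is transported when those to the smaller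
  segments are already stabilized.\<close>

definition objects :: "nat \<Rightarrow> nat list list \<Rightarrow> nat list \<Rightarrow> nat \<Rightarrow> nat list \<Rightarrow> nat list list" where
  "objects n t ks k T =
     concat (map (\<lambda>a. concat (map (\<lambda>b. map (\<lambda>j. twisted n t k T a b j) ks) T)) T)"

text \<open>The map t z -> y b(z), with (t, y) in \<open>P\<close> and z below \<open>k\<close>,
  continued by the identity from \<open>l\<close> on. The nested list collects the values for all
  factorizations x = t z; for coset representatives t there is just one.\<close>

definition extend :: "nat \<Rightarrow> nat list list \<Rightarrow> nat list list \<Rightarrow> nat \<Rightarrow> nat \<Rightarrow> (nat \<times> nat) list \<Rightarrow> nat list \<Rightarrow> nat list" where
  "extend n g h k l P b = map (\<lambda>x. if x < l then clip n (first 0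
       (concat (map (\<lambda>p. map (\<lambda>z. mul h (snd p) (get b z)) (filter (\<lambda>z. mul g (fst p) z = x) [0..<k])) P)))
     else x) [0..<n]"

text \<open>A check carried out by the program on its candidates, so that everything it collects is
  correct by construction and only completeness needs an argument.\<close>

definition chain_map :: "nat \<Rightarrow> nat list list \<Rightarrow> nat list list \<Rightarrow> nat list \<Rightarrow> nat \<Rightarrow> nat list \<Rightarrow> bool" where
  "chain_map n g h ks l f \<longleftrightarrow>
     list_all (\<lambda>x. list_all (\<lambda>y. get f (mul g x y) = mul h (get f x) (get f y)) [0..<l]) [0..<l] \<and>
     list_all (\<lambda>j. list_all (\<lambda>x. get f x < j) [0..<j]) ks \<and>
     list_all (\<lambda>x. list_all (\<lambda>y. x = y \<or> get f x \<noteq> get f y) [0..<n]) [0..<n] \<and>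
     list_all (\<lambda>x. x < l \<or> get f x = x) [0..<n]"

definition tuples :: "nat \<Rightarrow> nat \<Rightarrow> nat list \<Rightarrow> nat list list" where
  "tuples n M T = foldl (\<lambda>L _. take M (concat (map (\<lambda>l. map (\<lambda>x. x # l) [0..<n]) L))) [[]] T"

definition extensions :: "nat \<Rightarrow> nat \<Rightarrow> nat list list \<Rightarrow> nat list list \<Rightarrow> nat list \<times> nat \<times> nat
    \<Rightarrow> nat list list \<Rightarrow> nat list \<Rightarrow> nat list list" where
  "extensions n M g h lv A T = concat (map (\<lambda>y.
     case transport n M A (zip (objects n g (fst lv) (fst (snd lv)) T) (objects n h (fst lv) (fst (snd lv)) y)) of
       [] \<Rightarrow> []
     | q # _ \<Rightarrow> (let f = extend n g h (fst (snd lv)) (snd (snd lv)) (zip T y) (snd q) in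
         if chain_map n g h (snd (snd lv) # fst lv) (snd (snd lv)) f then [f] else [])) (tuples n M T))"

text \<open>The data of \<open>T\<close> are transported to themselves for the sake of
  \<open>fst q\<close>, the generators of their stabilizer; each of these is continued by the
  identity on \<open>T\<close>.\<close>

definition lifts :: "nat \<Rightarrow> nat \<Rightarrow> nat list list \<Rightarrow> nat list \<times> nat \<times> nat \<Rightarrow> nat list list \<Rightarrow> nat list \<Rightarrow> nat list list" where
  "lifts n M g lv A T =
     (case transport n M A (zip (objects n g (fst lv) (fst (snd lv)) T) (objects n g (fst lv) (fst (snd lv)) T)) of
        [] \<Rightarrow> []
      | q # _ \<Rightarrow> filter (chain_map n g g (snd (snd lv) # fst lv) (snd (snd lv)))
          (map (extend n g g (fst (snd lv)) (snd (snd lv)) (zip T T)) (fst q)))"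

definition transversal :: "nat list list \<Rightarrow> nat \<Rightarrow> nat \<Rightarrow> nat list" where
  "transversal g k l = foldl (\<lambda>T x. if list_ex (\<lambda>t. list_ex (\<lambda>z. mul g t z = x) [0..<k]) T
     then T else T @ [x]) [] [0..<l]"

text \<open>The table of \<open>h\<close> pulled back along \<open>f\<close>. Where \<open>f\<close>
  is an isomorphism from the first table, the new table coincides with that table.\<close>

definition relabel :: "nat \<Rightarrow> nat list list \<Rightarrow> nat list \<Rightarrow> nat list list" where
  "relabel n h f = map (\<lambda>x. map (\<lambda>y. get (pinv n f) (mul h (get f x) (get f y))) [0..<n]) [0..<n]"

definition level_step :: "nat \<Rightarrow> nat \<Rightarrow> nat list list \<Rightarrow> (nat list list \<times> nat list list) list
    \<Rightarrow> nat list \<times> nat \<times> nat \<Rightarrow> (nat list list \<times> nat list list) list" where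
  "level_step n M g st lv = (case st of [] \<Rightarrow> [] | q # _ \<Rightarrow>
     (let T = transversal g (fst (snd lv)) (snd (snd lv)) in
      case extensions n M g (snd q) lv (fst q) T of
        [] \<Rightarrow> []
      | f # _ \<Rightarrow> [(sims n (extensions n M g g lv (fst q) T @ lifts n M g lv (fst q) T),
          relabel n (snd q) f)]))"

definition levels :: "nat list \<Rightarrow> (nat list \<times> nat \<times> nat) list" where
  "levels K = map (\<lambda>i. (take (Suc i) K, get K i, get K (Suc i))) [0..<length (tl K)]"

definition chain_isomorphic :: "nat \<Rightarrow> nat \<Rightarrow> nat list list \<Rightarrow> nat list list \<Rightarrow> nat list \<Rightarrow> bool" where
  "chain_isomorphic n M g h K \<longleftrightarrow> foldl (level_step n M g) [([], h)] (levels K) \<noteq> []"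

text \<open>Keeping first occurrences in the concatenated members of an increasing series numbers
  the elements so that every member becomes an initial segment.\<close>

definition dedup :: "nat list \<Rightarrow> nat list" where
  "dedup l = foldl (\<lambda>s x. if list_ex (\<lambda>y. y = x) s then s else s @ [x]) [] l"

text \<open>The final \<open>unit\<close> is encoded as \<open>Leaf\<close>, so these nested pairs
  have exactly the encoding of the four-element list in \<open>enc_input\<close>.\<close>

type_synonym instance_data = "nat list list \<times> nat list list \<times> nat list list \<times> nat list list \<times> unit"

text \<open>Indices are obtained by counting coset representatives. It is enough to inspect the
  first series, as the test fails anyway unless the second one has the same sizes.\<close>

definition max_index :: "instance_data \<Rightarrow> nat" where
  "max_index d = foldl (\<lambda>m i. if m < i then i else m) 0
     (map (\<lambda>lv. length (transversal (relabel (length (fst d)) (fst d) (dedup (concat (fst (snd d)))))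
        (fst (snd lv)) (snd (snd lv)))) (levels (map length (fst (snd d)))))"

text \<open>With \<open>M\<close> as a separate unary argument the test is polynomial on all inputs;
  growth beyond that is confined to the computation of \<open>M\<close>.\<close>

definition isomorphism_test :: "instance_data \<times> nat \<Rightarrow> bool" where
  "isomorphism_test dM = (case dM of ((g, S, h, S', _), M) \<Rightarrow>
     map length S = map length S' \<and>
     chain_isomorphic (length g) M (relabel (length g) g (dedup (concat S)))
       (relabel (length g) h (dedup (concat S'))) (map length S))"

lemma polytime_remainder [polytime_intros]:
  "polytime t \<Longrightarrow> polytime k \<Longrightarrow> polytime T \<Longrightarrow> polytime z \<Longrightarrow>
    polytime (\<lambda>x. remainder (t x) (k x) (T x) (z x))"
  by (rule polytime_app4[of remainder], unfold remainder_def) (intro polytime_intros | assumption)+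

lemma polytime_objects [polytime_intros]:
  "polytime n \<Longrightarrow> polytime t \<Longrightarrow> polytime ks \<Longrightarrow> polytime k \<Longrightarrow> polytime T \<Longrightarrow>
    polytime (\<lambda>x. objects (n x) (t x) (ks x) (k x) (T x))"
  by (rule polytime_app5[of objects], unfold objects_def twisted_def) (intro polytime_intros | assumption)+

lemma polytime_extend [polytime_intros]:
  "polytime n \<Longrightarrow> polytime g \<Longrightarrow> polytime h \<Longrightarrow> polytime k \<Longrightarrow> polytime l \<Longrightarrow> polytime P \<Longrightarrow> polytime b \<Longrightarrow>
    polytime (\<lambda>x. extend (n x) (g x) (h x) (k x) (l x) (P x) (b x))"
  by (rule polytime_app8[of "\<lambda>n g h k l P b (_ :: unit). extend n g h k l P b" _ _ _ _ _ _ _ "\<lambda>_. ()"],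
      unfold extend_def) (intro polytime_intros | assumption)+

lemma polytime_chain_map [polytime_intros]:
  "polytime n \<Longrightarrow> polytime g \<Longrightarrow> polytime h \<Longrightarrow> polytime ks \<Longrightarrow> polytime l \<Longrightarrow> polytime f \<Longrightarrow>
    polytime (\<lambda>x. chain_map (n x) (g x) (h x) (ks x) (l x) (f x))"
  by (rule polytime_app6[of chain_map], unfold chain_map_def) (intro polytime_intros | assumption)+

lemma polytime_tuples [polytime_intros]:
  assumes "polytime n" "polytime M" "polytime T"
  shows "polytime (\<lambda>x. tuples (n x) (M x) (T x))"
proof -
  let ?f = "\<lambda>n M L _. take M (concat (map (\<lambda>l. map (\<lambda>x. x # l) [0..<n]) L))"
  have inv: "length (foldl (?f n M) [[]] T) \<le> 1 + M \<and>
      (\<forall>l \<in> set (foldl (?f n M) [[]] T). length l \<le> length T \<and> set l \<subseteq> {..<n})"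
    for n M and T :: "nat list"
    by (induction T rule: rev_induct) (auto dest!: in_set_takeD, (fastforce+)?)
  have "polytime (\<lambda>x. foldl (?f (n x) (M x)) [[]] (T x))"
  proof (rule polytime_foldl[OF _ polytime_const assms(3)])
    show "polytime (\<lambda>p. take (M (fst p)) (concat (map (\<lambda>l. map (\<lambda>x. x # l) [0..<n (fst p)]) (fst (snd p)))))"
      by (intro polytime_intros assms assms[THEN polytime_comp])
    let ?e = "\<lambda>x. 2 + sz (T x) * (n x + 2)"
    show "poly_bounded (\<lambda>x. 2 + (1 + M x) * ?e x)"
      by (intro poly_bounded_intros poly_bounded_sz poly_bounded_nat assms)
    fix x i
    let ?L = "foldl (?f (n x) (M x)) [[]] (take i (T x))"
    note inv = inv[of "M x" "n x" "take i (T x)"]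
    have "sz ?L \<le> 2 + length ?L * ?e x"
    proof (rule sz_list_le)
      fix l assume "l \<in> set ?L"
      with inv have l: "length l \<le> length (take i (T x))" "set l \<subseteq> {..<n x}" by auto
      have "sz l \<le> 2 + length l * (n x + 2)"
        by (rule sz_list_le) (use l(2) in \<open>auto simp: sz_nat subset_iff order_less_imp_le\<close>)
      also have "\<dots> \<le> ?e x"
        using l(1) length_less_sz[of "T x"] unfolding length_take
        by (intro add_left_mono mult_le_mono1) linarith
      finally show "sz l \<le> ?e x" .
    qed
    also have "\<dots> \<le> 2 + (1 + M x) * ?e x" using inv by (intro add_left_mono mult_le_mono1) blast
    finally show "sz ?L \<le> 2 + (1 + M x) * ?e x" .
  qed
  then show ?thesis by (simp add: tuples_def)
qed

lemma polytime_extensions [polytime_intros]: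
  "polytime n \<Longrightarrow> polytime M \<Longrightarrow> polytime g \<Longrightarrow> polytime h \<Longrightarrow> polytime lv \<Longrightarrow> polytime A \<Longrightarrow> polytime T \<Longrightarrow>
    polytime (\<lambda>x. extensions (n x) (M x) (g x) (h x) (lv x) (A x) (T x))"
  by (rule polytime_app8[of "\<lambda>n M g h lv A T (_ :: unit). extensions n M g h lv A T" _ _ _ _ _ _ _ "\<lambda>_. ()"],
      unfold extensions_def) (intro polytime_intros | assumption)+

lemma polytime_lifts [polytime_intros]:
  "polytime n \<Longrightarrow> polytime M \<Longrightarrow> polytime g \<Longrightarrow> polytime lv \<Longrightarrow> polytime A \<Longrightarrow> polytime T \<Longrightarrow>
    polytime (\<lambda>x. lifts (n x) (M x) (g x) (lv x) (A x) (T x))"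
  by (rule polytime_app6[of lifts], unfold lifts_def) (intro polytime_intros | assumption)+

lemma polytime_collect:
  assumes "polytime (\<lambda>p. P (fst p) (fst (snd p)) (snd (snd p)))" "polytime l"
  shows "polytime (\<lambda>x. foldl (\<lambda>s e. if P x s e then s else s @ [e]) [] (l x))"
proof (rule polytime_foldl[OF _ polytime_const assms(2)])
  show "polytime (\<lambda>p. if P (fst p) (fst (snd p)) (snd (snd p)) then fst (snd p) else fst (snd p) @ [snd (snd p)])"
    by (intro polytime_intros assms)
  show "poly_bounded (\<lambda>x. 2 + sz (l x) * sz (l x))"
    by (intro poly_bounded_intros poly_bounded_sz assms)
  fix x i
  let ?f = "\<lambda>s e. if P x s e then s else s @ [e]"
  have inv: "set (foldl ?f [] k) \<subseteq> set k \<and> length (foldl ?f [] k) \<le> length k" for k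
    by (induction k rule: rev_induct) auto
  have "sz (foldl ?f [] (take i (l x))) \<le> 2 + length (foldl ?f [] (take i (l x))) * sz (l x)"
    by (rule sz_list_le) (use inv[of "take i (l x)"] in \<open>auto intro!: sz_elem_le dest!: in_set_takeD\<close>)
  also have "\<dots> \<le> 2 + sz (l x) * sz (l x)"
    using inv[of "take i (l x)"] length_less_sz[of "l x"] unfolding length_take
    by (intro add_left_mono mult_le_mono1) linarith
  finally show "sz (foldl ?f [] (take i (l x))) \<le> 2 + sz (l x) * sz (l x)" .
qed

lemma polytime_transversal [polytime_intros]:
  "polytime g \<Longrightarrow> polytime k \<Longrightarrow> polytime l \<Longrightarrow> polytime (\<lambda>x. transversal (g x) (k x) (l x))"
  by (rule polytime_app3[of transversal], unfold transversal_def)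
    (intro polytime_intros polytime_collect | assumption)+

lemma polytime_dedup [polytime_intros]: "polytime l \<Longrightarrow> polytime (\<lambda>x. dedup (l x))"
  unfolding dedup_def by (rule polytime_collect) (intro polytime_intros | assumption)+

lemma polytime_relabel [polytime_intros]:
  "polytime n \<Longrightarrow> polytime h \<Longrightarrow> polytime f \<Longrightarrow> polytime (\<lambda>x. relabel (n x) (h x) (f x))"
  by (rule polytime_app3[of relabel], unfold relabel_def) (intro polytime_intros | assumption)+

lemma polytime_levels [polytime_intros]: "polytime K \<Longrightarrow> polytime (\<lambda>x. levels (K x))"
proof (rule polytime_comp[of levels])
  show "polytime levels" unfolding levels_def by (intro polytime_intros)
qed

lemma polytime_level_step [polytime_intros]:
  "polytime n \<Longrightarrow> polytime M \<Longrightarrow> polytime g \<Longrightarrow> polytime st \<Longrightarrow> polytime lv \<Longrightarrow>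
    polytime (\<lambda>x. level_step (n x) (M x) (g x) (st x) (lv x))"
  by (rule polytime_app5[of level_step], unfold level_step_def) (intro polytime_intros | assumption)+

lemma get_maps_lt: "f \<in> maps n \<Longrightarrow> x < n \<Longrightarrow> get f x < n"
  by (auto simp: maps_def nth_default_eq subset_iff)

lemma get_maps_le: "f \<in> maps n \<Longrightarrow> get f x \<le> n"
  by (auto simp: maps_def nth_default_eq subset_iff intro: less_imp_le)

lemma sz_relabel_le: "sz (relabel n h f) \<le> 2 + n * (2 + n * (n + 2))"
proof -
  have "sz (relabel n h f) \<le> 2 + length (relabel n h f) * (2 + n * (n + 2))"
  proof (rule sz_list_le)
    fix r assume r: "r \<in> set (relabel n h f)"
    have "sz r \<le> 2 + length r * (n + 2)"
      by (rule sz_list_le) (use r in \<open>auto simp: relabel_def sz_nat intro!: get_maps_le\<close>)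
    moreover have "length r = n" using r by (auto simp: relabel_def)
    ultimately show "sz r \<le> 2 + n * (n + 2)" by simp
  qed
  then show ?thesis by (simp add: relabel_def)
qed

text \<open>Neither component of the state accumulates over the levels: the generators come from
  \<open>sims\<close>, and the size of a table made by \<open>relabel\<close> is bounded in terms of
  n alone.\<close>

lemma polytime_chain_isomorphic [polytime_intros]:
  assumes "polytime n" "polytime M" "polytime g" "polytime h" "polytime K"
  shows "polytime (\<lambda>x. chain_isomorphic (n x) (M x) (g x) (h x) (K x))"
proof -
  let ?I = "\<lambda>x st. st = [] \<or> (\<exists>Y k. st = [(Y, k)] \<and> length Y \<le> n x * n x \<and> set Y \<subseteq> maps (n x) \<and>
    sz k \<le> sz (h x) + (2 + n x * (2 + n x * (n x + 2))))"
  have "polytime (\<lambda>x. foldl (level_step (n x) (M x) (g x)) [([], h x)] (levels (K x)))"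
  proof (rule polytime_foldl_inv[where I = ?I])
    show "polytime (\<lambda>p. level_step (n (fst p)) (M (fst p)) (g (fst p)) (fst (snd p)) (snd (snd p)))"
      by (intro polytime_intros assms[THEN polytime_comp])
    let ?e = "\<lambda>x. 2 + n x * (n x + 2)"
    show "poly_bounded (\<lambda>x. 2 + ((2 + (n x * n x) * ?e x) + (sz (h x) + (2 + n x * ?e x))))"
      by (intro poly_bounded_intros poly_bounded_sz poly_bounded_nat assms)
    have "sz (relabel (n x) k f) \<le> sz (h x) + (2 + n x * (2 + n x * (n x + 2)))" for x k f
      by (rule trans_le_add2[OF sz_relabel_le])
    then show "?I x (level_step (n x) (M x) (g x) st lv)" if "?I x st" for x lv st
      by (auto simp: level_step_def Let_def sims_bounds split: list.splits)
    fix x st assume "?I x st"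
    then consider "st = []" | Y k where "st = [(Y, k)]" "length Y \<le> n x * n x" "set Y \<subseteq> maps (n x)"
      "sz k \<le> sz (h x) + (2 + n x * (2 + n x * (n x + 2)))" by blast
    then show "sz st \<le> 2 + ((2 + (n x * n x) * ?e x) + (sz (h x) + (2 + n x * ?e x)))"
    proof cases
      case 2
      have "sz Y \<le> 2 + length Y * ?e x"
        by (rule sz_list_le, rule sz_maps_le) (use 2(3) in auto)
      also have "\<dots> \<le> 2 + (n x * n x) * ?e x" using 2(2) by (intro add_left_mono mult_le_mono1)
      finally show ?thesis
        using 2(4) sz_Pair[of Y k] sz_Cons[of "(Y, k)" "[]"] unfolding 2(1) sz_Nil by linarith
    qed simp
  qed (auto intro!: polytime_intros assms)
  then show ?thesis unfolding chain_isomorphic_def by (intro polytime_intros)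
qed

lemma polytime_max_index: "polytime max_index"
proof -
  have "polytime (\<lambda>l. foldl (\<lambda>m i :: nat. if m < i then i else m) 0 l)"
  proof (rule polytime_foldl_inv[where I = "\<lambda>l m. m = 0 \<or> m \<in> set l" and h = "\<lambda>l. 2 + sz l"])
    show "poly_bounded (\<lambda>l :: nat list. 2 + sz l)" by (intro poly_bounded_intros poly_bounded_id)
    show "sz m \<le> 2 + sz l" if "m = 0 \<or> m \<in> set l" for l and m :: nat
      using that sz_elem_le[of m l] by (auto simp: sz_nat)
  qed (auto intro!: polytime_intros)
  then have "polytime (\<lambda>x. foldl (\<lambda>m i :: nat. if m < i then i else m) 0 (l x))" if "polytime l" for l :: "instance_data \<Rightarrow> _"
    using that by (rule polytime_comp)
  then show ?thesis unfolding max_index_def by this (intro polytime_intros)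
qed

lemma polytime_isomorphism_test: "polytime isomorphism_test"
  unfolding isomorphism_test_def by (intro polytime_intros)


section \<open>Correctness of the permutation group algorithms\<close>

section \<open>Permutation groups given by generators\<close>

definition perms :: "nat \<Rightarrow> nat list set" where
  "perms n = {f \<in> maps n. distinct f}"

lemma perms_maps [simp]: "f \<in> perms n \<Longrightarrow> f \<in> maps n"
  by (simp add: perms_def)

lemma finite_perms: "finite (perms n)"
  by (rule finite_subset[OF _ finite_lists_length_eq[of "{..<n}" n]]) (auto simp: perms_def maps_def)

lemma get_upt [simp]: "x < n \<Longrightarrow> get [0..<n] x = x"
  by (simp add: nth_default_eq)

lemma get_map_upt [simp]: "x < n \<Longrightarrow> get (map f [0..<n]) x = f x"
  by (simp add: nth_default_eq)

lemma maps_eqI: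
  assumes "f \<in> maps n" "g \<in> maps n" "\<And>x. x < n \<Longrightarrow> get f x = get g x"
  shows "f = g"
  using assms by (auto simp: maps_def nth_default_eq intro!: nth_equalityI)

lemma norm_map_id [simp]: "f \<in> maps n \<Longrightarrow> norm_map n f = f"
  by (rule maps_eqI[OF norm_map_maps]) (auto simp: norm_map_def clip_def get_maps_lt)

lemma get_cmp [simp]: "f \<in> maps n \<Longrightarrow> g \<in> maps n \<Longrightarrow> x < n \<Longrightarrow> get (cmp n f g) x = get f (get g x)"
  by (simp add: cmp_def clip_def get_maps_lt)

lemma cmp_assoc:
  assumes "f \<in> maps n" "g \<in> maps n" "h \<in> maps n"
  shows "cmp n (cmp n f g) h = cmp n f (cmp n g h)"
  by (rule maps_eqI[of _ n]) (use assms in \<open>simp_all add: get_maps_lt\<close>)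

lemma cmp_id [simp]:
  assumes "f \<in> maps n" shows "cmp n [0..<n] f = f" "cmp n f [0..<n] = f"
  by (rule maps_eqI[of _ n]; use assms in \<open>simp add: get_maps_lt\<close>)+

lemma upt_perms [simp]: "[0..<n] \<in> perms n"
  by (simp add: perms_def del: perms_maps)

lemma perms_inj: "f \<in> perms n \<Longrightarrow> x < n \<Longrightarrow> y < n \<Longrightarrow> get f x = get f y \<longleftrightarrow> x = y"
  by (simp add: perms_def maps_def nth_default_eq nth_eq_iff_index_eq del: perms_maps)

lemma perms_iff: "f \<in> perms n \<longleftrightarrow> f \<in> maps n \<and> (\<forall>x<n. \<forall>y<n. get f x = get f y \<longrightarrow> x = y)"
  by (auto simp: perms_def maps_def nth_default_eq distinct_conv_nth simp del: perms_maps)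

lemma perms_surj:
  assumes "f \<in> perms n" "y < n" obtains x where "x < n" "get f x = y"
proof -
  have "inj_on (get f) {..<n}" using assms(1) by (auto simp: inj_on_def perms_inj)
  moreover have "get f ` {..<n} \<subseteq> {..<n}" using assms(1) by (auto simp: get_maps_lt)
  ultimately have "get f ` {..<n} = {..<n}" by (simp add: endo_inj_surj)
  with assms(2) that show thesis by (metis imageE lessThan_iff)
qed

lemma pinv_get [simp]:
  assumes "f \<in> perms n" "x < n" shows "get (pinv n f) (get f x) = x"
proof -
  have "filter (\<lambda>z. get f z = get f x) [0..<n] \<noteq> []"
    using assms by (auto simp: filter_empty_conv)
  from first_in[OF this, of 0]
  have "first 0 (filter (\<lambda>z. get f z = get f x) [0..<n]) = x"
    using assms perms_inj[OF assms(1)] by auto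
  then show ?thesis using assms by (simp add: pinv_def get_maps_lt)
qed

lemma get_pinv [simp]:
  assumes "f \<in> perms n" "y < n" shows "get f (get (pinv n f) y) = y"
  using perms_surj[OF assms] pinv_get[OF assms(1)] by metis

lemma pinv_perms [simp]: assumes "f \<in> perms n" shows "pinv n f \<in> perms n"
  unfolding perms_iff
proof (intro conjI allI impI)
  fix x y assume xy: "x < n" "y < n" and eq: "get (pinv n f) x = get (pinv n f) y"
  have "get f (get (pinv n f) x) = get f (get (pinv n f) y)" by (simp only: eq)
  then show "x = y" unfolding get_pinv[OF assms xy(1)] get_pinv[OF assms xy(2)] .
qed (rule pinv_maps)

lemma cmp_pinv [simp]:
  assumes "f \<in> perms n" shows "cmp n f (pinv n f) = [0..<n]" "cmp n (pinv n f) f = [0..<n]"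
  by (rule maps_eqI[of _ n]; use assms in simp)+

lemma cmp_perms [simp]: "f \<in> perms n \<Longrightarrow> g \<in> perms n \<Longrightarrow> cmp n f g \<in> perms n"
  by (auto simp: perms_iff[of "cmp n f g"] get_maps_lt perms_inj)

lemma pinv_unique:
  assumes "f \<in> perms n" "g \<in> maps n" "cmp n f g = [0..<n]" shows "g = pinv n f"
proof -
  have "g = cmp n (cmp n (pinv n f) f) g" using assms by simp
  also have "\<dots> = cmp n (pinv n f) (cmp n f g)" using assms by (intro cmp_assoc) simp_all
  finally show ?thesis using assms by simp
qed

lemma pinv_cmp_cancel [simp]:
  assumes "f \<in> perms n" "g \<in> maps n"
  shows "cmp n f (cmp n (pinv n f) g) = g" "cmp n (pinv n f) (cmp n f g) = g"
  using assms by (simp_all flip: cmp_assoc)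

lemma conj_by_iff:
  assumes "b \<in> perms n" "c \<in> maps n" "d \<in> maps n"
  shows "conj_by n b c = d \<longleftrightarrow> (\<forall>x<n. get d (get b x) = get b (get c x))"
proof
  assume "conj_by n b c = d"
  then show "\<forall>x<n. get d (get b x) = get b (get c x)"
    using assms by (auto simp: conj_by_def get_maps_lt)
next
  assume *: "\<forall>x<n. get d (get b x) = get b (get c x)"
  show "conj_by n b c = d"
  proof (rule maps_eqI[of _ n])
    fix x assume "x < n"
    then show "get (conj_by n b c) x = get d x"
      using assms *[rule_format, of "get (pinv n b) x"] by (simp add: conj_by_def get_maps_lt)
  qed (simp_all add: assms)
qed

lemma conj_by_get [simp]:
  assumes "b \<in> perms n" "c \<in> maps n" "x < n"
  shows "get (conj_by n b c) (get b x) = get b (get c x)"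
  using conj_by_iff[of b n c "conj_by n b c"] assms by simp

lemma conj_by_cmp:
  assumes "a \<in> perms n" "b \<in> perms n" "c \<in> maps n"
  shows "conj_by n (cmp n a b) c = conj_by n a (conj_by n b c)"
  by (subst conj_by_iff) (use assms in \<open>simp_all add: get_maps_lt\<close>)

lemma conj_by_id [simp]: "c \<in> maps n \<Longrightarrow> conj_by n [0..<n] c = c"
  by (subst conj_by_iff) (simp_all add: get_maps_lt)

lemma conj_by_pinv [simp]:
  assumes "b \<in> perms n" "c \<in> maps n"
  shows "conj_by n b (conj_by n (pinv n b) c) = c" "conj_by n (pinv n b) (conj_by n b c) = c"
  using assms by (simp_all flip: conj_by_cmp)

text \<open>Generators act from the left and inverses are omitted: by finiteness this is already the
  generated group, and the induction follows the way in which orbits are explored.\<close>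

inductive_set closure :: "nat \<Rightarrow> nat list set \<Rightarrow> nat list set" for n A where
  closure_id: "[0..<n] \<in> closure n A"
| closure_step: "s \<in> A \<Longrightarrow> f \<in> closure n A \<Longrightarrow> cmp n s f \<in> closure n A"

definition perm_group :: "nat \<Rightarrow> nat list set \<Rightarrow> bool" where
  "perm_group n B \<longleftrightarrow> B \<subseteq> perms n \<and> [0..<n] \<in> B \<and> (\<forall>f\<in>B. \<forall>g\<in>B. cmp n f g \<in> B) \<and> (\<forall>f\<in>B. pinv n f \<in> B)"

lemma perm_groupD:
  assumes "perm_group n B"
  shows "B \<subseteq> perms n" "[0..<n] \<in> B" "f \<in> B \<Longrightarrow> g \<in> B \<Longrightarrow> cmp n f g \<in> B" "f \<in> B \<Longrightarrow> pinv n f \<in> B"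
  using assms by (auto simp: perm_group_def)

text \<open>Powers of \<open>f\<close> must repeat, by the pigeonhole principle; cancelling gives
  f^(k+1) = 1, so f^k, which lies in \<open>B\<close>, is the inverse.\<close>

lemma perm_group_closed_finite:
  assumes "B \<subseteq> perms n" "[0..<n] \<in> B" "\<And>f g. f \<in> B \<Longrightarrow> g \<in> B \<Longrightarrow> cmp n f g \<in> B"
  shows "perm_group n B"
proof -
  have "pinv n f \<in> B" if f: "f \<in> B" for f
  proof -
    let ?p = "\<lambda>k. (cmp n f ^^ k) [0..<n]"
    have fp: "f \<in> perms n" using f assms(1) by auto
    have pB: "?p k \<in> B" for k by (induction k) (simp_all add: assms f)
    then have pp: "?p k \<in> perms n" for k using assms(1) by auto
    have "\<not> inj ?p"
      using finite_subset[OF _ finite_perms] pp by (metis finite_imageD image_subsetI infinite_UNIV_nat)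
    then obtain i j where ij: "?p i = ?p j" "i < j"
      unfolding inj_def by (metis linorder_neqE_nat)
    have add: "?p (i + k) = cmp n (?p i) (?p k)" for k
      by (induction i) (use pp fp in \<open>simp_all add: cmp_assoc\<close>)
    obtain k where k: "j = i + Suc k" using ij(2) less_iff_Suc_add by auto
    have "?p i = cmp n (?p i) (?p (Suc k))" using ij(1) add[of "Suc k"] by (simp add: k)
    then have "cmp n (pinv n (?p i)) (?p i) = cmp n (pinv n (?p i)) (cmp n (?p i) (?p (Suc k)))"
      by simp
    then have "?p (Suc k) = [0..<n]"
      using pp[of i] pp[of "Suc k"] by (simp del: funpow.simps)
    then have "?p k = pinv n f"
      using pinv_unique[OF fp, of "?p k"] pp[of k] by simp
    with pB[of k] show ?thesis by simp
  qed
  then show ?thesis using assms by (auto simp: perm_group_def)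
qed

lemma closure_subset: "perm_group n B \<Longrightarrow> A \<subseteq> B \<Longrightarrow> closure n A \<subseteq> B"
proof
  fix f assume B: "perm_group n B" "A \<subseteq> B" and "f \<in> closure n A"
  from this(3) show "f \<in> B"
    by induction (use B in \<open>auto simp: perm_group_def\<close>)
qed

lemma perm_group_perms: "perm_group n (perms n)"
  by (simp add: perm_group_def)

lemma closure_perms: "A \<subseteq> perms n \<Longrightarrow> closure n A \<subseteq> perms n"
  by (rule closure_subset[OF perm_group_perms])

lemma perm_group_closure:
  assumes "A \<subseteq> perms n" shows "perm_group n (closure n A)"
proof (rule perm_group_closed_finite[OF closure_perms[OF assms] closure_id])
  fix f g assume "f \<in> closure n A" "g \<in> closure n A"
  then show "cmp n f g \<in> closure n A"
  proof induction
    case closure_id then show ?case using closure_perms[OF assms] by auto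
  next
    case (closure_step s f)
    then have "s \<in> perms n" "f \<in> perms n" "g \<in> perms n" using assms closure_perms[OF assms] by auto
    then show ?case using closure_step by (simp add: cmp_assoc closure.closure_step)
  qed
qed

lemma closure_incl: "A \<subseteq> perms n \<Longrightarrow> s \<in> A \<Longrightarrow> s \<in> closure n A"
  using closure_step[OF _ closure_id, of s A n] by auto

lemma closure_mono: "A \<subseteq> closure n B \<Longrightarrow> B \<subseteq> perms n \<Longrightarrow> closure n A \<subseteq> closure n B"
  by (rule closure_subset[OF perm_group_closure])

lemma closure_mono_subset: "A \<subseteq> B \<Longrightarrow> B \<subseteq> perms n \<Longrightarrow> closure n A \<subseteq> closure n B"
  by (rule closure_mono) (auto intro: closure_incl)

lemma closure_eqI:
  assumes "A \<subseteq> perms n" "B \<subseteq> perms n" "A \<subseteq> closure n B" "B \<subseteq> closure n A"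
  shows "closure n A = closure n B"
  using assms closure_mono by blast

lemma closure_insert_id: "A \<subseteq> perms n \<Longrightarrow> closure n (insert [0..<n] A) = closure n A"
  by (rule closure_eqI) (auto intro: closure_incl closure_id closure_incl[of "insert _ A"])


subsection \<open>Reducing the number of generators\<close>

text \<open>A residue r = t^-1 g lies in the generated group, and g = t r recovers the element it
  replaces, so the group is unchanged. By the last claim, base points treated earlier stay fixed,
  because t and g both fix them.\<close>

lemma sift_correct:
  assumes "set A \<subseteq> perms n" "b < n"
  shows "set (snd (sift n b A)) \<subseteq> closure n (set A)"
    "set A \<subseteq> closure n (set (fst (sift n b A)) \<union> set (snd (sift n b A)))"
    "distinct (map (\<lambda>t. get t b) (fst (sift n b A)))"
    "\<forall>r \<in> set (snd (sift n b A)). get r b = b \<and> (\<forall>x<n. (\<forall>f\<in>set A. get f x = x) \<longrightarrow> get r x = x)"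
  using assms(1)
proof (induction A rule: rev_induct)
  case (snoc g A)
  let ?s = "sift n b A"
  {
    assume A: "set (A @ [g]) \<subseteq> perms n"
    then have A': "set A \<subseteq> perms n" and g: "g \<in> perms n" by auto
    note IH = snoc[OF A']
    have cA: "closure n (set A) \<subseteq> closure n (set (A @ [g]))"
      by (rule closure_mono_subset[OF _ A]) auto
    have reps: "set (fst ?s) \<subseteq> set A" by (rule sift_bounds(1))
    have rest: "set (snd ?s) \<subseteq> perms n" using IH(1) closure_perms[OF A'] by auto
    have "set (snd (sift n b (A @ [g]))) \<subseteq> closure n (set (A @ [g])) \<and>
      set (A @ [g]) \<subseteq> closure n (set (fst (sift n b (A @ [g]))) \<union> set (snd (sift n b (A @ [g])))) \<and>
      distinct (map (\<lambda>t. get t b) (fst (sift n b (A @ [g])))) \<and>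
      (\<forall>r \<in> set (snd (sift n b (A @ [g]))).
        get r b = b \<and> (\<forall>x<n. (\<forall>f\<in>set (A @ [g]). get f x = x) \<longrightarrow> get r x = x))"
    proof (cases "filter (\<lambda>t. get t b = get g b) (fst ?s)")
      case Nil
      then have step: "sift n b (A @ [g]) = (g # fst ?s, snd ?s)" by (simp add: sift_def)
      have U: "set (g # fst ?s) \<union> set (snd ?s) \<subseteq> perms n" using g reps A' rest by auto
      have "closure n (set (fst ?s) \<union> set (snd ?s)) \<subseteq> closure n (set (g # fst ?s) \<union> set (snd ?s))"
        by (rule closure_mono_subset[OF _ U]) auto
      then have "set (A @ [g]) \<subseteq> closure n (set (g # fst ?s) \<union> set (snd ?s))"
        using IH(2) closure_incl[OF U, of g] by auto
      moreover have "get g b \<notin> set (map (\<lambda>t. get t b) (fst ?s))"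
        using Nil by (auto simp: filter_empty_conv)
      ultimately show ?thesis
        unfolding step fst_conv snd_conv using IH(1,3,4) cA by auto
    next
      case (Cons t ts)
      then have step: "sift n b (A @ [g]) = (fst ?s, cmp n (pinv n t) g # snd ?s)" by (simp add: sift_def)
      have "t \<in> set (filter (\<lambda>t. get t b = get g b) (fst ?s))" by (simp add: Cons)
      then have t: "t \<in> set (fst ?s)" "get t b = get g b" "t \<in> set A" "t \<in> perms n"
        using reps A' by auto
      let ?r = "cmp n (pinv n t) g"
      have r: "?r \<in> perms n" using t g by simp
      have rcl: "?r \<in> closure n (set (A @ [g]))"
        using perm_groupD(3,4)[OF perm_group_closure[OF A]] closure_incl[OF A, of t] closure_incl[OF A, of g] t(3)
        by auto
      have U: "set (fst ?s) \<union> set (?r # snd ?s) \<subseteq> perms n" using r reps A' rest by auto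
      have "closure n (set (fst ?s) \<union> set (snd ?s)) \<subseteq> closure n (set (fst ?s) \<union> set (?r # snd ?s))"
        by (rule closure_mono_subset[OF _ U]) auto
      moreover have "g \<in> closure n (set (fst ?s) \<union> set (?r # snd ?s))"
      proof -
        have "g = cmp n t ?r" using t g by simp
        moreover have "cmp n t ?r \<in> closure n (set (fst ?s) \<union> set (?r # snd ?s))"
        proof (rule closure_step)
          show "?r \<in> closure n (set (fst ?s) \<union> set (?r # snd ?s))" by (rule closure_incl[OF U]) simp
        qed (use t in simp)
        ultimately show ?thesis by simp
      qed
      moreover have "get ?r b = b" using t g assms(2) by (simp flip: t(2))
      moreover have "get ?r x = x" if "x < n" "\<forall>f\<in>set (A @ [g]). get f x = x" for x
      proof -
        have "get g x = x" "get t x = x" using that t(3) by auto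
        then show ?thesis using that(1) t(4) g pinv_get[OF t(4) that(1)] by simp
      qed
      ultimately show ?thesis
        unfolding step fst_conv snd_conv using IH cA rcl by auto
    qed
  }
  note * = this
  {
    case 1 then show ?case using * by blast
  next
    case 2 then show ?case using * by blast
  next
    case 3 then show ?case using * by blast
  next
    case 4 then show ?case using * by blast
  }
qed (auto simp: sift_def)

text \<open>
  One level of the filter keeps at most one generator for every image of the base point \<open>b\<close>
  and turns the other ones into elements that fix \<open>b\<close>, without changing the generated group.
\<close>

lemma sims_correct:
  assumes A: "set A \<subseteq> perms n"
  shows "set (sims n A) \<subseteq> perms n" "closure n (set (sims n A)) = closure n (set A)"
proof -
  let ?f = "\<lambda>s b. let r = sift n b (snd s) in (fst r @ fst s, snd r)"
  let ?s = "\<lambda>i. foldl ?f ([], map (norm_map n) A) [0..<i]"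
  have inv: "set (fst (?s i)) \<union> set (snd (?s i)) \<subseteq> closure n (set A) \<and>
      set A \<subseteq> closure n (set (fst (?s i)) \<union> set (snd (?s i))) \<and>
      length (fst (?s i)) \<le> i * n \<and> (\<forall>r \<in> set (snd (?s i)). \<forall>x<i. get r x = x)" if "i \<le> n" for i
    using that
  proof (induction i)
    case 0
    have "map (norm_map n) A = A" using A by (intro map_idI) auto
    then show ?case using closure_incl[OF A] by auto
  next
    case (Suc i)
    let ?r = "sift n i (snd (?s i))"
    have IH: "set (fst (?s i)) \<union> set (snd (?s i)) \<subseteq> closure n (set A)"
      "set A \<subseteq> closure n (set (fst (?s i)) \<union> set (snd (?s i)))"
      "length (fst (?s i)) \<le> i * n" "\<forall>r \<in> set (snd (?s i)). \<forall>x<i. get r x = x" and i: "i < n"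
      using Suc by auto
    have clA: "closure n (set A) \<subseteq> perms n" by (rule closure_perms[OF A])
    have R: "set (snd (?s i)) \<subseteq> perms n" using IH(1) clA by auto
    note sc = sift_correct[OF R i]
    have step: "?s (Suc i) = (fst ?r @ fst (?s i), snd ?r)" by (simp add: Let_def)
    have reps: "set (fst ?r) \<subseteq> set (snd (?s i))" by (rule sift_bounds(1))
    have rest: "set (snd ?r) \<subseteq> closure n (set A)"
      using sc(1) closure_mono[of "set (snd (?s i))" n "set A"] IH(1) A by auto
    let ?U = "set (fst ?r @ fst (?s i)) \<union> set (snd ?r)"
    have U: "?U \<subseteq> closure n (set A)" using reps rest IH(1) by auto
    then have Up: "?U \<subseteq> perms n" using clA by auto
    have "set (snd (?s i)) \<subseteq> closure n ?U"
      using sc(2) closure_mono_subset[OF _ Up, of "set (fst ?r) \<union> set (snd ?r)"] by auto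
    then have "set (fst (?s i)) \<union> set (snd (?s i)) \<subseteq> closure n ?U"
      using closure_incl[OF Up] by auto
    then have "set A \<subseteq> closure n ?U" using IH(2) closure_mono[OF _ Up] by blast
    moreover have "length (fst ?r) \<le> n"
    proof -
      have "(\<lambda>t. get t i) ` set (fst ?r) \<subseteq> {..<n}"
        using reps R i by (auto intro!: get_maps_lt perms_maps)
      then have "card (set (map (\<lambda>t. get t i) (fst ?r))) \<le> n"
        using card_mono[of "{..<n}"] by auto
      then show ?thesis using distinct_card[OF sc(3)] by simp
    qed
    moreover have "\<forall>r \<in> set (snd ?r). \<forall>x<Suc i. get r x = x"
      using sc(4) IH(4) i by (auto simp: less_Suc_eq)
    ultimately show ?case unfolding step fst_conv snd_conv using U IH(3) by auto
  qed
  \<comment> \<open>At most n elements are kept for each of the n base points, so the cut-off in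
    \<open>sims\<close> discards nothing.\<close>
  have "length (fst (?s n)) \<le> n * n" using inv[of n] by simp
  then have sims: "sims n A = fst (?s n)"
    by (simp add: sims_def length_concat o_def map_replicate_const sum_list_replicate)
  have clA: "closure n (set A) \<subseteq> perms n" by (rule closure_perms[OF A])
  then show p: "set (sims n A) \<subseteq> perms n" using inv[of n] sims by auto
  \<comment> \<open>A residue left after the last base point fixes every point, so only copies of
    the identity are dropped.\<close>
  have "set (snd (?s n)) \<subseteq> {[0..<n]}"
  proof
    fix r assume r: "r \<in> set (snd (?s n))"
    then have "r \<in> maps n" "\<forall>x<n. get r x = x" using inv[of n] clA by auto
    then show "r \<in> {[0..<n]}" using maps_eqI[of r n "[0..<n]"] by simp
  qed
  then have "set (fst (?s n)) \<union> set (snd (?s n)) \<subseteq> insert [0..<n] (set (sims n A))"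
    unfolding sims by auto
  then have "closure n (set (fst (?s n)) \<union> set (snd (?s n))) \<subseteq> closure n (insert [0..<n] (set (sims n A)))"
    using p by (intro closure_mono_subset) auto
  then have "set A \<subseteq> closure n (set (sims n A))"
    using inv[of n] closure_insert_id[OF p] by auto
  moreover have "set (sims n A) \<subseteq> closure n (set A)" using inv[of n] sims by auto
  ultimately show "closure n (set (sims n A)) = closure n (set A)"
    by (intro closure_eqI p A)
qed


subsection \<open>Orbits and stabilizers\<close>

definition orbit_entries :: "nat \<Rightarrow> nat list list \<Rightarrow> nat list \<Rightarrow> (nat list \<times> nat list) list \<Rightarrow> bool" where
  "orbit_entries n A c L \<longleftrightarrow> (c, [0..<n]) \<in> set L \<and> distinct (map fst L) \<and>
     (\<forall>e \<in> set L. snd e \<in> closure n (set A) \<and> fst e = conj_by n (snd e) c)"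

definition orbit_closed :: "nat \<Rightarrow> nat list list \<Rightarrow> (nat list \<times> nat list) list \<Rightarrow> bool" where
  "orbit_closed n A L \<longleftrightarrow> (\<forall>e \<in> set L. \<forall>s \<in> set A. conj_by n s (fst e) \<in> fst ` set L)"

lemma foldl_insert_entry:
  assumes "distinct (map fst L)"
  shows "distinct (map fst (foldl insert_entry L k)) \<and> set L \<subseteq> set (foldl insert_entry L k) \<and>
    fst ` set (foldl insert_entry L k) = fst ` set L \<union> fst ` set k \<and>
    length L \<le> length (foldl insert_entry L k) \<and>
    (length L = length (foldl insert_entry L k) \<longrightarrow> foldl insert_entry L k = L)"
  using assms
proof (induction k arbitrary: L)
  case (Cons a k)
  have d: "distinct (map fst (insert_entry L a))"
    using Cons.prems by (auto simp: insert_entry_def list_ex_iff)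
  have 1: "fst ` set (insert_entry L a) = insert (fst a) (fst ` set L)"
  proof (cases "list_ex (\<lambda>d. fst d = fst a) L")
    case True
    then obtain d where d: "d \<in> set L" "fst d = fst a" unfolding list_ex_iff by blast
    then have "fst a \<in> fst ` set L" using imageI[OF d(1), of fst] by simp
    then have "insert (fst a) (fst ` set L) = fst ` set L" by (rule insert_absorb)
    moreover have "insert_entry L a = L" using True by (simp add: insert_entry_def)
    ultimately show ?thesis by (simp only:)
  qed (simp add: insert_entry_def)
  have 2: "set L \<subseteq> set (insert_entry L a)"
    and 3: "length L \<le> length (insert_entry L a)"
    and 4: "length L = length (insert_entry L a) \<Longrightarrow> insert_entry L a = L"
    by (auto simp: insert_entry_def split: if_splits)
  note IH = Cons.IH[OF d]
  show ?case unfolding foldl_Cons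
  proof (intro conjI impI)
    show "set L \<subseteq> set (foldl insert_entry (insert_entry L a) k)" using 2 IH by blast
    show "fst ` set (foldl insert_entry (insert_entry L a) k) = fst ` set L \<union> fst ` set (a # k)"
      using 1 IH by simp
    show "length L \<le> length (foldl insert_entry (insert_entry L a) k)" using 3 IH by linarith
    assume eq: "length L = length (foldl insert_entry (insert_entry L a) k)"
    then have "length L = length (insert_entry L a)" using 3 IH by linarith
    with 4 have "insert_entry L a = L" by blast
    with eq IH show "foldl insert_entry (insert_entry L a) k = L" by metis
  qed (use IH in blast)
qed simp

text \<open>The keys of an orbit list are distinct points of the orbit, so it has at most
  \<open>M\<close> entries and \<open>take M\<close> is harmless. If a round adds no entry, all
  images of the present points were present already.\<close>

lemma grow_correct:
  assumes A: "set A \<subseteq> perms n" and c: "c \<in> maps n"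
    and M: "card ((\<lambda>u. conj_by n u c) ` closure n (set A)) \<le> M"
    and L: "orbit_entries n A c L"
  shows "orbit_entries n A c (grow n M A L)" "length L \<le> M"
    "orbit_closed n A L \<or> length L < length (grow n M A L)"
    "orbit_closed n A L \<Longrightarrow> grow n M A L = L"
proof -
  let ?k = "concat (map (\<lambda>e. map (\<lambda>s. (conj_by n s (fst e), cmp n s (snd e))) A) L)"
  let ?L = "foldl insert_entry L ?k"
  have dL: "distinct (map fst L)" using L by (simp add: orbit_entries_def)
  note fi = foldl_insert_entry[OF dL, of ?k]
  have clp: "closure n (set A) \<subseteq> perms n" by (rule closure_perms[OF A])
  have k: "snd e \<in> closure n (set A) \<and> fst e = conj_by n (snd e) c" if e: "e \<in> set ?k" for e
  proof -
    obtain d s where d: "d \<in> set L" "s \<in> set A" "e = (conj_by n s (fst d), cmp n s (snd d))" using e by auto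
    then have "snd d \<in> closure n (set A)" "fst d = conj_by n (snd d) c" using L by (auto simp: orbit_entries_def)
    moreover from this have "snd d \<in> perms n" "s \<in> perms n" using d(2) A clp by auto
    ultimately show ?thesis
      using d c conj_by_cmp[of s n "snd d" c] by (auto intro: closure_step)
  qed
  have ent: "orbit_entries n A c ?L"
    using fi L k insert_entry_bounds(1)[of L ?k] unfolding orbit_entries_def by blast
  have len: "length K \<le> M" if "orbit_entries n A c K" for K
  proof -
    have "finite ((\<lambda>u. conj_by n u c) ` closure n (set A))"
      using finite_subset[OF clp finite_perms] by simp
    moreover have "fst ` set K \<subseteq> (\<lambda>u. conj_by n u c) ` closure n (set A)"
      using that by (auto simp: orbit_entries_def)
    ultimately have "card (fst ` set K) \<le> M" using M card_mono le_trans by blast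
    moreover have "card (fst ` set K) = length K"
      using that distinct_card[of "map fst K"] by (simp add: orbit_entries_def)
    ultimately show ?thesis by simp
  qed
  then show "length L \<le> M" using L by blast
  have g: "grow n M A L = ?L" using len[OF ent] by (simp add: grow_def)
  show "orbit_entries n A c (grow n M A L)" using ent g by simp
  have cl: "orbit_closed n A L \<longleftrightarrow> fst ` set ?k \<subseteq> fst ` set L"
  proof -
    have "fst ` set ?k = (\<Union>e\<in>set L. (\<lambda>s. conj_by n s (fst e)) ` set A)"
      by (simp add: image_UN image_image)
    then show ?thesis
      unfolding orbit_closed_def by (simp only: UN_subset_iff image_subset_iff)
  qed
  show "orbit_closed n A L \<or> length L < length (grow n M A L)"
  proof (cases "length L = length ?L")
    case True
    with fi have e: "?L = L" by blast
    have "fst ` set ?L = fst ` set L \<union> fst ` set ?k" using fi by blast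
    then have "fst ` set ?k \<subseteq> fst ` set ?L" by (rule ssubst) (rule Un_upper2)
    then have "fst ` set ?k \<subseteq> fst ` set L" by (simp only: e)
    then show ?thesis by (simp only: cl simp_thms)
  next
    case False
    with fi show ?thesis unfolding g by linarith
  qed
  assume "orbit_closed n A L"
  then have "fst ` set ?k \<subseteq> fst ` set L" by (simp only: cl)
  moreover have "fst ` set ?L = fst ` set L \<union> fst ` set ?k" using fi by blast
  ultimately have "fst ` set ?L = fst ` set L" by (simp only: Un_absorb2)
  then have "card (set (map fst ?L)) = card (set (map fst L))" by simp
  then have "length ?L = length L" using fi dL by (simp add: distinct_card del: set_map)
  then show "grow n M A L = L" using fi g by simp
qed

lemma orbit_list_correct:
  assumes A: "set A \<subseteq> perms n" and c: "c \<in> maps n"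
    and M: "card ((\<lambda>u. conj_by n u c) ` closure n (set A)) \<le> M"
  shows "orbit_entries n A c (orbit_list n M A c)" "orbit_closed n A (orbit_list n M A c)"
proof -
  let ?L = "\<lambda>i. foldl (\<lambda>L _. grow n M A L) [(c, [0..<n])] (replicate i ())"
  have step: "?L (Suc i) = grow n M A (?L i)" for i
    by (simp flip: replicate_append_same)
  have ent: "orbit_entries n A c (?L i)" for i
  proof (induction i)
    case 0 show ?case using c by (simp add: orbit_entries_def closure_id)
  next
    case (Suc i) then show ?case unfolding step by (rule grow_correct(1)[OF assms])
  qed
  \<comment> \<open>For i = M the second alternative contradicts the bound \<open>M\<close> on the
    length, so the list is closed by then.\<close>
  have len: "orbit_closed n A (?L i) \<or> i < length (?L i)" for i
  proof (induction i)
    case (Suc i)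
    show ?case
    proof (cases "orbit_closed n A (?L i)")
      case True
      then show ?thesis unfolding step using grow_correct(4)[OF assms ent[of i]] by simp
    next
      case False
      then show ?thesis unfolding step using Suc grow_correct(3)[OF assms ent[of i]] by linarith
    qed
  qed simp
  show "orbit_entries n A c (orbit_list n M A c)" unfolding orbit_list_def by (rule ent)
  show "orbit_closed n A (orbit_list n M A c)"
    unfolding orbit_list_def using len[of M] grow_correct(2)[OF assms ent[of M]] by auto
qed

lemma orbit_complete:
  assumes A: "set A \<subseteq> perms n" and c: "c \<in> maps n"
    and L: "orbit_entries n A c L" "orbit_closed n A L" and u: "u \<in> closure n (set A)"
  shows "conj_by n u c \<in> fst ` set L"
  using u
proof induction
  case closure_id
  then show ?case using L(1) c by (force simp: orbit_entries_def)
next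
  case (closure_step s f)
  then have "s \<in> perms n" "f \<in> perms n" using A closure_perms[OF A] by auto
  then show ?case using closure_step L(2) c by (auto simp: conj_by_cmp orbit_closed_def)
qed

lemma lookup_in:
  assumes "orbit_entries n A c L" "d \<in> fst ` set L"
  shows "(d, lookup L d) \<in> set L"
proof -
  have "filter (\<lambda>e. fst e = d) L \<noteq> []" using assms(2) by (auto simp: filter_empty_conv)
  then obtain e es where "filter (\<lambda>e. fst e = d) L = e # es" by (cases "filter (\<lambda>e. fst e = d) L") auto
  then have "e \<in> set (filter (\<lambda>e. fst e = d) L)" "lookup L d = snd e"
    by (simp_all add: lookup_def first_def)
  then have "e \<in> set L" "fst e = d" "lookup L d = snd e" by (simp_all only: set_filter mem_Collect_eq)
  then show ?thesis by (metis prod.collapse)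
qed

lemma lookup_eq:
  assumes "orbit_entries n A c L" "(d, u) \<in> set L" shows "lookup L d = u"
proof -
  have "(d, lookup L d) \<in> set L" using lookup_in[OF assms(1)] assms(2) by force
  moreover have "distinct (map fst L)" using assms(1) by (simp add: orbit_entries_def)
  ultimately show ?thesis using assms(2) by (metis eq_key_imp_eq_value)
qed

text \<open>Schreier's lemma. By induction over left multiplication by generators, every group
  element is a stored witness times a product of Schreier generators. If the element fixes
  \<open>c\<close>, the witness belongs to \<open>c\<close> and is the identity, as keys are
  distinct.\<close>

lemma schreier_correct:
  assumes A: "set A \<subseteq> perms n" and c: "c \<in> maps n"
    and L: "orbit_entries n A c L" "orbit_closed n A L"
  shows "set (schreier n L A) \<subseteq> perms n"
    "closure n (set (schreier n L A)) = {u \<in> closure n (set A). conj_by n u c = c}"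
proof -
  let ?S = "set (schreier n L A)"
  let ?H = "{u \<in> closure n (set A). conj_by n u c = c}"
  note G = perm_groupD[OF perm_group_closure[OF A]]
  have ent: "snd e \<in> closure n (set A)" "fst e = conj_by n (snd e) c" "snd e \<in> perms n"
    if "e \<in> set L" for e
    using that L(1) G(1) by (auto simp: orbit_entries_def)
  have look: "(conj_by n s (fst e), lookup L (conj_by n s (fst e))) \<in> set L"
    if "e \<in> set L" "s \<in> set A" for e s
    using that L(2) by (intro lookup_in[OF L(1)]) (auto simp: orbit_closed_def)
  have H: "perm_group n ?H"
    by (rule perm_group_closed_finite) (use G c closure_id in \<open>auto simp: conj_by_cmp subset_iff\<close>)
  have SH: "?S \<subseteq> ?H"
  proof
    fix g assume "g \<in> ?S"
    then obtain e s where e: "e \<in> set L" "s \<in> set A"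
      "g = cmp n (pinv n (lookup L (conj_by n s (fst e)))) (cmp n s (snd e))"
      by (auto simp: schreier_def)
    let ?w = "lookup L (conj_by n s (fst e))"
    have w: "?w \<in> closure n (set A)" "conj_by n s (fst e) = conj_by n ?w c" "?w \<in> perms n"
      using ent[OF look[OF e(1,2)]] by auto
    have s: "s \<in> closure n (set A)" "s \<in> perms n" using e(2) A closure_incl[OF A] by auto
    have "g \<in> closure n (set A)" unfolding e(3) by (intro G(3,4) w s ent[OF e(1)])
    moreover have "conj_by n g c = c"
    proof -
      have "conj_by n g c = conj_by n (pinv n ?w) (conj_by n s (fst e))"
        unfolding e(3) conj_by_cmp[OF pinv_perms[OF w(3)] cmp_perms[OF s(2) ent(3)[OF e(1)]] c]
          conj_by_cmp[OF s(2) ent(3)[OF e(1)] c] ent(2)[OF e(1), symmetric] ..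
      also have "\<dots> = conj_by n (pinv n ?w) (conj_by n ?w c)" by (rule arg_cong[OF w(2)])
      finally show ?thesis unfolding conj_by_pinv(2)[OF w(3) c] .
    qed
    ultimately show "g \<in> ?H" by simp
  qed
  then show S: "?S \<subseteq> perms n" using G(1) by auto
  have factor: "\<exists>e \<in> set L. \<exists>h \<in> closure n ?S. u = cmp n (snd e) h" if "u \<in> closure n (set A)" for u
    using that
  proof induction
    case closure_id
    show ?case
      by (rule bexI[of _ "(c, [0..<n])"], rule bexI[of _ "[0..<n]"])
        (use L(1) in \<open>auto simp: orbit_entries_def closure.closure_id\<close>)
  next
    case (closure_step s u)
    then obtain e h where e: "e \<in> set L" "h \<in> closure n ?S" "u = cmp n (snd e) h" by blast
    let ?w = "lookup L (conj_by n s (fst e))"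
    let ?g = "cmp n (pinv n ?w) (cmp n s (snd e))"
    have g: "?g \<in> ?S" using e(1) closure_step(1) by (auto simp: schreier_def)
    have p: "?w \<in> perms n" "s \<in> perms n" "snd e \<in> perms n" "h \<in> perms n"
      using ent(3)[OF look[OF e(1) closure_step(1)]] closure_step(1) A ent(3)[OF e(1)]
        closure_perms[OF S] e(2) by auto
    have "cmp n s u = cmp n ?w (cmp n ?g h)"
      using p by (simp add: e(3) cmp_assoc)
    moreover have "cmp n ?g h \<in> closure n ?S" by (rule closure.closure_step[OF g e(2)])
    ultimately show ?case using look[OF e(1) closure_step(1)] by force
  qed
  have "?H \<subseteq> closure n ?S"
  proof
    fix u assume u: "u \<in> ?H"
    then obtain e h where e: "e \<in> set L" "h \<in> closure n ?S" "u = cmp n (snd e) h"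
      using factor by blast
    have h: "h \<in> ?H" using closure_subset[OF H SH] e(2) by auto
    have "fst e = conj_by n (snd e) (conj_by n h c)" using ent[OF e(1)] h by simp
    also have "\<dots> = conj_by n u c"
      using ent[OF e(1)] h c G(1) unfolding e(3) by (subst conj_by_cmp) auto
    finally have "fst e = c" using u by simp
    then have "snd e = [0..<n]"
      using lookup_eq[OF L(1), of c "snd e"] lookup_eq[OF L(1), of c "[0..<n]"] e(1) L(1)
      by (cases e) (auto simp: orbit_entries_def)
    then show "u \<in> closure n ?S" using e h G(1) by auto
  qed
  then show "closure n ?S = ?H" using closure_subset[OF H SH] by blast
qed

definition transporter :: "nat \<Rightarrow> nat list set \<Rightarrow> (nat list \<times> nat list) list \<Rightarrow> nat list set" where
  "transporter n B ps = {u \<in> B. \<forall>p \<in> set ps. conj_by n u (fst p) = snd p}"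

text \<open>The elements that solve the pairs form a coset v H of the stabilizer H of the first
  components, unless there are none. The bound \<open>M\<close> is demanded only for the orbit of
  each map under the stabilizer of the earlier ones, not under the whole group.\<close>

lemma transport_correct:
  assumes A: "set A \<subseteq> perms n" and "set ps \<subseteq> maps n \<times> maps n"
    and "\<And>i. i < length ps \<Longrightarrow> card ((\<lambda>u. conj_by n u (fst (ps ! i))) `
        transporter n (closure n (set A)) (map (\<lambda>p. (fst p, fst p)) (take i ps))) \<le> M"
  shows "(transport n M A ps = [] \<and> transporter n (closure n (set A)) ps = {}) \<or>
    (\<exists>B v. transport n M A ps = [(B, v)] \<and> v \<in> transporter n (closure n (set A)) ps \<and>
      set B \<subseteq> perms n \<and>
      closure n (set B) = transporter n (closure n (set A)) (map (\<lambda>p. (fst p, fst p)) ps))"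
  using assms(2,3)
proof (induction ps rule: rev_induct)
  case Nil
  then show ?case using A by (simp add: transport_def transporter_def closure_id)
next
  case (snoc p ps)
  let ?G = "closure n (set A)"
  note G = perm_groupD[OF perm_group_closure[OF A]]
  have p: "fst p \<in> maps n" "snd p \<in> maps n" and ps: "set ps \<subseteq> maps n \<times> maps n"
    using snoc.prems(1) by (auto simp: mem_Times_iff)
  have "card ((\<lambda>u. conj_by n u (fst (ps ! i))) `
        transporter n ?G (map (\<lambda>p. (fst p, fst p)) (take i ps))) \<le> M" if "i < length ps" for i
    using snoc.prems(2)[of i] that by (simp add: nth_append)
  from snoc.IH[OF ps this] consider "transport n M A ps = []" "transporter n ?G ps = {}"
    | B v where "transport n M A ps = [(B, v)]" "v \<in> transporter n ?G ps" "set B \<subseteq> perms n"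
      "closure n (set B) = transporter n ?G (map (\<lambda>p. (fst p, fst p)) ps)" by blast
  then show ?case
  proof cases
    case 1
    then have "transport n M A (ps @ [p]) = []" by (simp add: transport_def transport_step_def)
    moreover have "transporter n ?G (ps @ [p]) = {}" using 1(2) by (auto simp: transporter_def)
    ultimately show ?thesis by simp
  next
    case (2 B v)
    let ?H = "transporter n ?G (map (\<lambda>p. (fst p, fst p)) ps)"
    let ?L = "orbit_list n M B (fst p)"
    have M: "card ((\<lambda>u. conj_by n u (fst p)) ` closure n (set B)) \<le> M"
      using snoc.prems(2)[of "length ps"] by (simp add: 2(4))
    note L = orbit_list_correct[OF 2(3) p(1) M]
    note sch = schreier_correct[OF 2(3) p(1) L]
    have v: "v \<in> ?G" "v \<in> perms n" "\<And>q. q \<in> set ps \<Longrightarrow> conj_by n v (fst q) = snd q"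
      using 2(2) G(1) by (auto simp: transporter_def)
    have H: "h \<in> ?H \<Longrightarrow> h \<in> ?G \<and> h \<in> perms n \<and> (\<forall>q \<in> set ps. conj_by n h (fst q) = fst q)" for h
      using G(1) by (auto simp: transporter_def)
    \<comment> \<open>Writing u = v h turns the condition of the new pair into one on h, an element
      of the stabilizer reached so far.\<close>
    have trans: "transporter n ?G (ps @ [p]) = cmp n v ` {h \<in> ?H. conj_by n h (fst p) = conj_by n (pinv n v) (snd p)}"
    proof (intro equalityI subsetI)
      fix u assume u: "u \<in> transporter n ?G (ps @ [p])"
      then have up: "u \<in> ?G" "u \<in> perms n" "\<And>q. q \<in> set ps \<Longrightarrow> conj_by n u (fst q) = snd q"
        "conj_by n u (fst p) = snd p"
        using G(1) by (auto simp: transporter_def)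
      let ?h = "cmp n (pinv n v) u"
      have "?h \<in> ?G" using v up G(3,4) by blast
      moreover have "conj_by n ?h (fst q) = fst q" if "q \<in> set ps" for q
      proof -
        have q: "fst q \<in> maps n" using that ps by (auto simp: mem_Times_iff)
        have "conj_by n ?h (fst q) = conj_by n (pinv n v) (conj_by n v (fst q))"
          using v(2) up(2) q v(3)[OF that] up(3)[OF that] by (simp add: conj_by_cmp)
        then show ?thesis using v(2) q by simp
      qed
      ultimately have "?h \<in> ?H" by (auto simp: transporter_def)
      moreover have "conj_by n ?h (fst p) = conj_by n (pinv n v) (snd p)"
        using v(2) up p by (simp add: conj_by_cmp)
      moreover have "u = cmp n v ?h" using v(2) up(2) by simp
      ultimately show "u \<in> cmp n v ` {h \<in> ?H. conj_by n h (fst p) = conj_by n (pinv n v) (snd p)}"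
        by blast
    next
      fix u assume "u \<in> cmp n v ` {h \<in> ?H. conj_by n h (fst p) = conj_by n (pinv n v) (snd p)}"
      then obtain h where h: "h \<in> ?H" "conj_by n h (fst p) = conj_by n (pinv n v) (snd p)" "u = cmp n v h"
        by blast
      have "conj_by n u (fst q) = snd q" if "q \<in> set ps" for q
      proof -
        have "fst q \<in> maps n" using that ps by (auto simp: mem_Times_iff)
        then show ?thesis using H[OF h(1)] v that by (simp add: h(3) conj_by_cmp)
      qed
      moreover have "conj_by n u (fst p) = snd p" using H[OF h(1)] v p h(2) by (simp add: h(3) conj_by_cmp)
      moreover have "u \<in> ?G" using v(1) H[OF h(1)] G(3) h(3) by blast
      ultimately show "u \<in> transporter n ?G (ps @ [p])" by (auto simp: transporter_def)
    qed
    let ?F = "filter (\<lambda>d. fst d = conj_by n (pinv n v) (snd p)) ?L"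
    have step: "transport n M A (ps @ [p]) = (case ?F of [] \<Rightarrow> []
      | d # _ \<Rightarrow> [(sims n (schreier n ?L B), cmp n v (snd d))])"
    proof -
      have "transport n M A (ps @ [p]) = transport_step n M [(B, v)] p"
        using 2(1) by (simp add: transport_def)
      then show ?thesis unfolding transport_step_def Let_def list.case fst_conv snd_conv .
    qed
    show ?thesis
    proof (cases ?F)
      case Nil
      have "{h \<in> ?H. conj_by n h (fst p) = conj_by n (pinv n v) (snd p)} = {}"
      proof (rule ccontr)
        assume "\<not> ?thesis"
        then obtain h where "h \<in> closure n (set B)" "conj_by n h (fst p) = conj_by n (pinv n v) (snd p)"
          using 2(4) by auto
        then have "conj_by n (pinv n v) (snd p) \<in> fst ` set ?L"
          using orbit_complete[OF 2(3) p(1) L] by metis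
        with Nil show False by (auto simp: filter_empty_conv)
      qed
      then have "transporter n ?G (ps @ [p]) = {}" unfolding trans by simp
      then show ?thesis using step Nil by simp
    next
      case (Cons d ds)
      have "d \<in> set ?F" by (simp add: Cons)
      then have d: "d \<in> set ?L" "fst d = conj_by n (pinv n v) (snd p)" by auto
      have dH: "snd d \<in> ?H" "conj_by n (snd d) (fst p) = conj_by n (pinv n v) (snd p)"
        using d L(1) 2(4) by (auto simp: orbit_entries_def)
      have "cmp n v (snd d) \<in> transporter n ?G (ps @ [p])"
        unfolding trans using dH by blast
      moreover have "closure n (set (sims n (schreier n ?L B))) =
          transporter n ?G (map (\<lambda>p. (fst p, fst p)) (ps @ [p]))"
        unfolding sims_correct(2)[OF sch(1)] sch(2) 2(4) by (auto simp: transporter_def)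
      ultimately show ?thesis using step Cons sims_correct(1)[OF sch(1)] by simp
    qed
  qed
qed


section \<open>Correctness of the extension from one member of the chain to the next\<close>

section \<open>Groups with a chain of initial segments\<close>

text \<open>Normality is stated as moving \<open>z\<close> to the right past \<open>x\<close>. In
  this form it rewrites a x b as a b w and hence as an element of the coset of a b.\<close>

locale chain_table =
  fixes n :: nat and g :: "nat list list" and K :: "nat list"
  assumes K_nonempty: "K \<noteq> []"
    and K_first: "K ! 0 = 1"
    and K_last: "K ! (length K - 1) = n"
    and K_mono: "i \<le> j \<Longrightarrow> j < length K \<Longrightarrow> K ! i \<le> K ! j"
    and mul_closed: "i < length K \<Longrightarrow> x < K ! i \<Longrightarrow> y < K ! i \<Longrightarrow> mul g x y < K ! i"
    and inverse_ex: "i < length K \<Longrightarrow> x < K ! i \<Longrightarrow> \<exists>y < K ! i. mul g x y = 0 \<and> mul g y x = 0"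
    and mul_assoc: "x < n \<Longrightarrow> y < n \<Longrightarrow> z < n \<Longrightarrow> mul g (mul g x y) z = mul g x (mul g y z)"
    and mul_0_left: "x < n \<Longrightarrow> mul g 0 x = x"
    and mul_0_right: "x < n \<Longrightarrow> mul g x 0 = x"
    and normal: "Suc i < length K \<Longrightarrow> x < K ! Suc i \<Longrightarrow> z < K ! i \<Longrightarrow>
      \<exists>w < K ! i. mul g z x = mul g x w"
begin

lemma K_le_n: "i < length K \<Longrightarrow> K ! i \<le> n"
  using K_mono[of i "length K - 1"] K_last by simp

lemma less_K_less_n: "i < length K \<Longrightarrow> x < K ! i \<Longrightarrow> x < n"
  using K_le_n[of i] by linarith

lemma K_pos: "i < length K \<Longrightarrow> 0 < K ! i"
  using K_mono[of 0 i] K_first by simp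

lemma n_pos: "0 < n"
  using K_pos[of "length K - 1"] K_last K_nonempty by simp

lemma last_index: "length K - 1 < length K"
  using K_nonempty by simp

lemma mul_less: "x < n \<Longrightarrow> y < n \<Longrightarrow> mul g x y < n"
  using mul_closed[OF last_index] K_last by simp

lemma left_cancel:
  assumes "x < n" "y < n" "z < n" "mul g x y = mul g x z" shows "y = z"
proof -
  obtain w where w: "w < n" "mul g w x = 0" using inverse_ex[OF last_index, of x] assms K_last by auto
  have "mul g (mul g w x) y = mul g w (mul g x y)" using assms w by (intro mul_assoc)
  also have "\<dots> = mul g w (mul g x z)" by (simp only: assms(4))
  also have "\<dots> = mul g (mul g w x) z" using assms w by (intro mul_assoc[symmetric])
  finally show ?thesis using assms w by (simp add: mul_0_left)
qed

text \<open>Having \<open>0\<close> among the representatives makes a lifted map t z -> t u(z) an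
  extension of u: take t = 0.\<close>

definition coset_reps :: "nat \<Rightarrow> nat list \<Rightarrow> bool" where
  "coset_reps i T \<longleftrightarrow> distinct T \<and> 0 \<in> set T \<and> set T \<subseteq> {..<K ! Suc i} \<and>
     (\<forall>x < K ! Suc i. \<exists>t \<in> set T. \<exists>z < K ! i. mul g t z = x) \<and>
     (\<forall>t \<in> set T. \<forall>t' \<in> set T. \<forall>z < K ! i. \<forall>z' < K ! i. mul g t z = mul g t' z' \<longrightarrow> t = t' \<and> z = z')"

lemma coset_repsD:
  assumes "coset_reps i T"
  shows "distinct T" "t \<in> set T \<Longrightarrow> t < K ! Suc i"
    "t \<in> set T \<Longrightarrow> t' \<in> set T \<Longrightarrow> z < K ! i \<Longrightarrow> z' < K ! i \<Longrightarrow> mul g t z = mul g t' z' \<Longrightarrow> t = t'"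
    "t \<in> set T \<Longrightarrow> t' \<in> set T \<Longrightarrow> z < K ! i \<Longrightarrow> z' < K ! i \<Longrightarrow> mul g t z = mul g t' z' \<Longrightarrow> z = z'"
    "0 \<in> set T"
  using assms unfolding coset_reps_def by blast+

lemma coset_repsE:
  assumes "coset_reps i T" "x < K ! Suc i"
  obtains t z where "t \<in> set T" "z < K ! i" "x = mul g t z"
  using assms unfolding coset_reps_def by metis

lemma transversal_correct:
  assumes i: "Suc i < length K"
  shows "coset_reps i (transversal g (K ! i) (K ! Suc i))"
proof -
  let ?T = "\<lambda>m. transversal g (K ! i) m"
  have i': "i < length K" using i by simp
  have inv: "distinct (?T m) \<and> set (?T m) \<subseteq> {..<m} \<and> (0 < m \<longrightarrow> 0 \<in> set (?T m)) \<and>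
      (\<forall>x < m. \<exists>t \<in> set (?T m). \<exists>z < K ! i. mul g t z = x) \<and>
      (\<forall>t \<in> set (?T m). \<forall>t' \<in> set (?T m). \<forall>z < K ! i. mul g t z = t' \<longrightarrow> t = t')" if "m \<le> K ! Suc i" for m
    using that
  proof (induction m)
    case 0 then show ?case by (simp add: transversal_def)
  next
    case (Suc m)
    have step: "?T (Suc m) = (if \<exists>t \<in> set (?T m). \<exists>z < K ! i. mul g t z = m then ?T m else ?T m @ [m])"
      by (simp add: transversal_def list_ex_iff Bex_def)
    have IH: "distinct (?T m)" "set (?T m) \<subseteq> {..<m}" "0 < m \<longrightarrow> 0 \<in> set (?T m)"
      "\<forall>x < m. \<exists>t \<in> set (?T m). \<exists>z < K ! i. mul g t z = x"
      "\<forall>t \<in> set (?T m). \<forall>t' \<in> set (?T m). \<forall>z < K ! i. mul g t z = t' \<longrightarrow> t = t'"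
      using Suc by auto
    have m: "m < n" using Suc.prems less_K_less_n[OF i, of m] by simp
    show ?case
    proof (cases "\<exists>t \<in> set (?T m). \<exists>z < K ! i. mul g t z = m")
      case True
      then have "?T (Suc m) = ?T m" unfolding step by simp
      moreover have "0 < m" using True IH(2) by (cases m) auto
      ultimately show ?thesis using IH True by (auto simp: less_Suc_eq)
    next
      case False
      then have T: "?T (Suc m) = ?T m @ [m]" unfolding step by simp
      \<comment> \<open>If m z were an earlier representative t, then m = t z^-1 would lie in a
        coset already represented.\<close>
      have "mul g m z \<noteq> t" if t: "t \<in> set (?T m)" and z: "z < K ! i" for t z
      proof
        assume eq: "mul g m z = t"
        obtain w where w: "w < K ! i" "mul g z w = 0" using inverse_ex[OF i' z] by blast
        have "mul g t w = mul g m (mul g z w)"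
          using m z w less_K_less_n[OF i'] by (simp add: mul_assoc flip: eq)
        then have "mul g t w = m" using m w(2) by (simp add: mul_0_right)
        with False t w(1) show False by blast
      qed
      moreover have "\<exists>z < K ! i. mul g m z = m" using mul_0_right[OF m] K_pos[OF i'] by blast
      ultimately show ?thesis unfolding T using IH False by (auto simp: less_Suc_eq)
    qed
  qed
  have T: "distinct (?T (K ! Suc i))" "set (?T (K ! Suc i)) \<subseteq> {..<K ! Suc i}"
    "0 \<in> set (?T (K ! Suc i))"
    "\<forall>x < K ! Suc i. \<exists>t \<in> set (?T (K ! Suc i)). \<exists>z < K ! i. mul g t z = x"
    "\<And>t t' z. t \<in> set (?T (K ! Suc i)) \<Longrightarrow> t' \<in> set (?T (K ! Suc i)) \<Longrightarrow> z < K ! i \<Longrightarrow> mul g t z = t' \<Longrightarrow> t = t'"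
    using inv[of "K ! Suc i"] K_pos[OF i] by auto
  \<comment> \<open>The greedy invariant only treats equations t z = t' between representatives;
    multiplication by the inverse of z reduces the general case to it.\<close>
  have "t = t' \<and> z = z'"
    if t: "t \<in> set (?T (K ! Suc i))" "t' \<in> set (?T (K ! Suc i))" and z: "z < K ! i" "z' < K ! i"
      and eq: "mul g t z = mul g t' z'" for t t' z z'
  proof -
    have n: "t < n" "t' < n" "z < n" "z' < n"
      using t z T(2) less_K_less_n[OF i] less_K_less_n[OF i'] by auto
    obtain w where w: "w < K ! i" "mul g z w = 0" using inverse_ex[OF i' z(1)] by blast
    have "t = mul g t (mul g z w)" using n w(2) by (simp add: mul_0_right)
    also have "\<dots> = mul g (mul g t z) w" using n w less_K_less_n[OF i'] by (simp add: mul_assoc)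
    also have "\<dots> = mul g t' (mul g z' w)" using n w less_K_less_n[OF i'] by (simp add: eq mul_assoc)
    finally have "t' = t" using T(5)[OF t(2,1) mul_closed[OF i' z(2) w(1)]] by simp
    with eq n left_cancel show ?thesis by blast
  qed
  with T(1-4) show ?thesis unfolding coset_reps_def by blast
qed

lemma coset_reps_length:
  assumes i: "Suc i < length K" and T: "coset_reps i T"
  shows "length T * K ! i = K ! Suc i"
proof -
  have "bij_betw (\<lambda>p. mul g (fst p) (snd p)) (set T \<times> {..<K ! i}) {..<K ! Suc i}"
  proof (rule bij_betw_imageI)
    show "inj_on (\<lambda>p. mul g (fst p) (snd p)) (set T \<times> {..<K ! i})"
      using T by (auto simp: inj_on_def coset_reps_def)
    have "mul g t z < K ! Suc i" if "t \<in> set T" "z < K ! i" for t z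
      using mul_closed[OF i coset_repsD(2)[OF T that(1)], of z] that(2) K_mono[of i "Suc i"] i by simp
    then show "(\<lambda>p. mul g (fst p) (snd p)) ` (set T \<times> {..<K ! i}) = {..<K ! Suc i}"
      by (auto elim!: coset_repsE[OF T] simp: image_iff) blast
  qed
  from bij_betw_same_card[OF this] show ?thesis
    using distinct_card[OF coset_repsD(1)[OF T]] by (simp add: card_cartesian_product)
qed

lemma remainder_eq:
  assumes "coset_reps i T" "t \<in> set T" "z < K ! i"
  shows "remainder g (K ! i) T (mul g t z) = z"
proof -
  let ?l = "filter (\<lambda>h. list_ex (\<lambda>c. mul g c h = mul g t z) T) [0..<K ! i]"
  have "z \<in> set ?l" using assms by (auto simp: list_ex_iff)
  then have "?l \<noteq> []" by (metis empty_iff empty_set)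
  from first_in[OF this, of 0] have "first 0 ?l \<in> set ?l" .
  then show ?thesis
    unfolding remainder_def using coset_repsD(4)[OF assms(1) _ assms(2) _ assms(3)]
    by (auto simp: list_ex_iff)
qed

end


section \<open>Isomorphisms of partial chains\<close>

text \<open>
  Isomorphisms between the segments \<open>{..<K ! i}\<close> are represented by permutations of \<open>{..<n}\<close> that
  fix all other points.
\<close>

definition isos :: "nat \<Rightarrow> nat list list \<Rightarrow> nat list list \<Rightarrow> nat list \<Rightarrow> nat \<Rightarrow> nat list set" where
  "isos n g h K i = {f \<in> perms n.
     (\<forall>x < K ! i. \<forall>y < K ! i. get f (mul g x y) = mul h (get f x) (get f y)) \<and>
     (\<forall>j \<le> i. \<forall>x < K ! j. get f x < K ! j) \<and>
     (\<forall>x < n. K ! i \<le> x \<longrightarrow> get f x = x)}"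

lemma isosI:
  assumes "f \<in> perms n" "\<And>x y. x < K ! i \<Longrightarrow> y < K ! i \<Longrightarrow> get f (mul g x y) = mul h (get f x) (get f y)"
    "\<And>j x. j \<le> i \<Longrightarrow> x < K ! j \<Longrightarrow> get f x < K ! j" "\<And>x. x < n \<Longrightarrow> K ! i \<le> x \<Longrightarrow> get f x = x"
  shows "f \<in> isos n g h K i"
  using assms by (auto simp: isos_def)

lemma isosD:
  assumes "f \<in> isos n g h K i"
  shows "f \<in> perms n" "x < K ! i \<Longrightarrow> y < K ! i \<Longrightarrow> get f (mul g x y) = mul h (get f x) (get f y)"
    "x < n \<Longrightarrow> K ! i \<le> x \<Longrightarrow> get f x = x"
  using assms by (auto simp: isos_def)

lemma chain_map_iff:
  assumes "Suc i < length K" "f \<in> maps n"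
  shows "chain_map n g h (K ! Suc i # take (Suc i) K) (K ! Suc i) f \<longleftrightarrow> f \<in> isos n g h K (Suc i)"
proof -
  have "set (K ! Suc i # take (Suc i) K) = (!) K ` {..Suc i}"
  proof -
    have "{..Suc i} = insert (Suc i) {0..<Suc i}" by auto
    then show ?thesis using nth_image[of "Suc i" K] assms(1) by simp
  qed
  then have ks: "list_all P (K ! Suc i # take (Suc i) K) \<longleftrightarrow> (\<forall>j \<le> Suc i. P (K ! j))" for P
    by (simp only: list_all_iff) auto
  have upt: "list_all P [0..<m] \<longleftrightarrow> (\<forall>x < m. P x)" for P m
    by (auto simp: list_all_iff)
  have "(\<forall>x<n. \<forall>y<n. x = y \<or> get f x \<noteq> get f y) \<longleftrightarrow> f \<in> perms n"
    using assms(2) unfolding perms_iff by blast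
  moreover have "(\<forall>x<n. x < K ! Suc i \<or> get f x = x) \<longleftrightarrow> (\<forall>x<n. K ! Suc i \<le> x \<longrightarrow> get f x = x)"
    using not_less by blast
  ultimately show ?thesis
    unfolding chain_map_def isos_def ks upt mem_Collect_eq by blast
qed

context chain_table
begin

text \<open>Holds for segments longer than the one on which \<open>f\<close> acts too, since
  \<open>f\<close> fixes all points beyond it.\<close>

lemma isos_less:
  assumes f: "f \<in> isos n g' h K i" and ij: "i < length K" "j < length K" and x: "x < K ! j"
  shows "get f x < K ! j"
proof (cases "j \<le> i")
  case True then show ?thesis using f x by (auto simp: isos_def)
next
  case False
  show ?thesis
  proof (cases "x < K ! i")
    case True
    then have "get f x < K ! i" using f by (auto simp: isos_def)
    then show ?thesis using K_mono[of i j] False ij by simp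
  next
    case False
    then show ?thesis using isosD(3)[OF f, of x] x less_K_less_n[OF ij(2) x] by simp
  qed
qed

lemma isos_less_iff:
  assumes f: "f \<in> isos n g' h K i" and ij: "i < length K" "j < length K" and x: "x < n"
  shows "get f x < K ! j \<longleftrightarrow> x < K ! j"
proof
  assume *: "get f x < K ! j"
  have "inj_on (get f) {..<K ! j}"
    using less_K_less_n[OF ij(2)] by (auto simp: inj_on_def perms_inj[OF isosD(1)[OF f]])
  moreover have "get f ` {..<K ! j} \<subseteq> {..<K ! j}" using isos_less[OF f ij] by auto
  ultimately have "get f ` {..<K ! j} = {..<K ! j}" by (simp add: endo_inj_surj)
  then obtain y where y: "y < K ! j" "get f y = get f x" using * by (metis imageE lessThan_iff)
  then have "y = x" using perms_inj[OF isosD(1)[OF f] less_K_less_n[OF ij(2) y(1)] x] by simp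
  with y show "x < K ! j" by simp
qed (rule isos_less[OF f ij])

lemma isos_cmp:
  assumes i: "i < length K" and f: "f \<in> isos n g h K i" and e: "e \<in> isos n h h' K i"
  shows "cmp n e f \<in> isos n g h' K i"
proof -
  have p: "e \<in> perms n" "f \<in> perms n" using isosD(1) e f by blast+
  show ?thesis
  proof (rule isosI)
    fix x y assume xy: "x < K ! i" "y < K ! i"
    then have "x < n" "y < n" "mul g x y < n" "get f x < K ! i" "get f y < K ! i"
      using less_K_less_n[OF i] mul_closed[OF i] isos_less[OF f i i] by auto
    then show "get (cmp n e f) (mul g x y) = mul h' (get (cmp n e f) x) (get (cmp n e f) y)"
      using p isosD(2)[OF f xy] isosD(2)[OF e, of "get f x" "get f y"] by simp
  next
    fix j x assume "j \<le> i" "x < K ! j"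
    then show "get (cmp n e f) x < K ! j"
      using i p isos_less[OF f i, of j] isos_less[OF e i, of j] less_K_less_n[of j x] by simp
  next
    fix x assume "x < n" "K ! i \<le> x"
    then show "get (cmp n e f) x = x" using p isosD(3)[OF f] isosD(3)[OF e] by simp
  qed (use p in simp)
qed

lemma isos_pinv:
  assumes i: "i < length K" and f: "f \<in> isos n g h K i"
  shows "pinv n f \<in> isos n h g K i"
proof -
  have p: "f \<in> perms n" using isosD(1)[OF f] .
  have less: "get (pinv n f) x < K ! j" if "j < length K" "x < K ! j" for x j
    using isos_less_iff[OF f i that(1), of "get (pinv n f) x"] that p less_K_less_n[OF that]
    by (simp add: get_maps_lt)
  show ?thesis
  proof (rule isosI)
    fix x y assume xy: "x < K ! i" "y < K ! i"
    let ?x = "get (pinv n f) x" and ?y = "get (pinv n f) y"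
    have n: "x < n" "y < n" using xy less_K_less_n[OF i] by auto
    have l: "?x < K ! i" "?y < K ! i" using less[OF i] xy by auto
    then have "get f (mul g ?x ?y) = mul h x y" using isosD(2)[OF f l] p n by simp
    then have "get (pinv n f) (mul h x y) = get (pinv n f) (get f (mul g ?x ?y))" by simp
    also have "\<dots> = mul g ?x ?y" using p less_K_less_n[OF i mul_closed[OF i l]] by simp
    finally show "get (pinv n f) (mul h x y) = mul g ?x ?y" .
  next
    fix x assume x: "x < n" "K ! i \<le> x"
    have "get (pinv n f) (get f x) = x" using p x(1) by simp
    then show "get (pinv n f) x = x" using isosD(3)[OF f x] by simp
  qed (use p less i in auto)
qed

lemma perm_group_isos: "i < length K \<Longrightarrow> perm_group n (isos n g g K i)"
proof (unfold perm_group_def, intro conjI ballI)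
  assume i: "i < length K"
  show "[0..<n] \<in> isos n g g K i"
  proof (rule isosI)
    fix j x assume "j \<le> i" "x < K ! j"
    then show "get [0..<n] x < K ! j" using i less_K_less_n[of j x] by simp
  next
    fix x y assume "x < K ! i" "y < K ! i"
    then show "get [0..<n] (mul g x y) = mul g (get [0..<n] x) (get [0..<n] y)"
      using i less_K_less_n[OF i] mul_closed[OF i] by simp
  qed simp_all
qed (auto dest: isosD intro: isos_cmp isos_pinv)

definition restrict_map :: "nat \<Rightarrow> nat list \<Rightarrow> nat list" where
  "restrict_map i f = map (\<lambda>x. if x < K ! i then get f x else x) [0..<n]"

lemma get_restrict_map [simp]: "x < n \<Longrightarrow> get (restrict_map i f) x = (if x < K ! i then get f x else x)"
  by (simp add: restrict_map_def)

lemma restrict_map_isos: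
  assumes ij: "i \<le> j" "j < length K" and f: "f \<in> isos n g h K j"
  shows "restrict_map i f \<in> isos n g h K i"
proof -
  have i: "i < length K" using ij by simp
  have p: "f \<in> perms n" using isosD(1)[OF f] .
  have m: "restrict_map i f \<in> maps n"
    using get_maps_lt[OF perms_maps[OF p]] by (auto simp: restrict_map_def maps_def)
  show ?thesis
  proof (rule isosI)
    show "restrict_map i f \<in> perms n"
      unfolding perms_iff
    proof (intro conjI m allI impI)
      fix x y assume xy: "x < n" "y < n" "get (restrict_map i f) x = get (restrict_map i f) y"
      have "get f x < K ! i \<longleftrightarrow> x < K ! i" "get f y < K ! i \<longleftrightarrow> y < K ! i"
        using isos_less_iff[OF f ij(2) i] xy(1,2) by blast+
      then show "x = y"
        using xy perms_inj[OF p xy(1,2)] by (cases "x < K ! i"; cases "y < K ! i") auto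
    qed
    fix x y assume xy: "x < K ! i" "y < K ! i"
    then have "x < n" "y < n" "mul g x y < n" "mul g x y < K ! i" "x < K ! j" "y < K ! j"
      using less_K_less_n[OF i] mul_closed[OF i] K_mono[OF ij] by auto
    then show "get (restrict_map i f) (mul g x y) = mul h (get (restrict_map i f) x) (get (restrict_map i f) y)"
      using xy isosD(2)[OF f] by simp
  next
    fix j' x assume "j' \<le> i" "x < K ! j'"
    then show "get (restrict_map i f) x < K ! j'"
      using isos_less[OF f ij(2), of j' x] i K_mono[of j' i] less_K_less_n[of j' x] by simp
  qed simp
qed

lemma isos_0:
  assumes i: "i < length K" and h: "chain_table n h K" and f: "f \<in> isos n g h K i"
  shows "get f 0 = 0"
proof -
  interpret h: chain_table n h K by (rule h)
  have "get f 0 < n" using isosD(1)[OF f] n_pos by (simp add: get_maps_lt)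
  moreover have "mul h (get f 0) (get f 0) = mul h (get f 0) 0"
    using isosD(2)[OF f K_pos[OF i] K_pos[OF i]] n_pos calculation
    by (simp add: mul_0_left h.mul_0_right)
  ultimately show ?thesis using h.left_cancel n_pos by blast
qed

lemma isos_coset_reps:
  assumes i: "Suc i < length K" and h: "chain_table n h K" and f: "f \<in> isos n g h K (Suc i)"
    and T: "coset_reps i T"
  shows "chain_table.coset_reps h K i (map (get f) T)"
proof -
  interpret h: chain_table n h K by (rule h)
  have i': "i < length K" using i by simp
  have p: "f \<in> perms n" using isosD(1)[OF f] .
  have K: "K ! i \<le> K ! Suc i" using K_mono[of i "Suc i"] i by simp
  have Tn: "t < n" if "t \<in> set T" for t using coset_repsD(2)[OF T that] less_K_less_n[OF i] by blast
  have zE: "\<exists>z < K ! i. z' = get f z" if z': "z' < K ! i" for z'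
  proof -
    obtain z where z: "z < n" "get f z = z'" using perms_surj[OF p less_K_less_n[OF i' z']] .
    then show ?thesis using z' isos_less_iff[OF f i i' z(1)] by auto
  qed
  show ?thesis
    unfolding h.coset_reps_def
  proof (intro conjI allI impI ballI)
    show "distinct (map (get f) T)"
      using coset_repsD(1)[OF T] Tn perms_inj[OF p] by (auto simp: distinct_map inj_on_def)
    show "set (map (get f) T) \<subseteq> {..<K ! Suc i}"
      using isos_less[OF f i i coset_repsD(2)[OF T]] by auto
    show "0 \<in> set (map (get f) T)"
      using isos_0[OF i h f] coset_repsD(5)[OF T] by (metis image_eqI set_map)
  next
    fix x assume x: "x < K ! Suc i"
    obtain x' where x': "x' < n" "get f x' = x" using perms_surj[OF p less_K_less_n[OF i x]] .
    then have "x' < K ! Suc i" using x isos_less_iff[OF f i i x'(1)] by simp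
    then obtain t z where tz: "t \<in> set T" "z < K ! i" "x' = mul g t z" using coset_repsE[OF T] by metis
    have "x = mul h (get f t) (get f z)"
      using x'(2) tz isosD(2)[OF f coset_repsD(2)[OF T tz(1)], of z] K by simp
    then show "\<exists>t\<in>set (map (get f) T). \<exists>z<K ! i. mul h t z = x"
      using tz isos_less[OF f i i'] by auto
  next
    fix t t' z z'
    assume t: "t \<in> set (map (get f) T)" "t' \<in> set (map (get f) T)" and z: "z < K ! i" "z' < K ! i"
      and eq: "mul h t z = mul h t' z'"
    obtain s s' where s: "s \<in> set T" "s' \<in> set T" "t = get f s" "t' = get f s'" using t by auto
    obtain y y' where y: "y < K ! i" "y' < K ! i" "z = get f y" "z' = get f y'" using zE z by metis
    have l: "s < K ! Suc i" "s' < K ! Suc i" "y < K ! Suc i" "y' < K ! Suc i"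
      using coset_repsD(2)[OF T] s y K by auto
    have "get f (mul g s y) = get f (mul g s' y')"
      using eq isosD(2)[OF f l(1,3)] isosD(2)[OF f l(2,4)] by (simp add: s y)
    then have "mul g s y = mul g s' y'"
      using perms_inj[OF p] less_K_less_n[OF i mul_closed[OF i l(1,3)]]
        less_K_less_n[OF i mul_closed[OF i l(2,4)]] by blast
    then have "s = s'" "y = y'" using coset_repsD(3,4)[OF T s(1,2) y(1,2)] by auto
    then show "t = t'" "z = z'" using s y by auto
  qed
qed


subsection \<open>The data to be transported\<close>

text \<open>A common index list for the data of \<open>T\<close> and of \<open>map \<phi> T\<close>,
  so that the entries of the two lists match one by one.\<close>

definition triples :: "nat \<Rightarrow> nat list \<Rightarrow> (nat \<times> nat \<times> nat) list" where
  "triples i T = concat (map (\<lambda>a. concat (map (\<lambda>b. map (\<lambda>j. (a, b, j)) (take (Suc i) K)) T)) T)"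

lemma set_triples: "set (triples i T) = set T \<times> set T \<times> set (take (Suc i) K)"
  by (auto simp: triples_def)

lemma objects_map:
  "objects n h (take (Suc i) K) k (map \<phi> T) =
    map (\<lambda>e. twisted n h k (map \<phi> T) (\<phi> (fst e)) (\<phi> (fst (snd e))) (snd (snd e))) (triples i T)"
  by (simp add: objects_def triples_def map_concat o_def)

lemma objects_eq:
  "objects n h (take (Suc i) K) k T =
    map (\<lambda>e. twisted n h k T (fst e) (fst (snd e)) (snd (snd e))) (triples i T)"
  using objects_map[where \<phi> = id] by simp

lemma twisted_maps [simp]: "twisted n h k T a b j \<in> maps n"
  by (auto simp: twisted_def maps_def clip_def)

lemma get_twisted: "x < n \<Longrightarrow> get (twisted n h k T a b j) x =
    (if x < j then clip n (remainder h k T (mul h (mul h a x) b)) else x)"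
  by (simp add: twisted_def)

lemma twisted_unique:
  assumes i: "Suc i < length K" and T: "coset_reps i T"
    and j: "j \<le> i" and x: "x < K ! j" and c: "c \<in> set T" "z < K ! i"
    and eq: "mul g (mul g a x) b = mul g c z"
  shows "get (twisted n g (K ! i) T a b (K ! j)) x = z"
  using remainder_eq[OF T c] x less_K_less_n[of j x] j less_K_less_n[of i z] c i
  by (simp add: get_twisted clip_def eq)

text \<open>Moving x past b gives a x b = a b w, and with a b = c q this is c (q w). So the
  representative \<open>c\<close> depends on \<open>a\<close> and \<open>b\<close> only, not on
  \<open>x\<close> or \<open>j\<close>.\<close>

lemma twisted_decompose:
  assumes i: "Suc i < length K" and T: "coset_reps i T" and ab: "a \<in> set T" "b \<in> set T"
  shows "\<exists>c \<in> set T. \<forall>j \<le> i. \<forall>x < K ! j.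
    get (twisted n g (K ! i) T a b (K ! j)) x < K ! i \<and>
    mul g (mul g a x) b = mul g c (get (twisted n g (K ! i) T a b (K ! j)) x)"
proof -
  have i': "i < length K" using i by simp
  have l: "a < K ! Suc i" "b < K ! Suc i" using coset_repsD(2)[OF T] ab by auto
  have abn: "a < n" "b < n" using less_K_less_n[OF i] l by auto
  obtain c q where c: "c \<in> set T" "q < K ! i" "mul g a b = mul g c q"
    using coset_repsE[OF T mul_closed[OF i l]] .
  have cq: "c < n" "q < n"
    using less_K_less_n[OF i coset_repsD(2)[OF T c(1)]] less_K_less_n[OF i' c(2)] by auto
  have "get (twisted n g (K ! i) T a b (K ! j)) x < K ! i \<and>
      mul g (mul g a x) b = mul g c (get (twisted n g (K ! i) T a b (K ! j)) x)"
    if j: "j \<le> i" and x: "x < K ! j" for j x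
  proof -
    have xi: "x < K ! i" using x K_mono[of j i] j i by simp
    obtain w where w: "w < K ! i" "mul g x b = mul g b w" using normal[OF i l(2) xi] by blast
    have n: "x < n" "w < n" using less_K_less_n[OF i'] xi w(1) by auto
    have "mul g (mul g a x) b = mul g a (mul g x b)" using abn n by (intro mul_assoc)
    also have "\<dots> = mul g (mul g a b) w" unfolding w(2) using abn n by (intro mul_assoc[symmetric])
    also have "\<dots> = mul g c (mul g q w)" unfolding c(3) using cq n by (intro mul_assoc)
    finally have eq: "mul g (mul g a x) b = mul g c (mul g q w)" .
    have qw: "mul g q w < K ! i" by (rule mul_closed[OF i' c(2) w(1)])
    show ?thesis using twisted_unique[OF i T j x c(1) qw eq] qw eq by simp
  qed
  with c(1) show ?thesis by blast
qed

text \<open>The necessary condition for an extension. Applying \<open>f\<close> to a x b = c z gives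
  f(a) f(x) f(b) = f(c) f(z), and f(c) is a representative in \<open>map (get f) T\<close>; hence
  f(z) is the value of the corresponding map for \<open>h\<close>.\<close>

lemma twisted_conj:
  assumes i: "Suc i < length K" and h: "chain_table n h K" and f: "f \<in> isos n g h K (Suc i)"
    and T: "coset_reps i T" and ab: "a \<in> set T" "b \<in> set T" and j: "j \<le> i"
  shows "conj_by n (restrict_map i f) (twisted n g (K ! i) T a b (K ! j)) =
    twisted n h (K ! i) (map (get f) T) (get f a) (get f b) (K ! j)"
proof -
  interpret h: chain_table n h K by (rule h)
  have i': "i < length K" "i \<le> Suc i" and j': "j < length K" using i j by auto
  have r: "restrict_map i f \<in> isos n g h K i" by (rule restrict_map_isos[OF i'(2) i f])
  have K: "K ! j \<le> K ! i" "K ! i \<le> K ! Suc i" using K_mono[of j i] K_mono[of i "Suc i"] i j by auto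
  show ?thesis
  proof (subst conj_by_iff)
    show "\<forall>x<n. get (twisted n h (K ! i) (map (get f) T) (get f a) (get f b) (K ! j)) (get (restrict_map i f) x) =
      get (restrict_map i f) (get (twisted n g (K ! i) T a b (K ! j)) x)"
    proof (intro allI impI)
      fix x assume x: "x < n"
      show "get (twisted n h (K ! i) (map (get f) T) (get f a) (get f b) (K ! j)) (get (restrict_map i f) x) =
        get (restrict_map i f) (get (twisted n g (K ! i) T a b (K ! j)) x)"
      proof (cases "x < K ! j")
        case True
        obtain c where dec: "c \<in> set T" "\<forall>j \<le> i. \<forall>x < K ! j.
          get (twisted n g (K ! i) T a b (K ! j)) x < K ! i \<and>
          mul g (mul g a x) b = mul g c (get (twisted n g (K ! i) T a b (K ! j)) x)"
          using twisted_decompose[OF i T ab] by blast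
        then have c: "c \<in> set T"
          "mul g (mul g a x) b = mul g c (get (twisted n g (K ! i) T a b (K ! j)) x)"
          "get (twisted n g (K ! i) T a b (K ! j)) x < K ! i"
          using j True by blast+
        let ?z = "get (twisted n g (K ! i) T a b (K ! j)) x"
        have l: "a < K ! Suc i" "b < K ! Suc i" "c < K ! Suc i" "x < K ! Suc i" "?z < K ! Suc i"
          using coset_repsD(2)[OF T] ab c True K by auto
        have "mul h (mul h (get f a) (get f x)) (get f b) = mul h (get f c) (get f ?z)"
          using isosD(2)[OF f l(1,4)] isosD(2)[OF f mul_closed[OF i l(1,4)] l(2)] isosD(2)[OF f l(3,5)] c(2)
          by simp
        moreover have "get f x < K ! j" using isos_less[OF f i j' True] .
        moreover have "get f ?z < K ! i" using isos_less[OF f i i'(1) c(3)] .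
        ultimately have "get (twisted n h (K ! i) (map (get f) T) (get f a) (get f b) (K ! j)) (get f x) = get f ?z"
          using c(1) by (intro h.twisted_unique[OF i isos_coset_reps[OF i h f T] j]) auto
        then show ?thesis using True K x c(3) less_K_less_n[OF i'(1) c(3)] by simp
      next
        case False
        then have "\<not> get (restrict_map i f) x < K ! j"
          using isos_less_iff[OF r i'(1) j' x] by simp
        moreover have "get (restrict_map i f) x < n"
          using get_maps_lt[OF perms_maps[OF isosD(1)[OF r]] x] .
        ultimately show ?thesis using False x by (simp only: get_twisted if_False)
      qed
    qed
  qed (use isosD(1)[OF r] in simp_all)
qed


subsection \<open>Lifting automorphisms\<close>

lemma get_extend:
  assumes T: "coset_reps i T" and t: "t \<in> set T" "z < K ! i" and x: "mul g t z < K ! Suc i" "mul g t z < n"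
  shows "get (extend n g h (K ! i) (K ! Suc i) (map (\<lambda>t. (t, \<phi> t)) T) b) (mul g t z) =
    clip n (mul h (\<phi> t) (get b z))"
proof -
  let ?L = "concat (map (\<lambda>p. map (\<lambda>z. mul h (snd p) (get b z))
      (filter (\<lambda>y. mul g (fst p) y = mul g t z) [0..<K ! i])) (map (\<lambda>t. (t, \<phi> t)) T))"
  have "mul h (\<phi> t) (get b z) \<in> set ?L" using t by auto
  then have "?L \<noteq> []" by (metis empty_iff empty_set)
  from first_in[OF this, of 0] obtain t' z' where
    "t' \<in> set T" "z' < K ! i" "mul g t' z' = mul g t z" "first 0 ?L = mul h (\<phi> t') (get b z')" by auto
  then have "first 0 ?L = mul h (\<phi> t) (get b z)"
    using coset_repsD(3,4)[OF T, of t' t z' z] t by auto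
  then show ?thesis using x unfolding extend_def by simp
qed

lemma get_extend_ge:
  "x < n \<Longrightarrow> K ! Suc i \<le> x \<Longrightarrow> get (extend n g h (K ! i) (K ! Suc i) P b) x = x"
  by (simp add: extend_def)

lemma extend_maps [simp]: "extend n g h k l P b \<in> maps n"
  by (auto simp: extend_def maps_def clip_def)

abbreviation stabilizer_data :: "nat \<Rightarrow> nat list \<Rightarrow> nat list set" where
  "stabilizer_data i T \<equiv> {u \<in> isos n g g K i. \<forall>e \<in> set (triples i T).
     conj_by n u (twisted n g (K ! i) T (fst e) (fst (snd e)) (snd (snd e))) =
       twisted n g (K ! i) T (fst e) (fst (snd e)) (snd (snd e))}"

abbreviation lift_map :: "nat \<Rightarrow> nat list \<Rightarrow> nat list \<Rightarrow> nat list" where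
  "lift_map i T \<equiv> extend n g g (K ! i) (K ! Suc i) (map (\<lambda>t. (t, t)) T)"

lemma get_lift_map:
  assumes i: "Suc i < length K" and T: "coset_reps i T" and t: "t \<in> set T" "z < K ! i"
    and u: "u \<in> isos n g g K i"
  shows "get (lift_map i T u) (mul g t z) = mul g t (get u z)"
proof -
  have i': "i < length K" using i by simp
  have l: "t < K ! Suc i" "z < K ! Suc i" "get u z < K ! Suc i"
    using coset_repsD(2)[OF T t(1)] t(2) isos_less[OF u i' i' t(2)] K_mono[of i "Suc i"] i by auto
  note m = mul_closed[OF i l(1,2)] mul_closed[OF i l(1,3)]
  show ?thesis
    using get_extend[OF T t m(1) less_K_less_n[OF i m(1)], of g "\<lambda>t. t" u] less_K_less_n[OF i m(2)]
    by (simp add: clip_def)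
qed

text \<open>
  If \<open>u\<close> commutes with \<open>r(x) = c\<inverse> t x t'\<close>, then \<open>t u(z) t' u(z') = c r(u(z)) u(z') = c u(r(z) z')\<close>,
  while \<open>t z t' z' = c r(z) z'\<close>.
\<close>

lemma lift_map_isos:
  assumes i: "Suc i < length K" and T: "coset_reps i T" and u: "u \<in> stabilizer_data i T"
  shows "lift_map i T u \<in> isos n g g K (Suc i)"
proof -
  have i': "i < length K" using i by simp
  have uI: "u \<in> isos n g g K i" using u by simp
  have up: "u \<in> perms n" using isosD(1)[OF uI] .
  let ?f = "lift_map i T u"
  note gl = get_lift_map[OF i T _ _ uI]
  have K: "K ! i \<le> K ! Suc i" using K_mono[of i "Suc i"] i by simp
  have uless: "get u z < K ! i" if "z < K ! i" for z using isos_less[OF uI i' i' that] .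
  have l: "t < K ! Suc i" if "t \<in> set T" for t using coset_repsD(2)[OF T that] .
  have ln: "t < n" if "t \<in> set T" for t using less_K_less_n[OF i l[OF that]] .
  have zn: "z < n" if "z < K ! i" for z using less_K_less_n[OF i' that] .
  have closed: "get ?f x < K ! Suc i" if x: "x < K ! Suc i" for x
    using x
  proof (rule coset_repsE[OF T])
    fix t z assume tz: "t \<in> set T" "z < K ! i" "x = mul g t z"
    then show ?thesis using gl[OF tz(1,2)] mul_closed[OF i l[OF tz(1)], of "get u z"] uless[of z] K by simp
  qed
  have inj: "x = y" if xy: "x < K ! Suc i" "y < K ! Suc i" "get ?f x = get ?f y" for x y
  proof -
    obtain t z where tz: "t \<in> set T" "z < K ! i" "x = mul g t z" using coset_repsE[OF T xy(1)] .
    obtain t' z' where tz': "t' \<in> set T" "z' < K ! i" "y = mul g t' z'" using coset_repsE[OF T xy(2)] .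
    have eq: "mul g t (get u z) = mul g t' (get u z')"
      using xy(3) gl[OF tz(1,2)] gl[OF tz'(1,2)] tz(3) tz'(3) by simp
    have "t = t'" "get u z = get u z'"
      using coset_repsD(3,4)[OF T tz(1) tz'(1) uless[OF tz(2)] uless[OF tz'(2)] eq] by auto
    then show ?thesis using tz tz' perms_inj[OF up zn[OF tz(2)] zn[OF tz'(2)]] by simp
  qed
  have eq_small: "get ?f x = get u x" if x: "x < K ! i" for x
    using gl[OF coset_repsD(5)[OF T] x] zn[OF x] zn[OF uless[OF x]] by (simp add: mul_0_left)
  show ?thesis
  proof (rule isosI)
    show "?f \<in> perms n" unfolding perms_iff
    proof (intro conjI allI impI extend_maps)
      fix x y assume xy: "x < n" "y < n" "get ?f x = get ?f y"
      show "x = y"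
      proof (cases "x < K ! Suc i"; cases "y < K ! Suc i")
        assume "x < K ! Suc i" "y < K ! Suc i"
        then show ?thesis using inj xy(3) by blast
      next
        assume "x < K ! Suc i" "\<not> y < K ! Suc i"
        then show ?thesis using closed[of x] get_extend_ge[OF xy(2), of i] xy(3) by simp
      next
        assume "\<not> x < K ! Suc i" "y < K ! Suc i"
        then show ?thesis using closed[of y] get_extend_ge[OF xy(1), of i] xy(3) by simp
      next
        assume "\<not> x < K ! Suc i" "\<not> y < K ! Suc i"
        then show ?thesis using get_extend_ge[OF xy(1), of i] get_extend_ge[OF xy(2), of i] xy(3) by simp
      qed
    qed
  next
    fix x y assume xy: "x < K ! Suc i" "y < K ! Suc i"
    obtain t z where tz: "t \<in> set T" "z < K ! i" "x = mul g t z" using coset_repsE[OF T xy(1)] .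
    obtain t' z' where tz': "t' \<in> set T" "z' < K ! i" "y = mul g t' z'" using coset_repsE[OF T xy(2)] .
    let ?r = "twisted n g (K ! i) T t t' (K ! i)"
    obtain c where dec: "c \<in> set T" "\<forall>j \<le> i. \<forall>x < K ! j.
      get (twisted n g (K ! i) T t t' (K ! j)) x < K ! i \<and>
      mul g (mul g t x) t' = mul g c (get (twisted n g (K ! i) T t t' (K ! j)) x)"
      using twisted_decompose[OF i T tz(1) tz'(1)] by blast
    then have c: "c \<in> set T" "\<And>x. x < K ! i \<Longrightarrow> get ?r x < K ! i"
      "\<And>x. x < K ! i \<Longrightarrow> mul g (mul g t x) t' = mul g c (get ?r x)"
      using le_refl by blast+
    have rz: "get ?r z < K ! i" by (rule c(2)[OF tz(2)])
    \<comment> \<open>The commutation is read off on the whole segment; the restrictions to shorter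
      segments are transported to keep the orbits small.\<close>
    have kin: "(t, t', K ! i) \<in> set (triples i T)"
      using tz(1) tz'(1) i by (auto simp: set_triples in_set_conv_nth intro!: exI[of _ i])
    have "conj_by n u ?r = ?r" using u kin by fastforce
    then have ur: "get ?r (get u z) = get u (get ?r z)"
      using conj_by_iff[OF up twisted_maps twisted_maps] zn[OF tz(2)] by blast
    have rzz: "mul g (get ?r z) z' < K ! i" by (rule mul_closed[OF i' rz tz'(2)])
    have "mul g x y = mul g c (mul g (get ?r z) z')"
    proof -
      have "mul g x y = mul g (mul g (mul g t z) t') z'"
        unfolding tz(3) tz'(3) using ln[OF tz(1)] ln[OF tz'(1)] zn[OF tz(2)] zn[OF tz'(2)] mul_less
        by (simp add: mul_assoc)
      also have "\<dots> = mul g c (mul g (get ?r z) z')"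
        unfolding c(3)[OF tz(2)] using ln[OF c(1)] zn[OF rz] zn[OF tz'(2)] by (intro mul_assoc)
      finally show ?thesis .
    qed
    then have "get ?f (mul g x y) = mul g c (get u (mul g (get ?r z) z'))"
      using gl[OF c(1) rzz] by simp
    also have "\<dots> = mul g c (mul g (get u (get ?r z)) (get u z'))"
      using isosD(2)[OF uI rz tz'(2)] by simp
    also have "\<dots> = mul g (mul g c (get u (get ?r z))) (get u z')"
      using ln[OF c(1)] zn[OF uless[OF rz]] zn[OF uless[OF tz'(2)]] by (simp add: mul_assoc)
    also have "\<dots> = mul g (mul g (mul g t (get u z)) t') (get u z')"
      using c(3)[OF uless[OF tz(2)]] ur by simp
    also have "\<dots> = mul g (mul g t (get u z)) (mul g t' (get u z'))"
      using ln[OF tz(1)] ln[OF tz'(1)] zn[OF uless[OF tz(2)]] zn[OF uless[OF tz'(2)]] mul_less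
      by (simp add: mul_assoc)
    finally show "get ?f (mul g x y) = mul g (get ?f x) (get ?f y)"
      using gl[OF tz(1,2)] gl[OF tz'(1,2)] tz(3) tz'(3) by simp
  next
    fix j x assume j: "j \<le> Suc i" and x: "x < K ! j"
    show "get ?f x < K ! j"
    proof (cases "j = Suc i")
      case True then show ?thesis using closed x by simp
    next
      case False
      then have "j \<le> i" using j by simp
      then show ?thesis
        using eq_small[of x] x K_mono[of j i] isos_less[OF uI i', of j x] i by simp
    qed
  qed (rule get_extend_ge)
qed

end


text \<open>Locates an entry of a concatenation inside its block while remembering that what
  precedes it in the block precedes it in the whole. It is applied twice to the nested list
  \<open>triples\<close>.\<close>

lemma concat_map_split:
  "concat (map f l) = xs @ e # ys \<Longrightarrow>
    \<exists>a \<in> set l. \<exists>xs' ys'. f a = xs' @ e # ys' \<and> set xs' \<subseteq> set xs"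
proof (induction l arbitrary: xs)
  case (Cons a l)
  then consider us where "f a @ us = xs" "concat (map f l) = us @ e # ys"
    | us where "f a = xs @ us" "us @ concat (map f l) = e # ys"
    by (auto simp: append_eq_append_conv2)
  then show ?case
  proof cases
    case 1
    from Cons.IH[OF 1(2)] show ?thesis using 1(1) by fastforce
  next
    case (2 us)
    show ?thesis
    proof (cases us)
      case Nil
      then have "concat (map f l) = [] @ e # ys" using 2 by simp
      from Cons.IH[OF this] show ?thesis by fastforce
    next
      case (Cons u us')
      then have "f a = xs @ e # us'" using 2 by simp
      then show ?thesis by fastforce
    qed
  qed
qed simp

text \<open>Without truncation the list has exactly \<open>n ^ length T\<close> entries, so
  \<open>take M\<close> never cuts.\<close>

lemma tuples_correct:
  assumes "0 < n" "n ^ length T \<le> M"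
  shows "set (tuples n M T) = {y. length y = length T \<and> set y \<subseteq> {..<n}}"
proof -
  have "length (tuples n M T) = n ^ length T \<and>
    set (tuples n M T) = {y. length y = length T \<and> set y \<subseteq> {..<n}}"
    using assms(2)
  proof (induction T rule: rev_induct)
    case (snoc t T)
    let ?L = "concat (map (\<lambda>l. map (\<lambda>x. x # l) [0..<n]) (tuples n M T))"
    have "n ^ length T \<le> M"
      using snoc.prems assms(1) by (metis length_append_singleton le_add2 power_increasing le_trans
          One_nat_def Suc_leI le_SucI le_refl)
    note IH = snoc.IH[OF this]
    have len: "length ?L = n ^ length (T @ [t])"
      using IH by (simp add: length_concat o_def sum_list_triv)
    have step: "tuples n M (T @ [t]) = take M ?L" by (simp add: tuples_def)
    have "take M ?L = ?L" using len snoc.prems by simp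
    moreover have "set ?L = {y. length y = length (T @ [t]) \<and> set y \<subseteq> {..<n}}"
      using IH by (force simp: length_Suc_conv image_iff)
    ultimately show ?case using len step by simp
  qed (auto simp: tuples_def)
  then show ?thesis by blast
qed

lemma mul_relabel:
  assumes "f \<in> perms n" "x < n" "y < n"
  shows "mul (relabel n h f) x y = get (pinv n f) (mul h (get f x) (get f y))"
  using assms by (simp add: relabel_def mul_def[of "map _ _"] nth_default_eq)

context chain_table
begin

text \<open>When the restriction to \<open>K ! j\<close> is due, the restrictions to all smaller
  segments with the same \<open>a\<close> and \<open>b\<close> are already stabilized. The orbit
  bound rests on this.\<close>

lemma triples_split:
  assumes i: "Suc i < length K" and q: "q < length (triples i T)"
  obtains a b j where "triples i T ! q = (a, b, K ! j)" "a \<in> set T" "b \<in> set T" "j \<le> i"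
    "\<And>j'. j' < j \<Longrightarrow> (a, b, K ! j') \<in> set (take q (triples i T))"
proof -
  let ?e = "triples i T ! q" and ?xs = "take q (triples i T)"
  have "concat (map (\<lambda>a. concat (map (\<lambda>b. map (\<lambda>j. (a, b, j)) (take (Suc i) K)) T)) T) =
      ?xs @ ?e # drop (Suc q) (triples i T)"
    using id_take_nth_drop[OF q] unfolding triples_def .
  from concat_map_split[OF this] obtain a us ys where a: "a \<in> set T"
    "concat (map (\<lambda>b. map (\<lambda>j. (a, b, j)) (take (Suc i) K)) T) = us @ ?e # ys" "set us \<subseteq> set ?xs"
    by blast
  from concat_map_split[OF a(2)] obtain b vs zs where b: "b \<in> set T"
    "map (\<lambda>j. (a, b, j)) (take (Suc i) K) = vs @ ?e # zs" "set vs \<subseteq> set us"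
    by blast
  let ?j = "length vs"
  have len: "length (vs @ ?e # zs) = Suc i" using arg_cong[OF b(2), of length] i by simp
  have nth: "(vs @ ?e # zs) ! m = (a, b, K ! m)" if "m \<le> i" for m
    using that i unfolding b(2)[symmetric] by simp
  have j: "?j \<le> i" using len by simp
  have "?e = (a, b, K ! ?j)" using nth[OF j] by simp
  moreover have "(a, b, K ! j') \<in> set ?xs" if "j' < ?j" for j'
  proof -
    have "vs ! j' = (a, b, K ! j')" using nth[of j'] that j by (simp add: nth_append)
    then have "(a, b, K ! j') \<in> set vs" using that nth_mem by metis
    then show ?thesis using a(3) b(3) by blast
  qed
  ultimately show thesis using that a(1) b(1) j by blast
qed


subsection \<open>Bounds for the orbits\<close>

text \<open>With p the conjugate of x' by b, a x x' b = (a x b) p, so multiplying the argument by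
  \<open>x'\<close> multiplies the value by \<open>p\<close>, whatever \<open>x\<close> is. The
  equation at \<open>0\<close> determines \<open>p\<close> from the values at \<open>0\<close> and
  \<open>x'\<close>.\<close>

lemma twisted_affine:
  assumes i: "Suc i < length K" and T: "coset_reps i T" and ab: "a \<in> set T" "b \<in> set T"
    and j: "j \<le> i" and x: "x < K ! j" "x' < K ! j"
  shows "\<exists>p < K ! i.
    mul g (get (twisted n g (K ! i) T a b (K ! j)) 0) p = get (twisted n g (K ! i) T a b (K ! j)) x' \<and>
    get (twisted n g (K ! i) T a b (K ! j)) (mul g x x') =
      mul g (get (twisted n g (K ! i) T a b (K ! j)) x) p"
proof -
  let ?r = "get (twisted n g (K ! i) T a b (K ! j))"
  have i': "i < length K" and j': "j < length K" using i j by auto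
  have xi: "x < K ! i" "x' < K ! i" using x K_mono[of j i] j i by simp_all
  have xn: "x < n" "x' < n" using xi less_K_less_n[OF i'] by auto
  have abn: "a < n" "b < n" using coset_repsD(2)[OF T] ab less_K_less_n[OF i] by blast+
  obtain p where p: "p < K ! i" "mul g x' b = mul g b p"
    using normal[OF i coset_repsD(2)[OF T ab(2)] xi(2)] by blast
  have pn: "p < n" using less_K_less_n[OF i' p(1)] .
  obtain c where dec: "c \<in> set T" "\<forall>j \<le> i. \<forall>x < K ! j.
    get (twisted n g (K ! i) T a b (K ! j)) x < K ! i \<and>
    mul g (mul g a x) b = mul g c (get (twisted n g (K ! i) T a b (K ! j)) x)"
    using twisted_decompose[OF i T ab] by blast
  then have c: "c \<in> set T" "\<And>y. y < K ! j \<Longrightarrow> ?r y < K ! i"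
    "\<And>y. y < K ! j \<Longrightarrow> mul g (mul g a y) b = mul g c (?r y)"
    using j by blast+
  have cn: "c < n" using coset_repsD(2)[OF T c(1)] less_K_less_n[OF i] by blast
  have r: "?r 0 < K ! i" "?r x < K ! i" using c(2) x(1) K_pos[OF j'] by auto
  then have rn: "?r 0 < n" "?r x < n" using less_K_less_n[OF i'] by auto
  have "mul g (mul g a x') b = mul g a (mul g x' b)" using abn xn by (intro mul_assoc)
  also have "\<dots> = mul g (mul g a b) p" unfolding p(2) using abn pn by (intro mul_assoc[symmetric])
  also have "\<dots> = mul g (mul g c (?r 0)) p"
    unfolding c(3)[OF K_pos[OF j'], symmetric] using abn by (simp add: mul_0_right)
  also have "\<dots> = mul g c (mul g (?r 0) p)" using cn rn pn by (intro mul_assoc)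
  finally have 1: "?r x' = mul g (?r 0) p"
    using twisted_unique[OF i T j x(2) c(1) mul_closed[OF i' r(1) p(1)]] by blast
  have "mul g (mul g a (mul g x x')) b = mul g (mul g (mul g a x) x') b" using abn xn by (simp add: mul_assoc)
  also have "\<dots> = mul g (mul g a x) (mul g x' b)" using abn xn mul_less by (intro mul_assoc)
  also have "\<dots> = mul g (mul g (mul g a x) b) p"
    unfolding p(2) using abn xn pn mul_less by (intro mul_assoc[symmetric])
  also have "\<dots> = mul g c (mul g (?r x) p)" unfolding c(3)[OF x(1)] using cn rn pn by (intro mul_assoc)
  finally have "?r (mul g x x') = mul g (?r x) p"
    using twisted_unique[OF i T j mul_closed[OF j' x] c(1) mul_closed[OF i' r(2) p(1)]] by blast
  with 1 p(1) show ?thesis by metis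
qed

text \<open>Conjugation by an automorphism \<open>u\<close> keeps the affine form: the multiplier p
  becomes w = u(p), and \<open>0\<close> stays the base point because \<open>u\<close> fixes
  it.\<close>

lemma conj_affine:
  assumes i: "Suc i < length K" and T: "coset_reps i T" and ab: "a \<in> set T" "b \<in> set T"
    and j: "j \<le> i" and u: "u \<in> isos n g g K i" and y: "y < K ! j" "y' < K ! j"
    and d: "d = conj_by n u (twisted n g (K ! i) T a b (K ! j))"
  shows "\<exists>w < K ! i. mul g (get d 0) w = get d y' \<and> get d (mul g y y') = mul g (get d y) w"
proof -
  let ?c = "twisted n g (K ! i) T a b (K ! j)"
  have i': "i < length K" and j': "j < length K" using i j by auto
  have up: "u \<in> perms n" using isosD(1)[OF u] .
  have Kji: "K ! j \<le> K ! i" using K_mono[OF j] i by simp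
  have du: "get d (get u x) = get u (get ?c x)" if "x < n" for x
    unfolding d using conj_by_get[OF up twisted_maps that] .
  have surj: "\<exists>x < K ! j. y = get u x" if "y < K ! j" for y
  proof -
    obtain x where x: "x < n" "get u x = y"
      by (rule perms_surj[OF up less_K_less_n[OF j' \<open>y < K ! j\<close>]])
    then show ?thesis using isos_less_iff[OF u i' j' x(1)] \<open>y < K ! j\<close> by auto
  qed
  obtain x x' where x: "x < K ! j" "y = get u x" "x' < K ! j" "y' = get u x'" using surj y by meson
  obtain p where p: "p < K ! i" "mul g (get ?c 0) p = get ?c x'"
    "get ?c (mul g x x') = mul g (get ?c x) p"
    using twisted_affine[OF i T ab j x(1,3)] by blast
  have cl: "get ?c v < K ! i" if "v < K ! j" for v
    using twisted_decompose[OF i T ab] j that by blast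
  have xn: "x < n" "x' < n" "mul g x x' < n" "0 < n"
    using less_K_less_n[OF j'] x mul_closed[OF j' x(1,3)] n_pos by auto
  have u0: "get u 0 = 0" by (rule isos_0[OF i' chain_table_axioms u])
  have "get d 0 = get u (get ?c 0)" using du[OF n_pos] u0 by simp
  then have "mul g (get d 0) (get u p) = get d y'"
    using isosD(2)[OF u cl[OF K_pos[OF j']] p(1)] p(2) du[OF xn(2)] x(4) by simp
  moreover have "get d (mul g y y') = mul g (get d y) (get u p)"
  proof -
    have "mul g y y' = get u (mul g x x')"
      using isosD(2)[OF u, of x x'] x Kji by simp
    then have "get d (mul g y y') = get u (mul g (get ?c x) p)" using du[OF xn(3)] p(3) by simp
    also have "\<dots> = mul g (get u (get ?c x)) (get u p)" by (rule isosD(2)[OF u cl[OF x(1)] p(1)])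
    finally show ?thesis using du[OF xn(1)] x(2) by simp
  qed
  moreover have "get u p < K ! i" using isos_less[OF u i' i' p(1)] .
  ultimately show ?thesis by blast
qed

text \<open>
  A member of the orbit agrees with the original map on the previous segment and is affine
  (\<open>conj_affine\<close>), hence it is determined by its values on coset representatives.
\<close>

lemma twisted_orbit_card:
  assumes i: "Suc i < length K" and T: "coset_reps i T" and ab: "a \<in> set T" "b \<in> set T"
    and j: "j \<le> i" and B: "B \<subseteq> isos n g g K i"
    and fixed: "\<And>u j'. u \<in> B \<Longrightarrow> j' < j \<Longrightarrow>
      conj_by n u (twisted n g (K ! i) T a b (K ! j')) = twisted n g (K ! i) T a b (K ! j')"
    and R: "R = (if j = 0 then [0] else transversal g (K ! (j - 1)) (K ! j))"
  shows "card ((\<lambda>u. conj_by n u (twisted n g (K ! i) T a b (K ! j))) ` B) \<le> n ^ length R"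
proof -
  let ?c = "twisted n g (K ! i) T a b (K ! j)"
  let ?O = "(\<lambda>u. conj_by n u ?c) ` B"
  have i': "i < length K" and j': "j < length K" using i j by auto
  have Rn: "set R \<subseteq> {..<n}"
  proof (cases "j = 0")
    case True then show ?thesis using n_pos by (simp add: R)
  next
    case False
    then have "coset_reps (j - 1) R" using transversal_correct[of "j - 1"] R j' by simp
    from coset_repsD(2)[OF this] show ?thesis using False less_K_less_n[OF j'] by auto
  qed
  have eq: "conj_by n u ?c = conj_by n u' ?c"
    if u: "u \<in> B" "u' \<in> B" and agree: "\<And>t. t \<in> set R \<Longrightarrow> get (conj_by n u ?c) t = get (conj_by n u' ?c) t" for u u'
  proof (rule maps_eqI[of _ n])
    fix x assume x: "x < n"
    have ge: "get (conj_by n u ?c) x = x" if "u \<in> B" "\<not> x < K ! j" for u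
    proof -
      have uI: "u \<in> isos n g g K i" using that(1) B by blast
      obtain y where y: "y < n" "get u y = x" by (rule perms_surj[OF isosD(1)[OF uI] x])
      then have "\<not> y < K ! j" using isos_less_iff[OF uI i' j' y(1)] that(2) by simp
      then have "get ?c y = y" using y(1) by (simp add: get_twisted)
      then show ?thesis using conj_by_get[OF isosD(1)[OF uI] twisted_maps y(1)] y(2) by metis
    qed
    show "get (conj_by n u ?c) x = get (conj_by n u' ?c) x"
    proof (cases "x < K ! j")
      case False then show ?thesis using ge u by simp
    next
      case x_less: True
      show ?thesis
      proof (cases j)
        case 0 then show ?thesis using x_less K_first agree[of 0] by (simp add: R)
      next
        case (Suc j0)
        have j0: "j0 < length K" "Suc j0 < length K" and K0: "K ! j0 \<le> K ! j"
          using j' Suc K_mono[of j0 j] by auto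
        have Rr: "coset_reps j0 R" using transversal_correct[OF j0(2)] Suc by (simp add: R)
        obtain t z where tz: "t \<in> set R" "z < K ! j0" "x = mul g t z"
          using coset_repsE[OF Rr] x_less Suc by metis
        have tj: "t < K ! j" using coset_repsD(2)[OF Rr tz(1)] Suc by simp
        have small: "get (conj_by n u ?c) v = get ?c v" if "u \<in> B" "v < K ! j0" for u v
        proof -
          have uI: "u \<in> isos n g g K i" using that(1) B by blast
          let ?cc = "twisted n g (K ! i) T a b (K ! j0)"
          have vn: "v < n" using less_K_less_n[OF j0(1) that(2)] .
          obtain w where w: "w < n" "get u w = v" by (rule perms_surj[OF isosD(1)[OF uI] vn])
          then have w0: "w < K ! j0" using isos_less_iff[OF uI i' j0(1) w(1)] that(2) by simp
          have same: "get ?c q = get ?cc q" if "q < K ! j0" for q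
            using that K0 less_K_less_n[OF j0(1) that] by (simp add: get_twisted)
          have 1: "get (conj_by n u ?c) v = get u (get ?c w)"
            using conj_by_get[OF isosD(1)[OF uI] twisted_maps w(1)] unfolding w(2) .
          have 2: "get u (get ?c w) = get u (get ?cc w)" by (rule arg_cong[OF same[OF w0]])
          have 3: "get (conj_by n u ?cc) v = get u (get ?cc w)"
            using conj_by_get[OF isosD(1)[OF uI] twisted_maps w(1)] unfolding w(2) .
          have 4: "conj_by n u ?cc = ?cc" by (rule fixed[OF that(1)]) (simp add: Suc)
          show ?thesis using 1 2 3 same[OF that(2)] unfolding 4 by linarith
        qed
        have zj: "z < K ! j" using tz(2) K0 by simp
        obtain w where w: "w < K ! i" "mul g (get (conj_by n u ?c) 0) w = get (conj_by n u ?c) z"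
          "get (conj_by n u ?c) x = mul g (get (conj_by n u ?c) t) w"
          using conj_affine[OF i T ab j _ tj zj refl, of u] u(1) B tz(3) by blast
        obtain w' where w': "w' < K ! i" "mul g (get (conj_by n u' ?c) 0) w' = get (conj_by n u' ?c) z"
          "get (conj_by n u' ?c) x = mul g (get (conj_by n u' ?c) t) w'"
          using conj_affine[OF i T ab j _ tj zj refl, of u'] u(2) B tz(3) by blast
        \<comment> \<open>Both 0 and z lie in the previous segment, where the two conjugates
          coincide with the original map. So their multipliers are equal, and the value at x = t z
          is determined by the value at t.\<close>
        have "mul g (get ?c 0) w = mul g (get ?c 0) w'"
          using w(2) w'(2) small[OF u(1)] small[OF u(2)] tz(2) K_pos[OF j0(1)] by simp
        then have "w = w'"
          using left_cancel[OF get_maps_lt[OF twisted_maps n_pos]] less_K_less_n[OF i'] w(1) w'(1) by blast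
        then show ?thesis using w(3) w'(3) agree[OF tz(1)] by simp
      qed
    qed
  qed simp_all
  have "inj_on (\<lambda>d. map (get d) R) ?O"
  proof (rule inj_onI)
    fix d d' assume d: "d \<in> ?O" "d' \<in> ?O" "map (get d) R = map (get d') R"
    then obtain u u' where "u \<in> B" "u' \<in> B" "d = conj_by n u ?c" "d' = conj_by n u' ?c" by blast
    with eq[of u u'] d(3) show "d = d'" by simp
  qed
  moreover have "(\<lambda>d. map (get d) R) ` ?O \<subseteq> {l. set l \<subseteq> {..<n} \<and> length l = length R}"
    using Rn get_maps_lt[OF conj_by_maps] by (auto simp: subset_iff)
  ultimately have "card ?O \<le> card {l. set l \<subseteq> {..<n} \<and> length l = length R}"
    by (rule card_inj_on_le) (simp add: finite_lists_length_eq)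
  then show ?thesis by (simp add: card_lists_length_eq)
qed

text \<open>Supplies the orbit bounds required by \<open>transport_correct\<close>. The separate
  assumption \<open>n \<le> M\<close> is for j = 0, where the segment is {0} and only the value at 0
  has to be recorded.\<close>

lemma transport_isos:
  assumes i: "Suc i < length K" and T: "coset_reps i T" and A: "set A \<subseteq> perms n"
    and clA: "closure n (set A) = isos n g g K i"
    and M: "\<And>j. Suc j < length K \<Longrightarrow> n ^ length (transversal g (K ! j) (K ! Suc j)) \<le> M" "n \<le> M"
    and P: "P = zip (objects n g (take (Suc i) K) (K ! i) T) (objects n h (take (Suc i) K) (K ! i) (map \<phi> T))"
    and D: "D = {u \<in> isos n g g K i. \<forall>e \<in> set (triples i T).
      conj_by n u (twisted n g (K ! i) T (fst e) (fst (snd e)) (snd (snd e))) =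
        twisted n h (K ! i) (map \<phi> T) (\<phi> (fst e)) (\<phi> (fst (snd e))) (snd (snd e))}"
  shows "(transport n M A P = [] \<and> D = {}) \<or>
    (\<exists>B v. transport n M A P = [(B, v)] \<and> v \<in> D \<and> set B \<subseteq> perms n \<and> closure n (set B) = stabilizer_data i T)"
proof -
  let ?tw = "\<lambda>e. twisted n g (K ! i) T (fst e) (fst (snd e)) (snd (snd e))"
  let ?tw' = "\<lambda>e. twisted n h (K ! i) (map \<phi> T) (\<phi> (fst e)) (\<phi> (fst (snd e))) (snd (snd e))"
  have PP: "P = map (\<lambda>e. (?tw e, ?tw' e)) (triples i T)"
    unfolding P objects_map objects_eq[where T = T and h = g] by (simp add: zip_map_map zip_same_conv_map)
  have stab: "transporter n (isos n g g K i) (map (\<lambda>p. (fst p, fst p)) (take q P)) =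
      {u \<in> isos n g g K i. \<forall>e \<in> set (take q (triples i T)). conj_by n u (?tw e) = ?tw e}" for q
    unfolding PP transporter_def by (auto simp: take_map)
  have "card ((\<lambda>u. conj_by n u (fst (P ! q))) `
      transporter n (closure n (set A)) (map (\<lambda>p. (fst p, fst p)) (take q P))) \<le> M" if q: "q < length P" for q
  proof -
    have q': "q < length (triples i T)" using q by (simp add: PP)
    obtain a b j where e: "triples i T ! q = (a, b, K ! j)" "a \<in> set T" "b \<in> set T" "j \<le> i"
      "\<And>j'. j' < j \<Longrightarrow> (a, b, K ! j') \<in> set (take q (triples i T))"
      using triples_split[OF i q'] by blast
    let ?R = "if j = 0 then [0] else transversal g (K ! (j - 1)) (K ! j)"
    have "card ((\<lambda>u. conj_by n u (twisted n g (K ! i) T a b (K ! j))) `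
        {u \<in> isos n g g K i. \<forall>e \<in> set (take q (triples i T)). conj_by n u (?tw e) = ?tw e}) \<le> n ^ length ?R"
    proof (rule twisted_orbit_card[OF i T e(2-4) _ _ refl])
      show "conj_by n u (twisted n g (K ! i) T a b (K ! j')) = twisted n g (K ! i) T a b (K ! j')"
        if "u \<in> {u \<in> isos n g g K i. \<forall>e \<in> set (take q (triples i T)). conj_by n u (?tw e) = ?tw e}" "j' < j"
        for u j'
        using that(1) e(5)[OF that(2)] by fastforce
    qed blast
    also have "\<dots> \<le> M" using M(1)[of "j - 1"] M(2) e(4) i by (cases "j = 0") auto
    finally show ?thesis unfolding clA stab using q' by (simp add: PP e(1))
  qed
  moreover have "set P \<subseteq> maps n \<times> maps n" by (auto simp: PP)
  ultimately have "(transport n M A P = [] \<and> transporter n (closure n (set A)) P = {}) \<or>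
    (\<exists>B v. transport n M A P = [(B, v)] \<and> v \<in> transporter n (closure n (set A)) P \<and>
      set B \<subseteq> perms n \<and>
      closure n (set B) = transporter n (closure n (set A)) (map (\<lambda>p. (fst p, fst p)) P))"
    using transport_correct[OF A] by blast
  moreover have "transporter n (closure n (set A)) P = D"
    unfolding clA PP transporter_def D by auto
  moreover have "transporter n (closure n (set A)) (map (\<lambda>p. (fst p, fst p)) P) = stabilizer_data i T"
    unfolding clA using stab[of "length P"] by (simp add: PP)
  ultimately show ?thesis by simp
qed


subsection \<open>One level\<close>

lemma stabilizer_dataI:
  assumes i: "Suc i < length K" and T: "coset_reps i T" and f: "f \<in> isos n g g K (Suc i)"
    and fT: "\<And>t. t \<in> set T \<Longrightarrow> get f t = t"
  shows "restrict_map i f \<in> stabilizer_data i T"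
proof -
  have "map (get f) T = T" using fT by (intro map_idI)
  then have "conj_by n (restrict_map i f) (twisted n g (K ! i) T a b (K ! j)) = twisted n g (K ! i) T a b (K ! j)"
    if "a \<in> set T" "b \<in> set T" "j \<le> i" for a b j
    using twisted_conj[OF i chain_table_axioms f T that] fT that by simp
  moreover have "\<exists>j \<le> i. k = K ! j" if "k \<in> set (take (Suc i) K)" for k
    using that i by (auto simp: in_set_conv_nth less_Suc_eq_le)
  ultimately show ?thesis
    using restrict_map_isos[of i "Suc i" f g] i f by (fastforce simp: set_triples)
qed

lemma isos_eqI:
  assumes i: "Suc i < length K" and T: "coset_reps i T"
    and f: "f \<in> isos n g h K (Suc i)" "f' \<in> isos n g h K (Suc i)"
    and "\<And>t z. t \<in> set T \<Longrightarrow> z < K ! i \<Longrightarrow> get f (mul g t z) = get f' (mul g t z)"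
  shows "f = f'"
proof (rule maps_eqI[of _ n])
  fix x assume x: "x < n"
  show "get f x = get f' x"
  proof (cases "x < K ! Suc i")
    case True
    obtain t z where tz: "t \<in> set T" "z < K ! i" "x = mul g t z" by (rule coset_repsE[OF T True])
    then show ?thesis using assms(5)[OF tz(1,2)] by simp
  next
    case False
    then show ?thesis using isosD(3)[OF f(1) x] isosD(3)[OF f(2) x] by simp
  qed
qed (use isosD(1) f in auto)

lemma lift_map_restrict:
  assumes i: "Suc i < length K" and T: "coset_reps i T" and f: "f \<in> isos n g g K (Suc i)"
    and fT: "\<And>t. t \<in> set T \<Longrightarrow> get f t = t"
  shows "lift_map i T (restrict_map i f) = f"
proof (rule isos_eqI[OF i T _ f])
  have r: "restrict_map i f \<in> stabilizer_data i T" by (rule stabilizer_dataI[OF assms])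
  show "lift_map i T (restrict_map i f) \<in> isos n g g K (Suc i)" by (rule lift_map_isos[OF i T r])
  fix t z assume tz: "t \<in> set T" "z < K ! i"
  have rI: "restrict_map i f \<in> isos n g g K i" using r by blast
  have l: "t < K ! Suc i" "z < K ! Suc i" "z < n"
    using coset_repsD(2)[OF T tz(1)] tz(2) K_mono[of i "Suc i"] less_K_less_n[of i z] i by auto
  show "get (lift_map i T (restrict_map i f)) (mul g t z) = get f (mul g t z)"
    using get_lift_map[OF i T tz rI] isosD(2)[OF f l(1,2)] fT[OF tz(1)] tz(2) l(3) by simp
qed

lemma lift_map_cmp:
  assumes i: "Suc i < length K" and T: "coset_reps i T"
    and u: "u \<in> stabilizer_data i T" "v \<in> stabilizer_data i T"
  shows "lift_map i T (cmp n u v) = cmp n (lift_map i T u) (lift_map i T v)"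
proof -
  have i': "i < length K" using i by simp
  have I: "u \<in> isos n g g K i" "v \<in> isos n g g K i" using u by auto
  have uv: "cmp n u v \<in> stabilizer_data i T"
    using u isos_cmp[OF i' I(2,1)] isosD(1)[OF I(1)] isosD(1)[OF I(2)] by (auto simp: conj_by_cmp)
  note lu = lift_map_isos[OF i T u(1)] and lv = lift_map_isos[OF i T u(2)]
  show ?thesis
  proof (rule isos_eqI[OF i T lift_map_isos[OF i T uv] isos_cmp[OF i lv lu]])
    fix t z assume tz: "t \<in> set T" "z < K ! i"
    have l: "z < n" "get v z < K ! i" "mul g t z < n"
      using less_K_less_n[OF i' tz(2)] isos_less[OF I(2) i' i' tz(2)]
        mul_less[OF less_K_less_n[OF i coset_repsD(2)[OF T tz(1)]] less_K_less_n[OF i' tz(2)]] by auto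
    have "get (lift_map i T (cmp n u v)) (mul g t z) = mul g t (get u (get v z))"
      using get_lift_map[OF i T tz, of "cmp n u v"] uv l(1) isosD(1)[OF I(1)] isosD(1)[OF I(2)] by simp
    moreover have "get (cmp n (lift_map i T u) (lift_map i T v)) (mul g t z) = mul g t (get u (get v z))"
      using get_lift_map[OF i T tz I(2)] get_lift_map[OF i T tz(1) l(2) I(1)] l(3) by simp
    ultimately show "get (lift_map i T (cmp n u v)) (mul g t z) =
        get (cmp n (lift_map i T u) (lift_map i T v)) (mul g t z)" by simp
  qed
qed

text \<open>An automorphism fixing \<open>T\<close> pointwise is the lift of its restriction, which
  lies in \<open>stabilizer_data\<close>. As lifting is multiplicative
  (\<open>lift_map_cmp\<close>), lifts of generators are enough.\<close>

lemma lifts_correct: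
  assumes i: "Suc i < length K" and T: "coset_reps i T" and A: "set A \<subseteq> perms n"
    and clA: "closure n (set A) = isos n g g K i"
    and M: "\<And>j. Suc j < length K \<Longrightarrow> n ^ length (transversal g (K ! j) (K ! Suc j)) \<le> M" "n \<le> M"
  shows "set (lifts n M g (take (Suc i) K, K ! i, K ! Suc i) A T) \<subseteq> isos n g g K (Suc i)"
    "\<And>f. f \<in> isos n g g K (Suc i) \<Longrightarrow> (\<And>t. t \<in> set T \<Longrightarrow> get f t = t) \<Longrightarrow>
      f \<in> closure n (set (lifts n M g (take (Suc i) K, K ! i, K ! Suc i) A T))"
proof -
  let ?lv = "(take (Suc i) K, K ! i, K ! Suc i)"
  let ?P = "zip (objects n g (take (Suc i) K) (K ! i) T) (objects n g (take (Suc i) K) (K ! i) (map (\<lambda>t. t) T))"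
  have i': "i < length K" using i by simp
  \<comment> \<open>The identity transports the data to themselves, so \<open>transport\<close>
    cannot fail here.\<close>
  have id: "[0..<n] \<in> stabilizer_data i T"
    using perm_groupD(2)[OF perm_group_isos[OF i']] by simp
  then obtain B v where B: "transport n M A ?P = [(B, v)]" "set B \<subseteq> perms n"
    "closure n (set B) = stabilizer_data i T"
    using transport_isos[OF i T A clA M refl refl, where h = g and \<phi> = "\<lambda>t. t"] by fastforce
  have BS: "set B \<subseteq> stabilizer_data i T" using closure_incl[OF B(2)] B(3) by blast
  have "zip T T = map (\<lambda>t. (t, t)) T" by (simp add: zip_same_conv_map)
  then have lifts: "set (lifts n M g ?lv A T) = lift_map i T ` set B"
    using B(1) BS lift_map_isos[OF i T] chain_map_iff[OF i extend_maps] by (auto simp: lifts_def)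
  show "set (lifts n M g ?lv A T) \<subseteq> isos n g g K (Suc i)"
    unfolding lifts using BS lift_map_isos[OF i T] by blast
  have idl: "lift_map i T [0..<n] = [0..<n]"
  proof -
    have "[0..<n] \<in> isos n g g K (Suc i)" using perm_groupD(2)[OF perm_group_isos[OF i]] .
    from lift_map_restrict[OF i T this] have "lift_map i T (restrict_map i [0..<n]) = [0..<n]"
      using less_K_less_n[OF i coset_repsD(2)[OF T]] by simp
    moreover have "restrict_map i [0..<n] = [0..<n]" by (auto simp: restrict_map_def intro!: map_idI)
    ultimately show ?thesis by simp
  qed
  have "lift_map i T u \<in> closure n (set (lifts n M g ?lv A T))" if "u \<in> closure n (set B)" for u
    using that
  proof induction
    case closure_id then show ?case unfolding idl by (rule closure.closure_id)
  next
    case (closure_step s f)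
    then have "lift_map i T (cmp n s f) = cmp n (lift_map i T s) (lift_map i T f)"
      using BS B(3) by (intro lift_map_cmp[OF i T]) auto
    then show ?case using closure_step by (auto simp: lifts intro: closure.closure_step)
  qed
  note * = this
  fix f assume f: "f \<in> isos n g g K (Suc i)" "\<And>t. t \<in> set T \<Longrightarrow> get f t = t"
  have "restrict_map i f \<in> closure n (set B)"
    unfolding B(3) by (rule stabilizer_dataI[OF i T f])
  from *[OF this] show "f \<in> closure n (set (lifts n M g ?lv A T))"
    by (simp only: lift_map_restrict[OF i T f])
qed

text \<open>The given \<open>f\<close> itself need not be found. Its restriction shows that the
  transport for the tuple of values of \<open>f\<close> on \<open>T\<close> succeeds, with some v.
  Then the inverse of the restriction followed after v is an element b stabilizing the data, and
  \<open>f\<close> composed with the lift of b is an isomorphism that equals the candidate built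
  from v.\<close>

lemma extensions_correct:
  assumes i: "Suc i < length K" and T: "coset_reps i T" and A: "set A \<subseteq> perms n"
    and clA: "closure n (set A) = isos n g g K i"
    and M: "\<And>j. Suc j < length K \<Longrightarrow> n ^ length (transversal g (K ! j) (K ! Suc j)) \<le> M" "n \<le> M"
    and MT: "n ^ length T \<le> M" and h: "chain_table n h K"
    and agree: "\<And>x y. x < K ! i \<Longrightarrow> y < K ! i \<Longrightarrow> mul h x y = mul g x y"
  shows "set (extensions n M g h (take (Suc i) K, K ! i, K ! Suc i) A T) \<subseteq> isos n g h K (Suc i)"
    "\<And>f. f \<in> isos n g h K (Suc i) \<Longrightarrow>
      \<exists>f' \<in> set (extensions n M g h (take (Suc i) K, K ! i, K ! Suc i) A T). \<forall>t \<in> set T. get f' t = get f t"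
proof -
  let ?lv = "(take (Suc i) K, K ! i, K ! Suc i)"
  interpret h: chain_table n h K by (rule h)
  have i': "i < length K" and K: "K ! i \<le> K ! Suc i" using i K_mono[of i "Suc i"] by auto
  show "set (extensions n M g h ?lv A T) \<subseteq> isos n g h K (Suc i)"
    using chain_map_iff[OF i extend_maps] by (auto simp: extensions_def Let_def split: list.splits if_splits)
  fix f assume f: "f \<in> isos n g h K (Suc i)"
  have fp: "f \<in> perms n" using isosD(1)[OF f] .
  let ?y = "map (get f) T" and ?f0 = "restrict_map i f"
  let ?P = "zip (objects n g (take (Suc i) K) (K ! i) T) (objects n h (take (Suc i) K) (K ! i) ?y)"
  have "?f0 \<in> isos n g h K i" using restrict_map_isos[of i "Suc i" f h] i f by simp
  \<comment> \<open>The two tables agree below \<open>K ! i\<close>, so an isomorphism between them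
    there is an automorphism.\<close>
  then have f0: "?f0 \<in> isos n g g K i"
  proof -
    assume *: "?f0 \<in> isos n g h K i"
    show ?thesis
    proof (rule isosI)
      fix x y assume xy: "x < K ! i" "y < K ! i"
      then show "get ?f0 (mul g x y) = mul g (get ?f0 x) (get ?f0 y)"
        using isosD(2)[OF * xy] agree[OF isos_less[OF * i' i' xy(1)] isos_less[OF * i' i' xy(2)]] by simp
    qed (use * in \<open>auto simp: isos_def\<close>)
  qed
  have set_ks: "\<exists>j \<le> i. k = K ! j" if "k \<in> set (take (Suc i) K)" for k
    using that i by (auto simp: in_set_conv_nth less_Suc_eq_le)
  let ?D = "{u \<in> isos n g g K i. \<forall>e \<in> set (triples i T).
      conj_by n u (twisted n g (K ! i) T (fst e) (fst (snd e)) (snd (snd e))) =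
        twisted n h (K ! i) ?y (get f (fst e)) (get f (fst (snd e))) (snd (snd e))}"
  have f0D: "?f0 \<in> ?D"
    using f0 twisted_conj[OF i h f T] set_ks by (fastforce simp: set_triples)
  then obtain B v where v: "transport n M A ?P = [(B, v)]" "v \<in> ?D"
    using transport_isos[OF i T A clA M refl refl, where h = h and \<phi> = "get f"] by blast
  have vI: "v \<in> isos n g g K i" using v(2) by blast
  let ?b = "cmp n (pinv n ?f0) v"
  have p: "?f0 \<in> perms n" "v \<in> perms n" using isosD(1) f0 vI by blast+
  have b: "?b \<in> stabilizer_data i T"
  proof -
    have "?b \<in> isos n g g K i" using isos_cmp[OF i' vI isos_pinv[OF i' f0]] .
    moreover have "conj_by n ?b c = c" if "conj_by n v c = d" "conj_by n ?f0 c = d" "c \<in> maps n" for c d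
      using that p by (simp add: conj_by_cmp) (metis conj_by_pinv(2))
    ultimately show ?thesis using v(2) f0D by fastforce
  qed
  let ?f' = "cmp n f (lift_map i T ?b)"
  have f': "?f' \<in> isos n g h K (Suc i)" by (rule isos_cmp[OF i lift_map_isos[OF i T b] f])
  let ?e = "extend n g h (K ! i) (K ! Suc i) (zip T ?y) v"
  have zip: "zip T ?y = map (\<lambda>t. (t, get f t)) T" by (simp add: zip_map2 zip_same_conv_map)
  have e: "get ?f' (mul g t z) = get ?e (mul g t z) \<and> get ?f' (mul g t z) = mul h (get f t) (get v z)"
    if tz: "t \<in> set T" "z < K ! i" for t z
  proof -
    have bI: "?b \<in> isos n g g K i" using b by blast
    have l: "t < K ! Suc i" "z < K ! Suc i" "z < n" "mul g t z < K ! Suc i" "mul g t z < n"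
      "get ?b z < K ! i" "get v z < K ! i"
      using coset_repsD(2)[OF T tz(1)] tz(2) K less_K_less_n[OF i'] mul_closed[OF i] less_K_less_n[OF i]
        isos_less[OF bI i' i' tz(2)] isos_less[OF vI i' i' tz(2)] by auto
    have "get f (get ?b z) = get ?f0 (get ?b z)" using l(6) less_K_less_n[OF i' l(6)] by simp
    also have "\<dots> = get v z" using l(3) p by (simp add: get_maps_lt)
    finally have fb: "get f (get ?b z) = get v z" .
    have "get ?f' (mul g t z) = get f (mul g t (get ?b z))"
      using get_lift_map[OF i T tz bI] l(5) fp by simp
    also have "\<dots> = mul h (get f t) (get v z)"
      using isosD(2)[OF f l(1), of "get ?b z"] l(6) K fb by simp
    finally have 1: "get ?f' (mul g t z) = mul h (get f t) (get v z)" .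
    have "mul h (get f t) (get v z) < n"
      using get_maps_lt[OF cmp_maps l(5), of f "lift_map i T ?b"] 1 by simp
    then have "get ?e (mul g t z) = mul h (get f t) (get v z)"
      unfolding zip using get_extend[OF T tz l(4,5), of h "get f" v] by (simp add: clip_def)
    with 1 show ?thesis by simp
  qed
  have "?e = ?f'"
  proof (rule maps_eqI[OF extend_maps cmp_maps])
    fix x assume x: "x < n"
    show "get ?e x = get ?f' x"
    proof (cases "x < K ! Suc i")
      case True
      obtain t z where tz: "t \<in> set T" "z < K ! i" "x = mul g t z" by (rule coset_repsE[OF T True])
      then show ?thesis using e[OF tz(1,2)] by simp
    next
      case False
      then show ?thesis using get_extend_ge[OF x, of i] isosD(3)[OF f' x] by simp
    qed
  qed
  then have eI: "?e \<in> isos n g h K (Suc i)" using f' by simp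
  have "?y \<in> set (tuples n M T)"
    unfolding tuples_correct[OF n_pos MT]
    using get_maps_lt[OF perms_maps[OF fp]] less_K_less_n[OF i coset_repsD(2)[OF T]] by auto
  then have "?e \<in> set (extensions n M g h ?lv A T)"
    using v(1) eI chain_map_iff[OF i extend_maps]
    by (auto simp: extensions_def Let_def intro!: bexI[of _ ?y])
  moreover have "get ?e t = get f t" if t: "t \<in> set T" for t
  proof -
    have tn: "t < n" using less_K_less_n[OF i coset_repsD(2)[OF T t]] .
    \<comment> \<open>Since \<open>?b\<close> fixes 0, its lift fixes t = t 0; hence
      \<open>?e\<close> has the prescribed values on \<open>T\<close>.\<close>
    have "get ?b 0 = 0" using isos_0[OF i' chain_table_axioms, of ?b] b by blast
    then have "get (lift_map i T ?b) t = t"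
      using get_lift_map[OF i T t K_pos[OF i'], of ?b] b mul_0_right[OF tn] by simp
    then have "get ?f' t = get f t" using tn fp by simp
    then show ?thesis using \<open>?e = ?f'\<close> by simp
  qed
  ultimately show "\<exists>f' \<in> set (extensions n M g h ?lv A T). \<forall>t \<in> set T. get f' t = get f t" by blast
qed

text \<open>As the new table is pulled back along \<open>f\<close>, this \<open>f\<close> becomes an
  isomorphism of the whole chain onto \<open>h\<close>, although it respects the table
  \<open>g\<close> only up to level \<open>i\<close>.\<close>

lemma relabel_correct:
  assumes h: "chain_table n h K" and i: "i < length K" and f: "f \<in> isos n g h K i"
  shows "chain_table n (relabel n h f) K" "f \<in> isos n (relabel n h f) h K (length K - 1)"
    "\<And>x y. x < K ! i \<Longrightarrow> y < K ! i \<Longrightarrow> mul (relabel n h f) x y = mul g x y"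
proof -
  interpret h: chain_table n h K by (rule h)
  have p: "f \<in> perms n" using isosD(1)[OF f] .
  note fm = get_maps_lt[OF perms_maps[OF p]] and pm = get_maps_lt[OF pinv_maps[of n f]]
  note mr = mul_relabel[OF p]
  have less: "get f x < K ! j \<longleftrightarrow> x < K ! j" if "j < length K" "x < n" for x j
    using isos_less_iff[OF f i that] .
  have pless: "get (pinv n f) x < K ! j" if "j < length K" "x < K ! j" for x j
    using less[OF that(1) pm[OF less_K_less_n[OF that]]] p that less_K_less_n[OF that] by simp
  have fmr: "get f (mul (relabel n h f) x y) = mul h (get f x) (get f y)" if "x < n" "y < n" for x y
    using mr[OF that] p h.mul_less[OF fm fm] that by simp
  have f0: "get f 0 = 0" by (rule isos_0[OF i h f])
  have p0: "get (pinv n f) 0 = 0" using pinv_get[OF p n_pos] f0 by simp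
  show ct: "chain_table n (relabel n h f) K"
  proof
    fix i' x y assume *: "i' < length K" "x < K ! i'" "y < K ! i'"
    then have "get f x < K ! i'" "get f y < K ! i'" "x < n" "y < n" using less less_K_less_n by auto
    then show "mul (relabel n h f) x y < K ! i'" using mr pless[OF *(1)] h.mul_closed[OF *(1)] by simp
  next
    fix i' x assume *: "i' < length K" "x < K ! i'"
    then have xn: "x < n" "get f x < K ! i'" using less less_K_less_n by auto
    obtain y where y: "y < K ! i'" "mul h (get f x) y = 0" "mul h y (get f x) = 0"
      using h.inverse_ex[OF *(1) xn(2)] by blast
    have yn: "y < n" using less_K_less_n[OF *(1) y(1)] .
    have "mul (relabel n h f) x (get (pinv n f) y) = 0" "mul (relabel n h f) (get (pinv n f) y) x = 0"
      using mr[OF xn(1) pm[OF yn]] mr[OF pm[OF yn] xn(1)] p yn y p0 by simp_all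
    then show "\<exists>y<K ! i'. mul (relabel n h f) x y = 0 \<and> mul (relabel n h f) y x = 0"
      using pless[OF *(1) y(1)] by blast
  next
    fix x y z assume *: "x < n" "y < n" "z < n"
    have m: "mul (relabel n h f) x y < n" "mul (relabel n h f) y z < n"
      using mr * pm h.mul_less fm by simp_all
    have "get f (mul (relabel n h f) (mul (relabel n h f) x y) z) =
      get f (mul (relabel n h f) x (mul (relabel n h f) y z))"
      using * m fmr h.mul_assoc fm by simp
    moreover have "mul (relabel n h f) (mul (relabel n h f) x y) z < n"
      "mul (relabel n h f) x (mul (relabel n h f) y z) < n"
      using mr * m pm h.mul_less fm by simp_all
    ultimately show "mul (relabel n h f) (mul (relabel n h f) x y) z =
      mul (relabel n h f) x (mul (relabel n h f) y z)"
      using perms_inj[OF p] by blast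
  next
    fix x assume x: "x < n"
    show "mul (relabel n h f) 0 x = x" "mul (relabel n h f) x 0 = x"
      using mr[OF n_pos x] mr[OF x n_pos] x p fm f0 by (simp_all add: h.mul_0_left h.mul_0_right)
  next
    fix i' x z assume *: "Suc i' < length K" "x < K ! Suc i'" "z < K ! i'"
    have n: "x < n" "z < n" "i' < length K" using * less_K_less_n[of i' z] less_K_less_n[of "Suc i'" x] by auto
    have l: "get f x < K ! Suc i'" "get f z < K ! i'" using less n * by auto
    obtain w where w: "w < K ! i'" "mul h (get f z) (get f x) = mul h (get f x) w"
      using h.normal[OF *(1) l] by blast
    have wn: "w < n" using less_K_less_n[OF n(3) w(1)] .
    have "mul (relabel n h f) z x = mul (relabel n h f) x (get (pinv n f) w)"
      using mr[OF n(2,1)] mr[OF n(1) pm[OF wn]] w(2) p wn by simp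
    then show "\<exists>w<K ! i'. mul (relabel n h f) z x = mul (relabel n h f) x w"
      using pless[OF n(3) w(1)] by blast
  qed (use K_nonempty K_first K_last K_mono in auto)
  show "f \<in> isos n (relabel n h f) h K (length K - 1)"
  proof (rule isosI[OF p])
    show "get f (mul (relabel n h f) x y) = mul h (get f x) (get f y)"
      if "x < K ! (length K - 1)" "y < K ! (length K - 1)" for x y
      using fmr that K_last by simp
    show "get f x < K ! j" if "j \<le> length K - 1" "x < K ! j" for j x
    proof -
      have "j < length K" using that(1) last_index by simp
      then show ?thesis using less less_K_less_n that(2) by blast
    qed
  qed (use K_last in simp)
  fix x y assume xy: "x < K ! i" "y < K ! i"
  then have "x < n" "y < n" "mul g x y < n" using less_K_less_n[OF i] mul_closed[OF i] by auto
  then show "mul (relabel n h f) x y = mul g x y"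
    using mr isosD(2)[OF f xy] p by (simp flip: isosD(2)[OF f xy])
qed


subsection \<open>The whole chain\<close>

lemma isos_restrict_nonempty:
  "i < length K \<Longrightarrow> isos n g h K (length K - 1) \<noteq> {} \<Longrightarrow> isos n g h K i \<noteq> {}"
  using restrict_map_isos[of i "length K - 1" _ h] last_index by force

theorem chain_isomorphic_iff:
  assumes M: "\<And>j. Suc j < length K \<Longrightarrow> n ^ length (transversal g (K ! j) (K ! Suc j)) \<le> M"
    and h: "chain_table n h K"
  shows "chain_isomorphic n M g h K \<longleftrightarrow> isos n g h K (length K - 1) \<noteq> {}"
proof -
  let ?full = "\<lambda>h. isos n g h K (length K - 1)"
  define st where "st i = foldl (level_step n M g) [([], h)] (take i (levels K))" for i
  have levels: "take (Suc i) (levels K) = take i (levels K) @ [(take (Suc i) K, K ! i, K ! Suc i)]"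
    if "Suc i < length K" for i
    using that by (simp add: levels_def take_map take_Suc_conv_app_nth nth_default_eq)
  have st_Suc: "st (Suc i) = level_step n M g (st i) (take (Suc i) K, K ! i, K ! Suc i)"
    if "Suc i < length K" for i
    using levels[OF that] by (simp add: st_def)
  have inv: "(st i = [] \<and> ?full h = {}) \<or> (\<exists>A h'. st i = [(A, h')] \<and> set A \<subseteq> perms n \<and>
      closure n (set A) = isos n g g K i \<and> chain_table n h' K \<and>
      (\<forall>x < K ! i. \<forall>y < K ! i. mul h' x y = mul g x y) \<and> (?full h' = {} \<longleftrightarrow> ?full h = {}))"
    if "i < length K" for i
    using that
  proof (induction i)
    case 0
    interpret h: chain_table n h K by (rule h)
    have "isos n g g K 0 = {[0..<n]}"
    proof
      show "isos n g g K 0 \<subseteq> {[0..<n]}"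
      proof
        fix f assume f: "f \<in> isos n g g K 0"
        have "get f x = x" if "x < n" for x
          using isosD(3)[OF f that] isos_less[OF f 0 0, of x] K_first by (cases "x = 0") auto
        then show "f \<in> {[0..<n]}" using maps_eqI[of f n "[0..<n]"] isosD(1)[OF f] by simp
      qed
      show "{[0..<n]} \<subseteq> isos n g g K 0" using perm_groupD(2)[OF perm_group_isos[OF 0]] by simp
    qed
    moreover have "closure n {} = {[0..<n]}"
      using closure.closure_id[of n "{}"] by (auto elim: closure.cases)
    ultimately show ?case
      using h K_first n_pos mul_0_left h.mul_0_left by (auto simp: st_def)
  next
    case (Suc i)
    have i: "Suc i < length K" "i < length K" using Suc.prems by auto
    let ?T = "transversal g (K ! i) (K ! Suc i)" and ?lv = "(take (Suc i) K, K ! i, K ! Suc i)"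
    have T: "coset_reps i ?T" by (rule transversal_correct[OF i(1)])
    have MT: "n ^ length ?T \<le> M" by (rule M[OF i(1)])
    have "0 < length ?T"
      using coset_reps_length[OF i(1) T] K_pos[OF i(1)] by (metis gr0I mult_0 less_irrefl)
    then have nM: "n \<le> M"
      using MT n_pos self_le_power[of n "length ?T"] by simp
    from Suc.IH[OF i(2)] show ?case
    proof (elim disjE exE conjE)
      assume "st i = []" "?full h = {}"
      then show ?thesis using st_Suc[OF i(1)] by (simp add: level_step_def)
    next
      fix A h' assume A: "st i = [(A, h')]" "set A \<subseteq> perms n" "closure n (set A) = isos n g g K i"
        and h': "chain_table n h' K" "\<forall>x < K ! i. \<forall>y < K ! i. mul h' x y = mul g x y"
        and full: "?full h' = {} \<longleftrightarrow> ?full h = {}"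
      let ?E = "extensions n M g h' ?lv A ?T"
      let ?A = "extensions n M g g ?lv A ?T @ lifts n M g ?lv A ?T"
      have E: "set ?E \<subseteq> isos n g h' K (Suc i)"
        "\<And>f. f \<in> isos n g h' K (Suc i) \<Longrightarrow> \<exists>f' \<in> set ?E. \<forall>t \<in> set ?T. get f' t = get f t"
        using extensions_correct[OF i(1) T A(2,3) M nM MT h'(1)] h'(2) by blast+
      have step: "st (Suc i) = (case ?E of [] \<Rightarrow> [] | f # _ \<Rightarrow> [(sims n ?A, relabel n h' f)])"
        unfolding st_Suc[OF i(1)] A(1) level_step_def Let_def by (simp only: list.case fst_conv snd_conv)
      show ?thesis
      proof (cases ?E)
        case Nil
        then have "isos n g h' K (Suc i) = {}" using E(2) by (metis empty_iff empty_set equals0I)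
        then have "?full h' = {}" using isos_restrict_nonempty[OF i(1)] by blast
        then show ?thesis using step Nil full by simp
      next
        case (Cons f fs)
        have f: "f \<in> isos n g h' K (Suc i)" using E(1) Cons by simp
        note G = perm_group_isos[OF i(1)]
        have ext: "set (extensions n M g g ?lv A ?T) \<subseteq> isos n g g K (Suc i)"
          "\<And>f. f \<in> isos n g g K (Suc i) \<Longrightarrow>
            \<exists>f' \<in> set (extensions n M g g ?lv A ?T). \<forall>t \<in> set ?T. get f' t = get f t"
          using extensions_correct[OF i(1) T A(2,3) M nM MT chain_table_axioms] by blast+
        note li = lifts_correct[OF i(1) T A(2,3) M nM]
        have sub: "set ?A \<subseteq> isos n g g K (Suc i)" using ext(1) li(1) by simp
        then have Ap: "set ?A \<subseteq> perms n" using perm_groupD(1)[OF G] by blast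
        have "isos n g g K (Suc i) \<subseteq> closure n (set ?A)"
        proof
          fix e assume e: "e \<in> isos n g g K (Suc i)"
          obtain e' where e': "e' \<in> set (extensions n M g g ?lv A ?T)" "\<forall>t \<in> set ?T. get e' t = get e t"
            using ext(2)[OF e] by blast
          have p: "e \<in> perms n" "e' \<in> perms n" "e' \<in> isos n g g K (Suc i)"
            using e e'(1) ext(1) perm_groupD(1)[OF G] by blast+
          \<comment> \<open>The factorization e = e' d: \<open>e'\<close> is a collected extension
            with the values of \<open>e\<close> on \<open>?T\<close>, and d fixes \<open>?T\<close>
            pointwise, so it is generated by \<open>lifts\<close>.\<close>
          let ?d = "cmp n (pinv n e') e"
          have "get ?d t = t" if "t \<in> set ?T" for t
          proof -
            have "t < n" using less_K_less_n[OF i(1) coset_repsD(2)[OF T that]] .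
            then have "get ?d t = get (pinv n e') (get e t)" using p by simp
            also have "\<dots> = get (pinv n e') (get e' t)" using e'(2) that by simp
            also have "\<dots> = t" by (rule pinv_get[OF p(2) \<open>t < n\<close>])
            finally show ?thesis .
          qed
          then have "?d \<in> closure n (set (lifts n M g ?lv A ?T))"
            using li(2)[of ?d] perm_groupD(3,4)[OF G] e p(3) by blast
          then have "?d \<in> closure n (set ?A)"
            using closure_mono_subset[OF _ Ap, of "set (lifts n M g ?lv A ?T)"] by auto
          then have "cmp n e' ?d \<in> closure n (set ?A)" using e'(1) by (intro closure_step[of e']) auto
          then show "e \<in> closure n (set ?A)" using p by simp
        qed
        moreover have "closure n (set ?A) \<subseteq> isos n g g K (Suc i)" by (rule closure_subset[OF G sub])
        ultimately have clA: "closure n (set (sims n ?A)) = isos n g g K (Suc i)"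
          using sims_correct(2)[OF Ap] by blast
        note rel = relabel_correct[OF h'(1) i(1) f]
        interpret r: chain_table n "relabel n h' f" K by (rule rel(1))
        interpret h': chain_table n h' K by (rule h'(1))
        \<comment> \<open>Committing to one extension \<open>f\<close> is safe: it is an isomorphism
          of whole chains between the renamed table and the old one, so composing with it or its
          inverse converts full isomorphisms.\<close>
        have "?full (relabel n h' f) = {} \<longleftrightarrow> ?full h' = {}"
          using isos_cmp[OF last_index _ rel(2)] isos_cmp[OF last_index _ r.isos_pinv[OF last_index rel(2)]]
          by blast
        then show ?thesis
          using step Cons sims_correct(1)[OF Ap] clA rel(1,3) full by auto
      qed
    qed
  qed
  have len: "length (levels K) = length K - 1" by (simp add: levels_def)
  have "chain_isomorphic n M g h K \<longleftrightarrow> st (length K - 1) \<noteq> []"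
    by (simp add: chain_isomorphic_def st_def len)
  also have "\<dots> \<longleftrightarrow> ?full h \<noteq> {}"
    using inv[OF last_index]
  proof (elim disjE exE conjE)
    fix A h' assume *: "st (length K - 1) = [(A, h')]" "chain_table n h' K"
      "\<forall>x < K ! (length K - 1). \<forall>y < K ! (length K - 1). mul h' x y = mul g x y"
      "?full h' = {} \<longleftrightarrow> ?full h = {}"
    \<comment> \<open>On the last member the tables agree everywhere, so the identity is a full
      isomorphism.\<close>
    have "[0..<n] \<in> ?full h'"
    proof (rule isosI)
      show "get [0..<n] (mul g x y) = mul h' (get [0..<n] x) (get [0..<n] y)"
        if "x < K ! (length K - 1)" "y < K ! (length K - 1)" for x y
        using that *(3) K_last mul_less by simp
      show "get [0..<n] x < K ! j" if "j \<le> length K - 1" "x < K ! j" for j x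
        using that less_K_less_n[of j x] last_index by simp
    qed simp_all
    then show ?thesis using * by auto
  qed simp
  finally show ?thesis .
qed

end


section \<open>From groups with subnormal series to numbered tables\<close>

section \<open>From subnormal series to chains of initial segments\<close>

lemma dedup_append: "\<exists>ys. dedup (a @ b) = dedup a @ ys"
proof (induction b rule: rev_induct)
  case (snoc x b)
  then show ?case by (auto simp: dedup_def)
qed simp

lemma dedup_correct: "distinct (dedup l)" "set (dedup l) = set l"
proof -
  have "distinct (dedup l) \<and> set (dedup l) = set l"
    by (induction l rule: rev_induct) (auto simp: dedup_def list_ex_iff)
  then show "distinct (dedup l)" "set (dedup l) = set l" by auto
qed

lemma subnormal_seriesD:
  assumes "subnormal_series G S"
  shows "S \<noteq> []" "S ! 0 = {\<one>\<^bsub>G\<^esub>}" "S ! (length S - 1) = carrier G"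
    "Suc i < length S \<Longrightarrow> S ! i \<lhd> G\<lparr>carrier := S ! Suc i\<rparr>"
    "Suc i < length S \<Longrightarrow> S ! i \<noteq> S ! Suc i"
  using assms by (auto simp: subnormal_series_def hd_conv_nth last_conv_nth)

text \<open>Induction from the top, because normality only makes a member a subgroup of the next
  one.\<close>

lemma (in group) subnormal_series_subgroup:
  assumes S: "subnormal_series G S" and i: "i < length S"
  shows "subgroup (S ! i) G"
proof -
  have "j < length S \<Longrightarrow> subgroup (S ! (length S - 1 - j)) G" for j
  proof (induction j)
    case 0 then show ?case using subnormal_seriesD(3)[OF S] subgroup_self by simp
  next
    case (Suc j)
    let ?i = "length S - 1 - Suc j"
    have si: "Suc ?i = length S - 1 - j" "Suc ?i < length S" using Suc.prems by auto
    have "subgroup (S ! ?i) (G\<lparr>carrier := S ! Suc ?i\<rparr>)"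
      using subnormal_seriesD(4)[OF S si(2)] by (rule normal_imp_subgroup)
    moreover have "subgroup (S ! Suc ?i) G" using Suc si(1) by simp
    ultimately show ?case using incl_subgroup by blast
  qed
  from this[of "length S - 1 - i"] show ?thesis using i by simp
qed

lemma (in group) subnormal_series_step:
  assumes S: "subnormal_series G S" and i: "Suc i < length S"
  shows "S ! i \<subset> S ! Suc i"
  using normal_imp_subgroup[OF subnormal_seriesD(4)[OF S i]] subnormal_seriesD(5)[OF S i] subgroup.subset
  by fastforce

lemma (in group) subnormal_series_mono:
  assumes S: "subnormal_series G S" and "i \<le> j" "j < length S"
  shows "S ! i \<subseteq> S ! j"
  using assms(2,3)
proof (induction j)
  case (Suc j)
  then show ?case using subnormal_series_step[OF S, of j] by (cases "i = Suc j") auto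
qed simp

lemma (in group) subnormal_series_factor_order:
  assumes S: "subnormal_series G S" and i: "Suc i < length S" and fin: "finite (carrier G)"
  shows "order (G\<lparr>carrier := S ! Suc i\<rparr> Mod (S ! i)) * card (S ! i) = card (S ! Suc i)"
proof -
  have "group (G\<lparr>carrier := S ! Suc i\<rparr>)"
    using subgroup.subgroup_is_group[OF subnormal_series_subgroup[OF S i] group_axioms] .
  from group.lagrange[OF this normal_imp_subgroup[OF subnormal_seriesD(4)[OF S i]]]
  show ?thesis by (simp add: order_def FactGroup_def)
qed

locale presented_series = group G for G :: "nat monoid" (structure) +
  fixes n :: nat and S :: "nat set list"
  assumes carrier: "carrier G = {..<n}" and series: "subnormal_series G S"
begin

abbreviation "member_lists \<equiv> map sorted_list_of_set S"

abbreviation "numbering \<equiv> dedup (concat member_lists)"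

abbreviation "sizes \<equiv> map length member_lists"

abbreviation "table \<equiv> relabel n (mult_table G) numbering"

lemma S_subset: "i < length S \<Longrightarrow> S ! i \<subseteq> {..<n}"
  using subgroup.subset[OF subnormal_series_subgroup[OF series]] carrier by simp

lemma S_finite: "i < length S \<Longrightarrow> finite (S ! i)"
  using S_subset finite_subset by blast

lemma order_n: "order G = n"
  by (simp add: order_def carrier)

lemma mult_table_closed: "x < n \<Longrightarrow> y < n \<Longrightarrow> x \<otimes> y < n"
  using m_closed carrier by (metis lessThan_iff)

lemma mul_mult_table: "x < n \<Longrightarrow> y < n \<Longrightarrow> mul (mult_table G) x y = x \<otimes> y"
  by (simp add: mul_def mult_table_def order_n nth_default_eq)

lemma last_S: "S ! (length S - 1) = {..<n}"
  using subnormal_seriesD(3)[OF series] carrier by simp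

lemma length_S_pos: "0 < length S"
  using subnormal_seriesD(1)[OF series] by simp

lemma set_member_lists: "set (concat (take (Suc j) member_lists)) = S ! j" if j: "j < length S"
proof -
  have "set (concat (take (Suc j) member_lists)) = (\<Union>i \<in> {..<Suc j}. S ! i)"
  proof -
    have "set (take (Suc j) member_lists) = (!) member_lists ` {0..<Suc j}" using j by (subst nth_image) simp_all
    then show ?thesis using j S_finite by (auto simp: set_concat)
  qed
  also have "\<dots> = S ! j"
    by (intro equalityI UN_least subnormal_series_mono[OF series _ j] UN_upper) simp_all
  finally show ?thesis .
qed

text \<open>The members are nested, so the first ones together have the elements of
  \<open>S ! j\<close>; and \<open>dedup\<close> of a prefix is a prefix of
  \<open>dedup\<close>.\<close>

lemma numbering_take: "j < length S \<Longrightarrow> set (take (card (S ! j)) numbering) = S ! j"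
proof -
  assume j: "j < length S"
  have "concat member_lists = concat (take (Suc j) member_lists) @ concat (drop (Suc j) member_lists)"
    by (metis append_take_drop_id concat_append)
  then obtain ys where ys: "numbering = dedup (concat (take (Suc j) member_lists)) @ ys"
    using dedup_append by metis
  have "length (dedup (concat (take (Suc j) member_lists))) = card (S ! j)"
    using distinct_card[OF dedup_correct(1)] dedup_correct(2) set_member_lists[OF j] by metis
  then show ?thesis using ys dedup_correct(2) set_member_lists[OF j] by simp
qed

lemma set_numbering: "set numbering = {..<n}"
proof -
  have "take (Suc (length S - 1)) member_lists = member_lists" using length_S_pos by simp
  then show ?thesis
    using set_member_lists[of "length S - 1"] last_S length_S_pos dedup_correct(2) by simp
qed

lemma numbering_perms: "numbering \<in> perms n"
proof -
  have "length numbering = n"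
    using distinct_card[OF dedup_correct(1), of "concat member_lists"] set_numbering by simp
  then show ?thesis using set_numbering dedup_correct(1)[of "concat member_lists"] by (auto simp: perms_def maps_def simp del: perms_maps)
qed

lemma numbering_less: "x < n \<Longrightarrow> get numbering x < n"
  using get_maps_lt[OF perms_maps[OF numbering_perms]] .

lemma numbering_in_iff:
  assumes j: "j < length S" and x: "x < n"
  shows "get numbering x \<in> S ! j \<longleftrightarrow> x < sizes ! j"
proof -
  have len: "length numbering = n" using perms_maps[OF numbering_perms] by (simp add: maps_def)
  define m where "m = card (S ! j)"
  have le: "m \<le> n" using card_mono[OF _ S_subset[OF j]] by (simp add: m_def)
  have "S ! j = (!) numbering ` {0..<m}"
    using numbering_take[OF j] nth_image[of m numbering] len le by (simp add: m_def)
  also have "\<dots> = get numbering ` {0..<m}"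
    using len le by (intro image_cong) (simp_all add: nth_default_eq)
  finally have eq: "S ! j = get numbering ` {0..<m}" .
  have "get numbering x \<in> S ! j \<longleftrightarrow> (\<exists>y < m. get numbering x = get numbering y)"
    unfolding eq by auto
  also have "\<dots> \<longleftrightarrow> x < m"
    using perms_inj[OF numbering_perms x] le by (metis order_less_le_trans)
  finally show ?thesis using j by (simp add: m_def)
qed

lemma pinv_numbering_less:
  assumes j: "j < length S" and x: "x \<in> S ! j"
  shows "get (pinv n numbering) x < sizes ! j"
proof -
  have xn: "x < n" using S_subset[OF j] x by auto
  then show ?thesis
    using numbering_in_iff[OF j get_maps_lt[OF pinv_maps xn], of numbering] numbering_perms x by simp
qed

lemma mul_table: "x < n \<Longrightarrow> y < n \<Longrightarrow>
    mul table x y = get (pinv n numbering) (get numbering x \<otimes> get numbering y)"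
  using mul_relabel[OF numbering_perms] mul_mult_table numbering_less by simp

lemma get_mul_table: "x < n \<Longrightarrow> y < n \<Longrightarrow>
    get numbering (mul table x y) = get numbering x \<otimes> get numbering y"
  using mul_table mult_table_closed numbering_less numbering_perms by simp

lemma mul_table_less: "x < n \<Longrightarrow> y < n \<Longrightarrow> mul table x y < n"
  using mul_table mult_table_closed numbering_less get_maps_lt[OF pinv_maps] by simp

lemma numbering_eqD: "x < n \<Longrightarrow> y < n \<Longrightarrow> get numbering x = get numbering y \<Longrightarrow> x = y"
  using perms_inj[OF numbering_perms] by blast

lemma n_pos: "0 < n"
  using one_closed carrier by (metis lessThan_iff gr_implies_not0 neq0_conv)

lemma numbering_0: "get numbering 0 = \<one>"
  using numbering_in_iff[OF length_S_pos n_pos] subnormal_seriesD(2)[OF series] length_S_pos by simp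

lemma sizes_less: "j < length S \<Longrightarrow> x < sizes ! j \<Longrightarrow> x < n"
  using card_mono[OF _ S_subset, of j] by simp

lemma chain_table: "chain_table n table sizes"
proof
  show "sizes \<noteq> []" using length_S_pos by simp
  show "sizes ! 0 = 1" using subnormal_seriesD(2)[OF series] length_S_pos by simp
  show "sizes ! (length sizes - 1) = n" using last_S length_S_pos by simp
next
  fix i j assume "i \<le> j" "j < length sizes"
  then show "sizes ! i \<le> sizes ! j"
    using card_mono[OF S_finite subnormal_series_mono[OF series], of j i] by simp
next
  fix i x y assume *: "i < length sizes" "x < sizes ! i" "y < sizes ! i"
  have i: "i < length S" using * by simp
  have n: "x < n" "y < n" using sizes_less[OF i] * by auto
  have "get numbering x \<otimes> get numbering y \<in> S ! i"
    using numbering_in_iff[OF i] n * subgroup.m_closed[OF subnormal_series_subgroup[OF series i]] by simp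
  then show "mul table x y < sizes ! i" unfolding mul_table[OF n] by (rule pinv_numbering_less[OF i])
next
  fix i x assume *: "i < length sizes" "x < sizes ! i"
  have i: "i < length S" using * by simp
  have n: "x < n" using sizes_less[OF i] * by auto
  have sx: "get numbering x \<in> S ! i" using numbering_in_iff[OF i n] * by simp
  let ?y = "get (pinv n numbering) (inv (get numbering x))"
  have "inv (get numbering x) \<in> S ! i"
    using subgroup.m_inv_closed[OF subnormal_series_subgroup[OF series i] sx] .
  then have y: "?y < sizes ! i" "?y < n" "get numbering ?y = inv (get numbering x)"
    using pinv_numbering_less[OF i] sizes_less[OF i] S_subset[OF i] numbering_perms by auto
  have sc: "get numbering x \<in> carrier G" using numbering_less[OF n] carrier by simp
  have "get numbering (mul table x ?y) = get numbering 0" "get numbering (mul table ?y x) = get numbering 0"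
    using get_mul_table[OF n y(2)] get_mul_table[OF y(2) n] sc by (simp_all add: y(3) numbering_0)
  then have "mul table x ?y = 0" "mul table ?y x = 0"
    using numbering_eqD[OF mul_table_less[OF n y(2)] n_pos]
      numbering_eqD[OF mul_table_less[OF y(2) n] n_pos] by blast+
  with y(1) show "\<exists>y<sizes ! i. mul table x y = 0 \<and> mul table y x = 0" by blast
next
  fix x y z assume *: "x < n" "y < n" "z < n"
  have c: "get numbering x \<in> carrier G" "get numbering y \<in> carrier G" "get numbering z \<in> carrier G"
    using numbering_less * carrier by auto
  have "get numbering (mul table (mul table x y) z) = get numbering (mul table x (mul table y z))"
    using * mul_table_less c by (simp add: get_mul_table m_assoc)
  then show "mul table (mul table x y) z = mul table x (mul table y z)"
    by (rule numbering_eqD[rotated 2]) (intro mul_table_less *)+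
next
  fix x assume x: "x < n"
  have c: "get numbering x \<in> carrier G" using numbering_less x carrier by auto
  have "get numbering (mul table 0 x) = get numbering x" "get numbering (mul table x 0) = get numbering x"
    using get_mul_table x n_pos c by (simp_all add: numbering_0)
  then show "mul table 0 x = x" "mul table x 0 = x"
    using numbering_eqD[OF mul_table_less[OF n_pos x] x] numbering_eqD[OF mul_table_less[OF x n_pos] x]
    by blast+
next
  fix i x z assume *: "Suc i < length sizes" "x < sizes ! Suc i" "z < sizes ! i"
  have i: "Suc i < length S" "i < length S" using * by auto
  have n: "x < n" "z < n" using sizes_less[OF i(1)] sizes_less[OF i(2)] * by auto
  have s: "get numbering x \<in> S ! Suc i" "get numbering z \<in> S ! i"
    using numbering_in_iff i n * by auto
  have "S ! i #>\<^bsub>G\<lparr>carrier := S ! Suc i\<rparr>\<^esub> get numbering x =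
      get numbering x <#\<^bsub>G\<lparr>carrier := S ! Suc i\<rparr>\<^esub> S ! i"
    using normal.coset_eq[OF subnormal_seriesD(4)[OF series i(1)]] s(1) by simp
  then have "get numbering z \<otimes> get numbering x \<in> (\<lambda>h. get numbering x \<otimes> h) ` (S ! i)"
    using s(2) by (auto simp: r_coset_def l_coset_def)
  then obtain v where v: "v \<in> S ! i" "get numbering z \<otimes> get numbering x = get numbering x \<otimes> v" by blast
  let ?w = "get (pinv n numbering) v"
  have w: "?w < sizes ! i" "get numbering ?w = v"
    using pinv_numbering_less[OF i(2) v(1)] S_subset[OF i(2)] v(1) numbering_perms by auto
  have wn: "?w < n" using sizes_less[OF i(2) w(1)] .
  have "get numbering (mul table z x) = get numbering (mul table x ?w)"
    using get_mul_table n wn v(2) w(2) by simp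
  then have "mul table z x = mul table x ?w"
    by (rule numbering_eqD[OF mul_table_less[OF n(2,1)] mul_table_less[OF n(1) wn]])
  with w(1) show "\<exists>w<sizes ! i. mul table z x = mul table x w" by blast
qed

text \<open>Strict inclusions force \<open>i < card (S ! i)\<close>. This is needed to bound the
  size of the input by a polynomial in n.\<close>

lemma length_S_le: "length S \<le> n"
proof -
  have "i < length S \<Longrightarrow> i < card (S ! i)" for i
  proof (induction i)
    case 0 then show ?case using subnormal_seriesD(2)[OF series] by simp
  next
    case (Suc i)
    then show ?case
      using psubset_card_mono[OF S_finite[OF Suc.prems] subnormal_series_step[OF series Suc.prems]] by simp
  qed
  from this[of "length S - 1"] show ?thesis using last_S length_S_pos by simp
qed

text \<open>By Lagrange, the number of representatives is the order of the factor; through this,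
  \<alpha> bounds the exponent of n in the fuel.\<close>

lemma transversal_length_le:
  assumes i: "Suc i < length S" and a: "\<forall>F \<in> series_factors G S. order F \<le> \<alpha>"
  shows "length (transversal table (sizes ! i) (sizes ! Suc i)) \<le> \<alpha>"
proof -
  interpret c: chain_table n table sizes by (rule chain_table)
  have "length (transversal table (sizes ! i) (sizes ! Suc i)) * sizes ! i = sizes ! Suc i"
    using i by (intro c.coset_reps_length c.transversal_correct) simp_all
  also have "\<dots> = order (G\<lparr>carrier := S ! Suc i\<rparr> Mod (S ! i)) * sizes ! i"
    using subnormal_series_factor_order[OF series i] i carrier by simp
  finally have "length (transversal table (sizes ! i) (sizes ! Suc i)) =
      order (G\<lparr>carrier := S ! Suc i\<rparr> Mod (S ! i))"
    using c.K_pos[of i] i by simp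
  moreover have "G\<lparr>carrier := S ! Suc i\<rparr> Mod (S ! i) \<in> series_factors G S"
    using i by (auto simp: series_factors_def)
  ultimately show ?thesis using a by simp
qed

end

lemma series_isomorphic_sizes:
  assumes "presented_series G n S" "presented_series H n S'" "series_isomorphic G S H S'"
  shows "map length (map sorted_list_of_set S) = map length (map sorted_list_of_set S')"
proof -
  interpret G: presented_series G n S by fact
  interpret H: presented_series H n S' by fact
  obtain \<phi> where len: "length S = length S'" and \<phi>: "\<phi> \<in> iso G H" "\<forall>i < length S. \<phi> ` (S ! i) = S' ! i"
    using assms(3) by (auto simp: series_isomorphic_def)
  have "inj_on \<phi> {..<n}" using \<phi>(1) by (simp add: iso_def bij_betw_def G.carrier)
  then have "card (S ! i) = card (S' ! i)" if "i < length S" for i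
    using \<phi>(2) that card_image inj_on_subset G.S_subset[OF that] by metis
  then show ?thesis using len by (intro nth_equalityI) simp_all
qed

text \<open>With s and s' the numberings of the two groups, \<phi> corresponds to f = s'^-1 \<phi>
  s.\<close>

lemma series_isomorphic_iff_isos:
  assumes "presented_series G n S" "presented_series H n S'"
    and K: "K = map length (map sorted_list_of_set S)" "K = map length (map sorted_list_of_set S')"
  shows "series_isomorphic G S H S' \<longleftrightarrow>
    isos n (relabel n (mult_table G) (dedup (concat (map sorted_list_of_set S))))
      (relabel n (mult_table H) (dedup (concat (map sorted_list_of_set S')))) K (length K - 1) \<noteq> {}"
    (is "_ \<longleftrightarrow> isos n ?g ?h K ?m \<noteq> {}")
proof -
  interpret G: presented_series G n S by fact
  interpret H: presented_series H n S' by fact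
  interpret c: chain_table n ?g K unfolding K(1) by (rule G.chain_table)
  let ?s = G.numbering and ?s' = H.numbering
  have len: "length S = length K" "length S' = length K" using arg_cong[OF K(1), of length] arg_cong[OF K(2), of length] by simp_all
  note sp = G.numbering_perms and sp' = H.numbering_perms
  have inS: "get ?s x \<in> S ! j \<longleftrightarrow> x < K ! j" if "j < length K" "x < n" for j x
    using G.numbering_in_iff[of j x] that unfolding len(1) K(1)[symmetric] by blast
  have inS': "get ?s' x \<in> S' ! j \<longleftrightarrow> x < K ! j" if "j < length K" "x < n" for j x
    using H.numbering_in_iff[of j x] that unfolding len(2) K(2)[symmetric] by blast
  have SK: "S ! j = get ?s ` {..<K ! j}" if j: "j < length K" for j
  proof
    show "S ! j \<subseteq> get ?s ` {..<K ! j}"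
    proof
      fix x assume x: "x \<in> S ! j"
      then have "x < n" using G.S_subset j len by auto
      then obtain y where y: "y < n" "get ?s y = x" by (rule perms_surj[OF sp])
      then show "x \<in> get ?s ` {..<K ! j}" using inS[OF j y(1)] x by auto
    qed
    show "get ?s ` {..<K ! j} \<subseteq> S ! j" using inS[OF j] c.less_K_less_n[OF j] by auto
  qed
  show ?thesis
  proof
    assume "series_isomorphic G S H S'"
    then obtain \<phi> where \<phi>: "\<phi> \<in> iso G H" "\<And>i. i < length S \<Longrightarrow> \<phi> ` (S ! i) = S' ! i"
      by (auto simp: series_isomorphic_def)
    have hom: "\<phi> (x \<otimes>\<^bsub>G\<^esub> y) = \<phi> x \<otimes>\<^bsub>H\<^esub> \<phi> y" if "x < n" "y < n" for x y
      using \<phi>(1) that by (auto simp: iso_def hom_def G.carrier)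
    have bij: "bij_betw \<phi> {..<n} {..<n}" using \<phi>(1) by (simp add: iso_def G.carrier H.carrier)
    have \<phi>n: "\<phi> x < n" if "x < n" for x using bij that by (auto simp: bij_betw_def)
    define f where "f = map (\<lambda>x. get (pinv n ?s') (\<phi> (get ?s x))) [0..<n]"
    have fx: "get f x = get (pinv n ?s') (\<phi> (get ?s x))" if "x < n" for x using that by (simp add: f_def)
    have fm: "f \<in> maps n"
      using get_maps_lt[OF pinv_maps] \<phi>n G.numbering_less by (auto simp: f_def maps_def)
    have sf: "get ?s' (get f x) = \<phi> (get ?s x)" if "x < n" for x
      using fx[OF that] sp' \<phi>n G.numbering_less that by simp
    have "f \<in> isos n ?g ?h K ?m"
    proof (rule isosI)
      show "f \<in> perms n" unfolding perms_iff
      proof (intro conjI fm allI impI)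
        fix x y assume xy: "x < n" "y < n" "get f x = get f y"
        then have "\<phi> (get ?s x) = \<phi> (get ?s y)" using sf by metis
        then have "get ?s x = get ?s y"
          using bij G.numbering_less xy by (auto simp: bij_betw_def inj_on_def)
        then show "x = y" using G.numbering_eqD xy by blast
      qed
      fix x y assume "x < K ! ?m" "y < K ! ?m"
      then have n: "x < n" "y < n" using c.K_last by auto
      have "get ?s' (get f (mul ?g x y)) = get ?s' (mul ?h (get f x) (get f y))"
        using n G.mul_table_less[OF n] get_maps_lt[OF fm] G.get_mul_table[OF n] G.numbering_less
        by (simp add: sf hom H.get_mul_table)
      then show "get f (mul ?g x y) = mul ?h (get f x) (get f y)"
        by (rule H.numbering_eqD[OF get_maps_lt[OF fm G.mul_table_less[OF n]]
              H.mul_table_less[OF get_maps_lt[OF fm n(1)] get_maps_lt[OF fm n(2)]]])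
    next
      fix j x assume j: "j \<le> ?m" and x: "x < K ! j"
      have j': "j < length K" using j c.last_index by simp
      have xn: "x < n" using c.less_K_less_n[OF j' x] .
      have "\<phi> (get ?s x) \<in> S' ! j" using inS[OF j' xn] x \<phi>(2)[of j] j' len by auto
      then have "get ?s' (get f x) \<in> S' ! j" using sf[OF xn] by simp
      then show "get f x < K ! j" using inS'[OF j' get_maps_lt[OF fm xn]] by simp
    qed (use c.K_last in simp)
    then show "isos n ?g ?h K ?m \<noteq> {}" by blast
  next
    assume "isos n ?g ?h K ?m \<noteq> {}"
    then obtain f where f: "f \<in> isos n ?g ?h K ?m" by blast
    have fp: "f \<in> perms n" using isosD(1)[OF f] .
    define \<phi> where "\<phi> x = get ?s' (get f (get (pinv n ?s) x))" for x
    have \<phi>s: "\<phi> (get ?s x) = get ?s' (get f x)" if "x < n" for x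
      using sp that by (simp add: \<phi>_def)
    have fn: "get f x < n" if "x < n" for x using get_maps_lt[OF perms_maps[OF fp] that] .
    have fK: "get f ` {..<K ! j} = {..<K ! j}" if j: "j < length K" for j
    proof
      show "get f ` {..<K ! j} \<subseteq> {..<K ! j}" using c.isos_less[OF f c.last_index j] by auto
      show "{..<K ! j} \<subseteq> get f ` {..<K ! j}"
      proof
        fix x assume "x \<in> {..<K ! j}"
        then have x: "x < K ! j" by simp
        obtain y where y: "y < n" "get f y = x" by (rule perms_surj[OF fp c.less_K_less_n[OF j x]])
        then show "x \<in> get f ` {..<K ! j}" using c.isos_less_iff[OF f c.last_index j y(1)] x by auto
      qed
    qed
    have S'K: "S' ! j = get ?s' ` {..<K ! j}" if j: "j < length K" for j
    proof
      show "S' ! j \<subseteq> get ?s' ` {..<K ! j}"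
      proof
        fix x assume x: "x \<in> S' ! j"
        then have "x < n" using H.S_subset j len by auto
        then obtain y where y: "y < n" "get ?s' y = x" by (rule perms_surj[OF sp'])
        then show "x \<in> get ?s' ` {..<K ! j}" using inS'[OF j y(1)] x by auto
      qed
      show "get ?s' ` {..<K ! j} \<subseteq> S' ! j" using inS'[OF j] c.less_K_less_n[OF j] by auto
    qed
    have img: "\<phi> ` (S ! j) = S' ! j" if j: "j < length K" for j
    proof -
      have "\<phi> ` (S ! j) = (\<lambda>x. get ?s' (get f x)) ` {..<K ! j}"
        unfolding SK[OF j] image_image using \<phi>s c.less_K_less_n[OF j] by (intro image_cong) auto
      also have "\<dots> = get ?s' ` (get f ` {..<K ! j})" by (simp only: image_image)
      finally show ?thesis unfolding fK[OF j] S'K[OF j] .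
    qed
    have m: "length S - 1 < length K" "length S' - 1 < length K" using c.last_index len by auto
    have img_n: "\<phi> ` {..<n} = {..<n}"
      using img[OF m(1)] G.last_S H.last_S len by simp
    have "\<phi> \<in> iso G H"
      unfolding iso_def mem_Collect_eq
    proof (intro conjI homI)
      show "\<phi> x \<in> carrier H" if "x \<in> carrier G" for x using img_n that by (auto simp: G.carrier H.carrier)
      fix x y assume "x \<in> carrier G" "y \<in> carrier G"
      then have xy: "x < n" "y < n" by (auto simp: G.carrier)
      obtain a where a: "a < n" "get ?s a = x" by (rule perms_surj[OF sp xy(1)])
      obtain b where b: "b < n" "get ?s b = y" by (rule perms_surj[OF sp xy(2)])
      have "\<phi> (x \<otimes>\<^bsub>G\<^esub> y) = get ?s' (get f (mul ?g a b))"
        using \<phi>s[OF G.mul_table_less[OF a(1) b(1)]] G.get_mul_table[OF a(1) b(1)] a(2) b(2) by simp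
      also have "\<dots> = get ?s' (mul ?h (get f a) (get f b))"
        using isosD(2)[OF f, of a b] a(1) b(1) c.K_last by simp
      also have "\<dots> = \<phi> x \<otimes>\<^bsub>H\<^esub> \<phi> y"
        using H.get_mul_table[OF fn[OF a(1)] fn[OF b(1)]] \<phi>s[OF a(1)] \<phi>s[OF b(1)] a(2) b(2) by simp
      finally show "\<phi> (x \<otimes>\<^bsub>G\<^esub> y) = \<phi> x \<otimes>\<^bsub>H\<^esub> \<phi> y" .
    next
      have "inj_on \<phi> {..<n}" by (rule eq_card_imp_inj_on) (simp_all add: img_n)
      then show "bij_betw \<phi> (carrier G) (carrier H)"
        using img_n by (simp add: bij_betw_def G.carrier H.carrier)
    qed
    then show "series_isomorphic G S H S'"
      using img len by (auto simp: series_isomorphic_def)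
  qed
qed


section \<open>The complete program and its running time\<close>

section \<open>The decision procedure\<close>

definition instance_of :: "nat monoid \<Rightarrow> nat set list \<Rightarrow> nat monoid \<Rightarrow> nat set list \<Rightarrow> instance_data" where
  "instance_of G S H S' =
     (mult_table G, map sorted_list_of_set S, mult_table H, map sorted_list_of_set S', ())"

definition fuel :: "instance_data \<Rightarrow> nat" where
  "fuel d = length (fst d) ^ max_index d"

lemma enc_instance: "enc (instance_of G S H S') = enc_input G S H S'"
proof -
  have 1: "enc = (\<lambda>l :: nat list. enc_list enc_nat l)"
    unfolding enc_list_def'[abs_def] enc_nat_def[abs_def] ..
  have "enc l = enc_list (enc_list enc_nat) l" for l :: "nat list list"
    unfolding enc_list_def' 1 ..
  moreover have "enc_list f (map h l) = enc_list (\<lambda>x. f (h x)) l" for f and h :: "nat set \<Rightarrow> nat list" and l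
    by (simp add: enc_list_def foldr_map o_def)
  ultimately show ?thesis
    by (simp add: instance_of_def enc_input_def enc_group_def enc_series_def enc_list_def[of "\<lambda>x. x"])
qed

lemma isomorphism_test_correct:
  assumes G: "presented_series G n S" and H: "presented_series H n S'"
  shows "isomorphism_test (instance_of G S H S', fuel (instance_of G S H S')) \<longleftrightarrow>
    series_isomorphic G S H S'"
proof -
  interpret G: presented_series G n S by (rule G)
  interpret H: presented_series H n S' by (rule H)
  let ?d = "instance_of G S H S'"
  have len: "length (mult_table G) = n" by (simp add: mult_table_def G.order_n)
  have max_ge: "k \<in> set l \<Longrightarrow> k \<le> foldl (\<lambda>m i :: nat. if m < i then i else m) 0 l" for k l
    by (induction l rule: rev_induct) auto
  have M: "n ^ length (transversal G.table (G.sizes ! j) (G.sizes ! Suc j)) \<le> fuel ?d"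
    if j: "Suc j < length G.sizes" for j
  proof -
    have "(take (Suc j) G.sizes, G.sizes ! j, G.sizes ! Suc j) \<in> set (levels G.sizes)"
    proof -
      have "(take (Suc j) G.sizes, get G.sizes j, get G.sizes (Suc j)) \<in> set (levels G.sizes)"
        unfolding levels_def set_map by (rule imageI) (use j in simp)
      then show ?thesis using j by (simp only: nth_default_eq) simp
    qed
    then have "length (transversal G.table (G.sizes ! j) (G.sizes ! Suc j)) \<le> max_index ?d"
      unfolding max_index_def instance_of_def fst_conv snd_conv len
      by (intro max_ge) (force simp: image_iff)
    then show ?thesis
      unfolding fuel_def using G.n_pos by (simp add: instance_of_def len power_increasing)
  qed
  show ?thesis
  proof (cases "G.sizes = H.sizes")
    case True
    have "chain_table n H.table G.sizes" unfolding True by (rule H.chain_table)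
    from chain_table.chain_isomorphic_iff[OF G.chain_table M this]
    have "chain_isomorphic n (fuel ?d) G.table H.table G.sizes \<longleftrightarrow> series_isomorphic G S H S'"
      using series_isomorphic_iff_isos[OF G H refl True] by simp
    then show ?thesis using True by (simp add: isomorphism_test_def instance_of_def len)
  next
    case False
    then show ?thesis
      using series_isomorphic_sizes[OF G H] by (auto simp: isomorphism_test_def instance_of_def)
  qed
qed

lemma polytime_times: "polytime f \<Longrightarrow> polytime g \<Longrightarrow> polytime (\<lambda>x. f x * (g x :: nat))"
proof (rule polytime_app2[of "(*)"])
  have "polytime (\<lambda>p :: nat \<times> nat. length (concat (map (\<lambda>_. replicate (snd p) ()) (replicate (fst p) ()))))"
    by (intro polytime_intros)
  then show "polytime (\<lambda>p :: nat \<times> nat. fst p * snd p)"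
    by (simp add: length_concat o_def sum_list_replicate map_replicate_const)
qed

lemma foldl_power: "foldl (\<lambda>m _. m * b) a (replicate k ()) = a * b ^ k" for a b :: nat
  by (induction k arbitrary: a) simp_all

text \<open>The fuel is exponential in \<open>max_index\<close>, so the closure of
  \<open>polytime\<close> under composition cannot be used for it. It is a fold of multiplications,
  whose largest state controls both its time and its result; the polynomial test applied to it then
  stays polynomial in \<open>sz d\<close> plus that state.\<close>

lemma time_bounded_fuel:
  "\<exists>C. time_bounded (\<lambda>d. isomorphism_test (d, fuel d))
    (\<lambda>d. (sz d + max_state (\<lambda>m _. m * length (fst d)) 1 (replicate (max_index d) ())) ^ C)"
proof -
  let ?a = "\<lambda>d :: instance_data. (length (fst d), 1 :: nat, replicate (max_index d) ())"
  let ?m = "\<lambda>d :: instance_data. max_state (\<lambda>m _. m * length (fst d)) (1 :: nat) (replicate (max_index d) ())"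
  have a: "polytime ?a" by (intro polytime_intros polytime_max_index)
  obtain c where c: "time_bounded (\<lambda>p. foldl (\<lambda>m (_ :: unit). m * fst p) (fst (snd p)) (snd (snd p)))
    (\<lambda>p :: nat \<times> nat \<times> unit list. (sz p + max_state (\<lambda>m _. m * fst p) (fst (snd p)) (snd (snd p))) ^ c)"
  proof -
    have "polytime (\<lambda>p :: nat \<times> nat \<times> unit. fst (snd p) * fst p)"
      by (intro polytime_times polytime_fst polytime_snd polytime_id)
    from time_bounded_foldl[where f = "\<lambda>(b :: nat) m (_ :: unit). m * b", OF this] that
    show thesis by blast
  qed
  obtain T1 where T1: "poly_bounded T1" "time_bounded ?a T1" using a by (auto simp: polytime_def)
  obtain T2 where T2: "poly_bounded T2" "time_bounded (\<lambda>d :: instance_data. d) T2"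
    using polytime_id by (auto simp: polytime_def)
  obtain T3 where T3: "poly_bounded T3" "time_bounded isomorphism_test T3"
    using polytime_isomorphism_test by (auto simp: polytime_def)
  have "time_bounded fuel (\<lambda>d. T1 d + (sz (?a d) + ?m d) ^ c + 3)"
    using time_bounded_comp[OF c T1(2)] by (simp add: foldl_power fuel_def[abs_def])
  from time_bounded_comp[OF T3(2) time_bounded_Pair[OF T2(2) this]]
  have tb: "time_bounded (\<lambda>d. isomorphism_test (d, fuel d))
    (\<lambda>d. (T2 d + (T1 d + (sz (?a d) + ?m d) ^ c + 3) + 5) + T3 (d, fuel d) + 3)" .
  obtain c1 where c1: "\<And>d. T1 d \<le> sz d ^ c1" using T1(1) by (auto simp: poly_bounded_def)
  obtain c2 where c2: "\<And>d. T2 d \<le> sz d ^ c2" using T2(1) by (auto simp: poly_bounded_def)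
  obtain c3 where c3: "\<And>p. T3 p \<le> sz p ^ c3" using T3(1) unfolding poly_bounded_def by blast
  obtain c4 where c4: "\<And>d. sz (?a d) \<le> sz d ^ c4"
    using poly_bounded_sz[OF a] unfolding poly_bounded_def by blast
  \<comment> \<open>The sum dominates each of the four exponents that occur; the final 4 pays for
    the numerical constants through 256 = 4^4 and \<open>4 \<le> ?B\<close>.\<close>
  define C where "C = c1 + c2 + c3 + (c4 + 1) * c + 4"
  have "(T2 d + (T1 d + (sz (?a d) + ?m d) ^ c + 3) + 5) + T3 (d, fuel d) + 3 \<le> (sz d + ?m d) ^ C" for d
  proof -
    let ?B = "sz d + ?m d"
    have fm: "sz (fuel d) \<le> ?m d"
      using max_state_ge[of "max_index d" "replicate (max_index d) ()" "\<lambda>m _. m * length (fst d)" 1]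
      by (simp add: foldl_power fuel_def)
    have B: "4 \<le> ?B" using sz_ge_2[of d] sz_ge_2[of "fuel d"] fm by linarith
    let ?E = "?B ^ (c1 + c2 + c3 + (c4 + 1) * c)"
    have "T1 d \<le> ?E"
      using B by (intro order_trans[OF c1] order_trans[OF power_mono[of "sz d" ?B]] power_increasing) simp_all
    moreover have "T2 d \<le> ?E"
      using B by (intro order_trans[OF c2] order_trans[OF power_mono[of "sz d" ?B]] power_increasing) simp_all
    moreover have "T3 (d, fuel d) \<le> ?E"
    proof -
      have "sz (d, fuel d) \<le> ?B" using sz_Pair[of d "fuel d"] fm by linarith
      then show ?thesis
        using B by (intro order_trans[OF c3] order_trans[OF power_mono[of "sz (d, fuel d)" ?B]] power_increasing) simp_all
    qed
    moreover have "(sz (?a d) + ?m d) ^ c \<le> ?E"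
    proof -
      have "sz (?a d) \<le> ?B ^ c4"
        by (rule order_trans[OF c4 power_mono]) simp_all
      moreover have "?m d \<le> ?B ^ (c4 + 1) - ?B ^ c4"
      proof -
        have "?m d + ?B ^ c4 \<le> ?B * ?B ^ c4"
        proof -
          have one: "1 \<le> ?B ^ c4" by (rule one_le_power) (use B in linarith)
          have "?m d + 1 \<le> ?B" using sz_ge_2[of d] by linarith
          have "?m d * 1 + 1 * ?B ^ c4 \<le> ?m d * ?B ^ c4 + 1 * ?B ^ c4"
            by (intro add_mono mult_le_mono one order_refl)
          also have "\<dots> = (?m d + 1) * ?B ^ c4" by (simp add: algebra_simps)
          also have "\<dots> \<le> ?B * ?B ^ c4" using \<open>?m d + 1 \<le> ?B\<close> by (rule mult_le_mono1)
          finally show ?thesis by simp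
        qed
        then show ?thesis by simp
      qed
      ultimately have "sz (?a d) + ?m d \<le> ?B ^ (c4 + 1)"
        using power_increasing[of c4 "c4 + 1" ?B] B by linarith
      then have "(sz (?a d) + ?m d) ^ c \<le> (?B ^ (c4 + 1)) ^ c" by (rule power_mono) simp
      also have "\<dots> = ?B ^ ((c4 + 1) * c)" by (rule power_mult[symmetric])
      also have "\<dots> \<le> ?E" using B by (intro power_increasing) simp_all
      finally show ?thesis .
    qed
    ultimately have "(T2 d + (T1 d + (sz (?a d) + ?m d) ^ c + 3) + 5) + T3 (d, fuel d) + 3 \<le> 4 * ?E + 11"
      by linarith
    also have "\<dots> \<le> ?E * 256"
    proof -
      have "1 \<le> ?E" by (rule one_le_power) (use B in linarith)
      then show ?thesis by linarith
    qed
    also have "\<dots> \<le> ?E * ?B ^ 4"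
      using power_mono[OF B, of 4] by (intro mult_le_mono2) simp
    also have "\<dots> = ?B ^ C" by (simp add: C_def power_add)
    finally show ?thesis .
  qed
  from time_bounded_mono[OF tb this] show ?thesis by blast
qed

lemma sz_instance_le:
  assumes G: "presented_series G n S" and H: "presented_series H n S'"
  shows "sz (instance_of G S H S') \<le> 31 * n ^ 3"
proof -
  let ?e = "2 + n * (2 + n * (n + 2))"
  have t: "sz (mult_table G) \<le> ?e" if "presented_series G n S" for G S
  proof -
    interpret presented_series G n S by fact
    have len: "length (mult_table G) = n" by (simp add: mult_table_def order_n)
    have "sz (mult_table G) \<le> 2 + length (mult_table G) * (2 + n * (n + 2))"
    proof (rule sz_list_le)
      fix r assume "r \<in> set (mult_table G)"
      then obtain x where x: "x < n" "r = map (\<lambda>y. x \<otimes>\<^bsub>G\<^esub> y) [0..<n]" by (auto simp: mult_table_def order_n)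
      have "sz r \<le> 2 + length r * (n + 2)"
        by (rule sz_list_le) (use x mult_table_closed in \<open>auto simp: sz_nat intro: less_imp_le\<close>)
      then show "sz r \<le> 2 + n * (n + 2)" using x(2) by simp
    qed
    then show ?thesis using len by simp
  qed
  have s: "sz (map sorted_list_of_set S) \<le> ?e" if "presented_series G n S" for G S
  proof -
    interpret presented_series G n S by fact
    have "sz member_lists \<le> 2 + length member_lists * (2 + n * (n + 2))"
    proof (rule sz_list_le)
      fix r assume "r \<in> set member_lists"
      then obtain i where i: "i < length S" "r = sorted_list_of_set (S ! i)" by (auto simp: in_set_conv_nth)
      have sub: "set r \<subseteq> {..<n}" using i S_subset[OF i(1)] S_finite[OF i(1)] by simp
      have "sz r \<le> 2 + length r * (n + 2)"
        by (rule sz_list_le) (use sub in \<open>auto simp: sz_nat intro: less_imp_le\<close>)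
      also have "\<dots> \<le> 2 + n * (n + 2)"
        using card_mono[OF _ S_subset[OF i(1)]] i(2) by (intro add_left_mono mult_le_mono1) simp
      finally show "sz r \<le> 2 + n * (n + 2)" .
    qed
    also have "\<dots> \<le> ?e" using length_S_le by (intro add_left_mono mult_le_mono1) simp
    finally show ?thesis .
  qed
  interpret G: presented_series G n S by (rule G)
  have "sz (instance_of G S H S') \<le> 4 * ?e + 2"
    using t[OF G] t[OF H] s[OF G] s[OF H]
    by (simp add: instance_of_def sz_def)
  \<comment> \<open>The coefficients of the expanded left-hand side add up to 30, and n is at least
    1.\<close>
  also have "\<dots> \<le> 31 * n ^ 3"
  proof -
    have "1 \<le> n" using G.n_pos by simp
    then have "n \<le> n ^ 3" "n ^ 2 \<le> n ^ 3" "1 \<le> n ^ 3"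
      using power_increasing[of 1 3 n] power_increasing[of 2 3 n] by simp_all
    moreover have "4 * ?e + 2 = 10 + 8 * n + 8 * n ^ 2 + 4 * n ^ 3"
      by (simp add: algebra_simps power2_eq_square power3_eq_cube)
    ultimately show ?thesis by linarith
  qed
  finally show ?thesis .
qed

lemma max_index_le:
  assumes G: "presented_series G n S" and a: "\<forall>F \<in> series_factors G S. order F \<le> \<alpha>"
  shows "max_index (instance_of G S H S') \<le> \<alpha>"
proof -
  interpret G: presented_series G n S by (rule G)
  have len: "length (mult_table G) = n" by (simp add: mult_table_def G.order_n)
  have max_le: "(\<And>k. k \<in> set l \<Longrightarrow> k \<le> \<alpha>) \<Longrightarrow> foldl (\<lambda>m i :: nat. if m < i then i else m) 0 l \<le> \<alpha>" for l
    by (induction l rule: rev_induct) auto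
  show ?thesis
    unfolding max_index_def instance_of_def fst_conv snd_conv len
  proof (rule max_le)
    fix k assume "k \<in> set (map (\<lambda>lv. length (transversal G.table (fst (snd lv)) (snd (snd lv)))) (levels G.sizes))"
    then obtain i where "i < length (tl G.sizes)"
      and k: "k = length (transversal G.table (get G.sizes i) (get G.sizes (Suc i)))"
      by (auto simp: levels_def simp del: length_tl)
    then have i: "Suc i < length S" by simp
    with k show "k \<le> \<alpha>" using G.transversal_length_le[OF i(1) a] by (simp add: nth_default_eq)
  qed
qed

theorem theorem4p12:
  "\<exists>(p :: prog) (c :: nat).
     \<forall>(n :: nat) (\<alpha> :: nat) (G :: nat monoid) (H :: nat monoid) (S :: nat set list) (S' :: nat set list).
       group G \<and> carrier G = {..<n} \<and> group H \<and> carrier H = {..<n} \<and>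
       composition_series G S \<and> composition_series H S' \<and>
       (\<forall>F \<in> series_factors G S \<union> series_factors H S'. order F \<le> \<alpha>) \<longrightarrow>
       decides_within p (enc_input G S H S') (series_isomorphic G S H S') (c * n ^ (c * \<alpha>))"
proof -
  obtain C where C: "time_bounded (\<lambda>d. isomorphism_test (d, fuel d))
    (\<lambda>d. (sz d + max_state (\<lambda>m _. m * length (fst d)) 1 (replicate (max_index d) ())) ^ C)"
    using time_bounded_fuel by blast
  then obtain p where p: "\<And>d. \<exists>t \<le> (sz d + max_state (\<lambda>m _. m * length (fst d)) 1 (replicate (max_index d) ())) ^ C.
      computes p (enc d) (enc (isomorphism_test (d, fuel d))) t"
    unfolding time_bounded_def by blast
  \<comment> \<open>The base 34 = 31 + 1 + 2 collects the coefficients of 31 n^3 + n^\<alpha> + 2.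
    The power \<open>34 ^ C\<close> serves as the factor, the summand \<open>4 * C\<close> as the
    exponent.\<close>
  define c where "c = 34 ^ C + 4 * C"
  show ?thesis
  proof (intro exI[of _ p] exI[of _ c] allI impI)
    fix n \<alpha> :: nat and G H :: "nat monoid" and S S' :: "nat set list"
    assume *: "group G \<and> carrier G = {..<n} \<and> group H \<and> carrier H = {..<n} \<and>
       composition_series G S \<and> composition_series H S' \<and>
       (\<forall>F \<in> series_factors G S \<union> series_factors H S'. order F \<le> \<alpha>)"
    then have G: "presented_series G n S" and H: "presented_series H n S'"
      by (simp_all add: presented_series_def presented_series_axioms_def composition_series_def)
    interpret G: presented_series G n S by (rule G)
    let ?d = "instance_of G S H S'"
    let ?m = "max_state (\<lambda>m _. m * length (fst ?d)) 1 (replicate (max_index ?d) ())"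
    have len: "length (fst ?d) = n" by (simp add: instance_of_def mult_table_def G.order_n)
    obtain t where t: "t \<le> (sz ?d + ?m) ^ C" "computes p (enc ?d) (enc (isomorphism_test (?d, fuel ?d))) t"
      using p by blast
    have n1: "1 \<le> n" using G.n_pos by simp
    have k: "max_index ?d \<le> \<alpha>" using max_index_le[OF G] * by blast
    have "?m \<le> n ^ \<alpha> + 2"
    proof (rule max_state_le)
      fix i assume "i \<le> length (replicate (max_index ?d) ())"
      then have "min i (max_index ?d) \<le> \<alpha>" using k by simp
      then have "n ^ min i (max_index ?d) \<le> n ^ \<alpha>" using n1 by (rule power_increasing)
      then show "sz (foldl (\<lambda>m _. m * length (fst ?d)) 1 (take i (replicate (max_index ?d) ()))) \<le> n ^ \<alpha> + 2"
        by (simp add: foldl_power len sz_nat)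
    qed
    then have "sz ?d + ?m \<le> 31 * n ^ 3 + (n ^ \<alpha> + 2)" using sz_instance_le[OF G H] by linarith
    also have "\<dots> \<le> 34 * n ^ (3 + \<alpha>)"
    proof -
      have "n ^ 3 \<le> n ^ (3 + \<alpha>)" "n ^ \<alpha> \<le> n ^ (3 + \<alpha>)" "1 \<le> n ^ (3 + \<alpha>)"
        using n1 by (simp_all add: power_increasing del: power_add)
      then show ?thesis by linarith
    qed
    finally have "(sz ?d + ?m) ^ C \<le> (34 * n ^ (3 + \<alpha>)) ^ C" by (rule power_mono) simp
    also have "\<dots> = 34 ^ C * n ^ ((3 + \<alpha>) * C)" by (simp add: power_mult_distrib power_mult)
    also have "\<dots> \<le> c * n ^ (c * \<alpha>)"
    proof (rule mult_le_mono)
      show "34 ^ C \<le> c" by (simp add: c_def)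
      show "n ^ ((3 + \<alpha>) * C) \<le> n ^ (c * \<alpha>)"
      \<comment> \<open>For n = 1 there may be no factors and \<alpha> may be 0, but both powers are
        then 1. For n > 1 a factor exists, so \<alpha> is at least 1 and 3 + \<alpha> \<le> 4
        \<alpha>.\<close>
      proof (cases "n = 1")
        case False
        have "length S \<noteq> 1"
        proof
          assume "length S = 1"
          then have "{\<one>\<^bsub>G\<^esub>} = {..<n}"
            using subnormal_seriesD(2)[OF G.series] G.last_S by simp
          then have "card {..<n} = 1" by (metis card.empty card_insert_disjoint empty_iff finite.emptyI One_nat_def)
          then show False using False by simp
        qed
        then have S1: "Suc 0 < length S" using G.length_S_pos by linarith
        let ?F = "G\<lparr>carrier := S ! Suc 0\<rparr> Mod (S ! 0)"
        have "order ?F * card (S ! 0) = card (S ! Suc 0)"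
          using G.subnormal_series_factor_order[OF G.series S1] G.carrier by simp
        moreover have "0 < card (S ! Suc 0)"
          using G.S_finite[OF S1] subgroup.one_closed[OF G.subnormal_series_subgroup[OF G.series S1]]
          by (auto simp: card_gt_0_iff)
        ultimately have "0 < order ?F" by (metis gr0I mult_0 less_irrefl)
        moreover have "?F \<in> series_factors G S" using S1 by (auto simp: series_factors_def)
        then have "order ?F \<le> \<alpha>" using * by blast
        ultimately have "1 \<le> \<alpha>" by linarith
        then have "(3 + \<alpha>) * C \<le> (4 * \<alpha>) * C" by (intro mult_le_mono1) simp
        also have "\<dots> \<le> c * \<alpha>" by (simp add: c_def algebra_simps)
        finally show ?thesis using n1 by (rule power_increasing)
      qed simp
    qed
    finally have "t \<le> c * n ^ (c * \<alpha>)" using t(1) by linarith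
    moreover have "(enc b \<noteq> Leaf) = b" for b by (cases b) simp_all
    ultimately show "decides_within p (enc_input G S H S') (series_isomorphic G S H S') (c * n ^ (c * \<alpha>))"
      using t(2) unfolding decides_within_def enc_instance isomorphism_test_correct[OF G H] by blast
  qed
qed

end
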